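(* Let $(M^{2n},g,J)$ be a $2n$-dimensional almost hermitian manifold. Then there exists a linear connection $\nabla$ with totally skew-symmetric torsion preserving the hermitian structure $(g,J)$ (i.e. $\nabla g=\nabla J=0$) if and only if the Nijenhuis tensor $N(X,Y,Z):=g(N(X,Y),Z)$ is a $3$-form. In this case the connection is unique and is determined by its torsion $$T(X,Y,Z)=-\,d\Omega(J(X),J(Y),J(Z))+N(X,Y,Z),$$ where $\Omega$ is the K\"ahler form.
   Context: $(M^{2n},g,J)$ is a Riemannian manifold with an almost complex structure $J$ such that $g(JX,JY)=g(X,Y)$. The K\"ahler form is $\Omega(X,Y)=g(X,JY)$ and the Nijenhuis tensor is $N(X,Y)=[JX,JY]-[X,Y]-J[JX,Y]-J[X,JY]$. The torsion of $\nabla$ is totally skew-symmetric if $T(X,Y,Z)=g(\nabla_XY-\nabla_YX-[X,Y],Z)$ is a $3$-form; then $g(\nabla_XY,Z)=g(\nabla^g_XY,Z)+\frac12T(X,Y,Z)$ with $\nabla^g$ the Levi-Civita connection. *)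

theory Defs
  imports "HOL-Analysis.Analysis"
begin

section \<open>Smooth functions on open subsets of Euclidean space\<close>

text \<open>Only used for open \<open>S\<close>. In finite dimension \<open>Ck_on k\<close> is the usual class of $k$ times
  continuously differentiable maps: all iterated directional derivatives up to order \<open>k\<close> exist and
  are continuous.\<close>

primrec Ck_on ::
  "nat \<Rightarrow> 'b::euclidean_space set \<Rightarrow> ('b \<Rightarrow> 'c::real_normed_vector) \<Rightarrow> bool" where
  "Ck_on 0 S f \<longleftrightarrow> continuous_on S f"
| "Ck_on (Suc k) S f \<longleftrightarrow>
     (\<forall>x\<in>S. f differentiable (at x)) \<and>
     (\<forall>v. Ck_on k S (\<lambda>x. frechet_derivative f (at x) v))"

definition smooth_on ::
  "'b::euclidean_space set \<Rightarrow> ('b \<Rightarrow> 'c::real_normed_vector) \<Rightarrow> bool" where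
  "smooth_on S f \<longleftrightarrow> (\<forall>k. Ck_on k S f)"


section \<open>Smooth manifolds\<close>

text \<open>A chart is a pair of its domain and its coordinate map; the values of the coordinate map
  outside the domain carry no meaning. An atlas need not be maximal.\<close>

type_synonym ('a, 'b) chart = "'a set \<times> ('a \<Rightarrow> 'b)"

definition chart_image :: "('a, 'b) chart \<Rightarrow> 'b set" where
  "chart_image c = snd c ` fst c"

definition chart_inv :: "('a, 'b) chart \<Rightarrow> 'b \<Rightarrow> 'a" where
  "chart_inv c = inv_into (fst c) (snd c)"

definition carrier :: "('a, 'b) chart set \<Rightarrow> 'a set" where
  "carrier A = (\<Union>c\<in>A. fst c)"

definition charts_at :: "('a, 'b) chart set \<Rightarrow> 'a \<Rightarrow> ('a, 'b) chart set" where
  "charts_at A p = {c \<in> A. p \<in> fst c}"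

locale smooth_manifold =
  fixes \<tau> :: "'a topology" and A :: "('a, 'b::euclidean_space) chart set"
  assumes Hausdorff: "Hausdorff_space \<tau>"
    and second_countable: "second_countable \<tau>"
    and covering: "carrier A = topspace \<tau>"
    and chart_open: "c \<in> A \<Longrightarrow> openin \<tau> (fst c)"
    and chart_image_open: "c \<in> A \<Longrightarrow> open (chart_image c)"
    and chart_homeomorphic: "c \<in> A \<Longrightarrow>
          homeomorphic_map (subtopology \<tau> (fst c)) (top_of_set (chart_image c)) (snd c)"
    and transition_smooth: "c \<in> A \<Longrightarrow> c' \<in> A \<Longrightarrow>
          smooth_on (snd c ` (fst c \<inter> fst c')) (snd c' \<circ> chart_inv c)"

definition smooth_fun :: "('a, 'b::euclidean_space) chart set \<Rightarrow> ('a \<Rightarrow> real) \<Rightarrow> bool" where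
  "smooth_fun A f \<longleftrightarrow> (\<forall>c\<in>A. smooth_on (chart_image c) (f \<circ> chart_inv c))"


section \<open>Tangent vectors and vector fields\<close>

text \<open>A tangent vector at a point \<open>p\<close> is an equivalence class of pairs of a chart \<open>c\<close> around \<open>p\<close>
  and a coordinate vector \<open>v\<close>, where $(c,v) \sim (c',v')$ iff $D(c' \circ c^{-1})(c(p))\,v = v'$.
  Such a class contains exactly one pair for every chart around \<open>p\<close>, so it is encoded as the
  function from charts to coordinate vectors whose graph it is. The value is set to \<open>0\<close> at charts
  not around \<open>p\<close>, so that equality of tangent vectors is equality of functions. In particular the
  tangent space at a point outside the manifold consists of the zero function alone.\<close>

type_synonym ('a, 'b) tvec = "('a, 'b) chart \<Rightarrow> 'b"

definition coord_change ::
  "('a, 'b::euclidean_space) chart \<Rightarrow> ('a, 'b) chart \<Rightarrow> 'a \<Rightarrow> 'b \<Rightarrow> 'b" where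
  "coord_change c c' p = frechet_derivative (snd c' \<circ> chart_inv c) (at (snd c p))"

definition tangent_space ::
  "('a, 'b::euclidean_space) chart set \<Rightarrow> 'a \<Rightarrow> ('a, 'b) tvec set" where
  "tangent_space A p =
     {v. (\<forall>c\<in>charts_at A p. \<forall>c'\<in>charts_at A p. v c' = coord_change c c' p (v c)) \<and>
         (\<forall>c. c \<notin> charts_at A p \<longrightarrow> v c = 0)}"

text \<open>The tangent vector at \<open>p\<close> with coordinates \<open>u\<close> in the chart \<open>c\<close>. For the members \<open>u\<close> of the
  standard basis these are the coordinate vectors $\partial/\partial x^i$.\<close>

definition coord_vec ::
  "('a, 'b::euclidean_space) chart set \<Rightarrow> ('a, 'b) chart \<Rightarrow> 'a \<Rightarrow> 'b \<Rightarrow> ('a, 'b) tvec" where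
  "coord_vec A c p u = (\<lambda>c'. if c' \<in> charts_at A p then coord_change c c' p u else 0)"

definition tadd :: "('a, 'b::euclidean_space) tvec \<Rightarrow> ('a, 'b) tvec \<Rightarrow> ('a, 'b) tvec" where
  "tadd v w = (\<lambda>c. v c + w c)"

definition tdiff :: "('a, 'b::euclidean_space) tvec \<Rightarrow> ('a, 'b) tvec \<Rightarrow> ('a, 'b) tvec" where
  "tdiff v w = (\<lambda>c. v c - w c)"

definition tscale :: "real \<Rightarrow> ('a, 'b::euclidean_space) tvec \<Rightarrow> ('a, 'b) tvec" where
  "tscale r v = (\<lambda>c. r *\<^sub>R v c)"

definition tzero :: "('a, 'b::euclidean_space) tvec" where
  "tzero = (\<lambda>c. 0)"

type_synonym ('a, 'b) vfield = "'a \<Rightarrow> ('a, 'b) tvec"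

definition vector_fields ::
  "('a, 'b::euclidean_space) chart set \<Rightarrow> ('a, 'b) vfield set" where
  "vector_fields A =
     {X. (\<forall>p. X p \<in> tangent_space A p) \<and>
         (\<forall>c\<in>A. smooth_on (chart_image c) (\<lambda>x. X (chart_inv c x) c))}"

definition vadd :: "('a, 'b::euclidean_space) vfield \<Rightarrow> ('a, 'b) vfield \<Rightarrow> ('a, 'b) vfield" where
  "vadd X Y = (\<lambda>p. tadd (X p) (Y p))"

definition vdiff :: "('a, 'b::euclidean_space) vfield \<Rightarrow> ('a, 'b) vfield \<Rightarrow> ('a, 'b) vfield" where
  "vdiff X Y = (\<lambda>p. tdiff (X p) (Y p))"

definition vscale :: "('a \<Rightarrow> real) \<Rightarrow> ('a, 'b::euclidean_space) vfield \<Rightarrow> ('a, 'b) vfield" where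
  "vscale f X = (\<lambda>p. tscale (f p) (X p))"

text \<open>The derivative $X f$. By the chain rule it does not depend on the chart selected.\<close>

definition dir_deriv ::
  "('a, 'b::euclidean_space) chart set \<Rightarrow> ('a, 'b) vfield \<Rightarrow> ('a \<Rightarrow> real) \<Rightarrow> 'a \<Rightarrow> real" where
  "dir_deriv A X f p =
     (let c = (SOME c. c \<in> charts_at A p)
      in frechet_derivative (f \<circ> chart_inv c) (at (snd c p)) (X p c))"

text \<open>In coordinates $[X,Y]^i = X^j\,\partial_j Y^i - Y^j\,\partial_j X^i$, that is,
  $[X,Y]f = X(Yf) - Y(Xf)$.\<close>

definition lie_bracket ::
  "('a, 'b::euclidean_space) chart set \<Rightarrow> ('a, 'b) vfield \<Rightarrow> ('a, 'b) vfield \<Rightarrow> ('a, 'b) vfield" where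
  "lie_bracket A X Y = (\<lambda>p c.
     if c \<in> charts_at A p
     then frechet_derivative (\<lambda>x. Y (chart_inv c x) c) (at (snd c p)) (X p c)
        - frechet_derivative (\<lambda>x. X (chart_inv c x) c) (at (snd c p)) (Y p c)
     else 0)"


section \<open>Differential forms\<close>

text \<open>Forms are given by their values on smooth vector fields: a $3$-form is an alternating map
  $\mathfrak{X}(M)^3 \to C^\infty(M)$ that is $C^\infty(M)$-linear in every argument.\<close>

definition Cinf_linear ::
  "('a, 'b::euclidean_space) chart set \<Rightarrow> (('a, 'b) vfield \<Rightarrow> 'a \<Rightarrow> real) \<Rightarrow> bool" where
  "Cinf_linear A F \<longleftrightarrow>
     (\<forall>X\<in>vector_fields A. smooth_fun A (F X)) \<and>
     (\<forall>X\<in>vector_fields A. \<forall>Y\<in>vector_fields A. \<forall>p\<in>carrier A. F (vadd X Y) p = F X p + F Y p) \<and>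
     (\<forall>f. smooth_fun A f \<longrightarrow>
        (\<forall>X\<in>vector_fields A. \<forall>p\<in>carrier A. F (vscale f X) p = f p * F X p))"

definition three_form ::
  "('a, 'b::euclidean_space) chart set \<Rightarrow>
   (('a, 'b) vfield \<Rightarrow> ('a, 'b) vfield \<Rightarrow> ('a, 'b) vfield \<Rightarrow> 'a \<Rightarrow> real) \<Rightarrow> bool" where
  "three_form A \<omega> \<longleftrightarrow>
     (\<forall>X\<in>vector_fields A. \<forall>Y\<in>vector_fields A.
        Cinf_linear A (\<lambda>Z. \<omega> Z X Y) \<and> Cinf_linear A (\<lambda>Z. \<omega> X Z Y) \<and> Cinf_linear A (\<lambda>Z. \<omega> X Y Z)) \<and>
     (\<forall>X\<in>vector_fields A. \<forall>Y\<in>vector_fields A. \<forall>Z\<in>vector_fields A. \<forall>p\<in>carrier A.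
        \<omega> Y X Z p = - \<omega> X Y Z p \<and> \<omega> X Z Y p = - \<omega> X Y Z p)"

text \<open>The exterior derivative of a $2$-form, normalised without a factor $1/3$, so that
  $d(f\,dx\wedge dy) = df\wedge dx\wedge dy$ for the determinant convention of the wedge product.\<close>

definition ext_deriv ::
  "('a, 'b::euclidean_space) chart set \<Rightarrow> (('a, 'b) vfield \<Rightarrow> ('a, 'b) vfield \<Rightarrow> 'a \<Rightarrow> real) \<Rightarrow>
   ('a, 'b) vfield \<Rightarrow> ('a, 'b) vfield \<Rightarrow> ('a, 'b) vfield \<Rightarrow> 'a \<Rightarrow> real" where
  "ext_deriv A \<omega> X Y Z p =
       dir_deriv A X (\<omega> Y Z) p - dir_deriv A Y (\<omega> X Z) p + dir_deriv A Z (\<omega> X Y) p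
     - \<omega> (lie_bracket A X Y) Z p + \<omega> (lie_bracket A X Z) Y p - \<omega> (lie_bracket A Y Z) X p"


section \<open>Almost hermitian manifolds\<close>

locale riemannian_manifold = smooth_manifold \<tau> A
  for \<tau> :: "'a topology" and A :: "('a, 'b::euclidean_space) chart set" +
  fixes g :: "'a \<Rightarrow> ('a, 'b) tvec \<Rightarrow> ('a, 'b) tvec \<Rightarrow> real"
  assumes g_add: "p \<in> carrier A \<Longrightarrow> u \<in> tangent_space A p \<Longrightarrow> v \<in> tangent_space A p \<Longrightarrow>
          w \<in> tangent_space A p \<Longrightarrow> g p (tadd u v) w = g p u w + g p v w"
    and g_scale: "p \<in> carrier A \<Longrightarrow> v \<in> tangent_space A p \<Longrightarrow> w \<in> tangent_space A p \<Longrightarrow>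
          g p (tscale r v) w = r * g p v w"
    and g_sym: "p \<in> carrier A \<Longrightarrow> v \<in> tangent_space A p \<Longrightarrow> w \<in> tangent_space A p \<Longrightarrow>
          g p v w = g p w v"
    and g_pos: "p \<in> carrier A \<Longrightarrow> v \<in> tangent_space A p \<Longrightarrow> v \<noteq> tzero \<Longrightarrow> 0 < g p v v"
    and g_smooth: "c \<in> A \<Longrightarrow> i \<in> Basis \<Longrightarrow> j \<in> Basis \<Longrightarrow>
          smooth_on (chart_image c)
            (\<lambda>x. g (chart_inv c x) (coord_vec A c (chart_inv c x) i)
                                   (coord_vec A c (chart_inv c x) j))"

locale almost_hermitian_manifold = riemannian_manifold \<tau> A g
  for \<tau> :: "'a topology" and A :: "('a, 'b::euclidean_space) chart set"
    and g :: "'a \<Rightarrow> ('a, 'b) tvec \<Rightarrow> ('a, 'b) tvec \<Rightarrow> real" +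
  fixes J :: "'a \<Rightarrow> ('a, 'b) tvec \<Rightarrow> ('a, 'b) tvec"
  assumes J_tangent: "p \<in> carrier A \<Longrightarrow> v \<in> tangent_space A p \<Longrightarrow> J p v \<in> tangent_space A p"
    and J_add: "p \<in> carrier A \<Longrightarrow> v \<in> tangent_space A p \<Longrightarrow> w \<in> tangent_space A p \<Longrightarrow>
          J p (tadd v w) = tadd (J p v) (J p w)"
    and J_scale: "p \<in> carrier A \<Longrightarrow> v \<in> tangent_space A p \<Longrightarrow>
          J p (tscale r v) = tscale r (J p v)"
    and J_square: "p \<in> carrier A \<Longrightarrow> v \<in> tangent_space A p \<Longrightarrow> J p (J p v) = tscale (-1) v"
    and J_smooth: "c \<in> A \<Longrightarrow> i \<in> Basis \<Longrightarrow>
          smooth_on (chart_image c)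
            (\<lambda>x. J (chart_inv c x) (coord_vec A c (chart_inv c x) i) c)"
    and J_orthogonal: "p \<in> carrier A \<Longrightarrow> v \<in> tangent_space A p \<Longrightarrow> w \<in> tangent_space A p \<Longrightarrow>
          g p (J p v) (J p w) = g p v w"

definition g_field ::
  "('a \<Rightarrow> ('a, 'b) tvec \<Rightarrow> ('a, 'b) tvec \<Rightarrow> real) \<Rightarrow> ('a, 'b) vfield \<Rightarrow> ('a, 'b) vfield \<Rightarrow> 'a \<Rightarrow> real"
  where "g_field g X Y = (\<lambda>p. g p (X p) (Y p))"

definition J_field ::
  "('a, 'b::euclidean_space) chart set \<Rightarrow> ('a \<Rightarrow> ('a, 'b) tvec \<Rightarrow> ('a, 'b) tvec) \<Rightarrow>
   ('a, 'b) vfield \<Rightarrow> ('a, 'b) vfield" where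
  "J_field A J X = (\<lambda>p. if p \<in> carrier A then J p (X p) else tzero)"

definition kaehler_form ::
  "('a, 'b::euclidean_space) chart set \<Rightarrow> ('a \<Rightarrow> ('a, 'b) tvec \<Rightarrow> ('a, 'b) tvec \<Rightarrow> real) \<Rightarrow>
   ('a \<Rightarrow> ('a, 'b) tvec \<Rightarrow> ('a, 'b) tvec) \<Rightarrow> ('a, 'b) vfield \<Rightarrow> ('a, 'b) vfield \<Rightarrow> 'a \<Rightarrow> real" where
  "kaehler_form A g J X Y = g_field g X (J_field A J Y)"

definition nijenhuis ::
  "('a, 'b::euclidean_space) chart set \<Rightarrow> ('a \<Rightarrow> ('a, 'b) tvec \<Rightarrow> ('a, 'b) tvec) \<Rightarrow>
   ('a, 'b) vfield \<Rightarrow> ('a, 'b) vfield \<Rightarrow> ('a, 'b) vfield" where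
  "nijenhuis A J X Y =
     vdiff (vdiff (vdiff (lie_bracket A (J_field A J X) (J_field A J Y)) (lie_bracket A X Y))
                  (J_field A J (lie_bracket A (J_field A J X) Y)))
           (J_field A J (lie_bracket A X (J_field A J Y)))"

definition nijenhuis3 ::
  "('a, 'b::euclidean_space) chart set \<Rightarrow> ('a \<Rightarrow> ('a, 'b) tvec \<Rightarrow> ('a, 'b) tvec \<Rightarrow> real) \<Rightarrow>
   ('a \<Rightarrow> ('a, 'b) tvec \<Rightarrow> ('a, 'b) tvec) \<Rightarrow>
   ('a, 'b) vfield \<Rightarrow> ('a, 'b) vfield \<Rightarrow> ('a, 'b) vfield \<Rightarrow> 'a \<Rightarrow> real" where
  "nijenhuis3 A g J X Y Z = g_field g (nijenhuis A J X Y) Z"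


section \<open>Linear connections\<close>

text \<open>A connection takes \<open>X\<close> and \<open>Y\<close> to $\nabla_X Y$. Its values on arguments that are not smooth
  vector fields carry no meaning.\<close>

type_synonym ('a, 'b) connection = "('a, 'b) vfield \<Rightarrow> ('a, 'b) vfield \<Rightarrow> ('a, 'b) vfield"

definition linear_connection ::
  "('a, 'b::euclidean_space) chart set \<Rightarrow> ('a, 'b) connection \<Rightarrow> bool" where
  "linear_connection A D \<longleftrightarrow>
     (\<forall>X\<in>vector_fields A. \<forall>Y\<in>vector_fields A. D X Y \<in> vector_fields A) \<and>
     (\<forall>X\<in>vector_fields A. \<forall>Y\<in>vector_fields A. \<forall>Z\<in>vector_fields A.
        D (vadd X Y) Z = vadd (D X Z) (D Y Z) \<and>
        D X (vadd Y Z) = vadd (D X Y) (D X Z)) \<and>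
     (\<forall>f. smooth_fun A f \<longrightarrow>
        (\<forall>X\<in>vector_fields A. \<forall>Y\<in>vector_fields A.
           D (vscale f X) Y = vscale f (D X Y) \<and>
           D X (vscale f Y) = vadd (vscale (dir_deriv A X f) Y) (vscale f (D X Y))))"

definition torsion ::
  "('a, 'b::euclidean_space) chart set \<Rightarrow> ('a, 'b) connection \<Rightarrow>
   ('a, 'b) vfield \<Rightarrow> ('a, 'b) vfield \<Rightarrow> ('a, 'b) vfield" where
  "torsion A D X Y = vdiff (vdiff (D X Y) (D Y X)) (lie_bracket A X Y)"

definition torsion3 ::
  "('a, 'b::euclidean_space) chart set \<Rightarrow> ('a \<Rightarrow> ('a, 'b) tvec \<Rightarrow> ('a, 'b) tvec \<Rightarrow> real) \<Rightarrow>
   ('a, 'b) connection \<Rightarrow>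
   ('a, 'b) vfield \<Rightarrow> ('a, 'b) vfield \<Rightarrow> ('a, 'b) vfield \<Rightarrow> 'a \<Rightarrow> real" where
  "torsion3 A g D X Y Z = g_field g (torsion A D X Y) Z"

definition preserves_metric ::
  "('a, 'b::euclidean_space) chart set \<Rightarrow> ('a \<Rightarrow> ('a, 'b) tvec \<Rightarrow> ('a, 'b) tvec \<Rightarrow> real) \<Rightarrow>
   ('a, 'b) connection \<Rightarrow> bool" where
  "preserves_metric A g D \<longleftrightarrow>
     (\<forall>X\<in>vector_fields A. \<forall>Y\<in>vector_fields A. \<forall>Z\<in>vector_fields A. \<forall>p\<in>carrier A.
        dir_deriv A X (g_field g Y Z) p - g_field g (D X Y) Z p - g_field g Y (D X Z) p = 0)"

definition preserves_almost_complex ::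
  "('a, 'b::euclidean_space) chart set \<Rightarrow> ('a \<Rightarrow> ('a, 'b) tvec \<Rightarrow> ('a, 'b) tvec) \<Rightarrow>
   ('a, 'b) connection \<Rightarrow> bool" where
  "preserves_almost_complex A J D \<longleftrightarrow>
     (\<forall>X\<in>vector_fields A. \<forall>Y\<in>vector_fields A. \<forall>p\<in>carrier A.
        tdiff (D X (J_field A J Y) p) (J_field A J (D X Y) p) = tzero)"

definition skew_hermitian_connection ::
  "('a, 'b::euclidean_space) chart set \<Rightarrow> ('a \<Rightarrow> ('a, 'b) tvec \<Rightarrow> ('a, 'b) tvec \<Rightarrow> real) \<Rightarrow>
   ('a \<Rightarrow> ('a, 'b) tvec \<Rightarrow> ('a, 'b) tvec) \<Rightarrow> ('a, 'b) connection \<Rightarrow> bool" where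
  "skew_hermitian_connection A g J D \<longleftrightarrow>
     linear_connection A D \<and> three_form A (torsion3 A g D) \<and>
     preserves_metric A g D \<and> preserves_almost_complex A J D"

definition levi_civita ::
  "('a, 'b::euclidean_space) chart set \<Rightarrow> ('a \<Rightarrow> ('a, 'b) tvec \<Rightarrow> ('a, 'b) tvec \<Rightarrow> real) \<Rightarrow>
   ('a, 'b) connection \<Rightarrow> bool" where
  "levi_civita A g D \<longleftrightarrow>
     linear_connection A D \<and> preserves_metric A g D \<and>
     (\<forall>X\<in>vector_fields A. \<forall>Y\<in>vector_fields A. \<forall>p\<in>carrier A. torsion A D X Y p = tzero)"

end

theory Submission
  imports Defs
begin

text \<open>A metric connection \<open>\<nabla>\<close> with skew torsion \<open>T\<close> satisfies
  \<open>2 g(\<nabla>\<^sub>X Y, Z) = K(X, Y, Z) + T(X, Y, Z)\<close>, where \<open>K\<close> is the Koszul expression; conversely this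
  equation defines a metric connection with torsion \<open>T\<close> for every 3-form \<open>T\<close>. If moreover
  \<open>\<nabla>J = 0\<close>, replacing brackets by covariant derivatives gives
  \<open>d\<Omega>(X, Y, Z) = T(X, Y, JZ) + T(Y, Z, JX) + T(Z, X, JY)\<close> and
  \<open>N(X, Y, Z) = T(X, Y, Z) - T(JX, JY, Z) - T(JX, Y, JZ) - T(X, JY, JZ)\<close>. Hence \<open>N\<close> is a 3-form and
  \<open>T\<close> is the stated expression, which determines \<open>\<nabla>\<close>. Conversely, for \<open>T\<close> given by this expression
  all terms of \<open>K(X, JY, Z) + T(X, JY, Z) + K(X, Y, JZ) + T(X, Y, JZ)\<close> cancel except
  \<open>N(X, Z, JY) + N(X, JY, Z)\<close>, which vanishes when \<open>N\<close> is skew; this is \<open>\<nabla>J = 0\<close>.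

  Bump functions are not needed: \<open>K(X, Y, \<cdot>)\<close> and \<open>d\<Omega>(X, Y, \<cdot>)\<close> are built from differentials,
  metric duals and Lie derivatives of covector fields, so they are defined on single tangent vectors
  and have smooth metric duals.\<close>

section \<open>Smooth maps on open sets\<close>

text \<open>The forms of the theorem act on globally defined fields. Reading off the value of such a
  form on one tangent vector would require an extension of that vector to a global field. A covector
  field given pointwise, in contrast, can always be evaluated on global fields, so the proof only
  passes in this direction. Likewise, two fields with the same products with all \<open>Z\<close>
  are compared by taking their difference as \<open>Z\<close>, where positivity of \<open>g\<close>
  decides.

  Two analytic facts remain. A field known only through its products with \<open>g\<close> has to be
  recovered by inverting \<open>g\<close> in each chart, smoothly in the base point. For this the
  equation \<open>G x (U x) = a x\<close> is differentiated: every directional derivative of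
  \<open>U\<close> solves the same equation with another right-hand side, which sets up an induction
  on the order of differentiability. The second fact is the symmetry of second derivatives.
  Differentiating components brings in the second derivative of the transition map, and its symmetry
  is what makes the bracket and the Lie derivative of a covector field independent of the
  chart.\<close>

lemma frechet_derivative_cong_open:
  assumes "open S" "x \<in> S" "\<And>y. y \<in> S \<Longrightarrow> f y = g y"
  shows "frechet_derivative f (at x) = frechet_derivative g (at x)"
proof -
  \<comment> \<open>\<open>frechet_derivative\<close> is a choice among all derivatives, so the
    equivalence for every \<open>D\<close> gives equality even at points where no derivative
    exists.\<close>
  have "(f has_derivative D) (at x) \<longleftrightarrow> (g has_derivative D) (at x)" for D
    using has_derivative_transform_within_open[of f D x UNIV S g]
      has_derivative_transform_within_open[of g D x UNIV S f] assms by auto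
  then show ?thesis by (simp add: frechet_derivative_def)
qed

lemma differentiable_cong_open:
  assumes "open S" "x \<in> S" "\<And>y. y \<in> S \<Longrightarrow> f y = g y"
  shows "f differentiable (at x) \<longleftrightarrow> g differentiable (at x)"
proof -
  have "(f has_derivative D) (at x) \<longleftrightarrow> (g has_derivative D) (at x)" for D
    using has_derivative_transform_within_open[of f D x UNIV S g]
      has_derivative_transform_within_open[of g D x UNIV S f] assms by auto
  then show ?thesis by (simp add: differentiable_def)
qed

lemma Ck_on_cong:
  assumes "open S" "\<And>y. y \<in> S \<Longrightarrow> f y = g y"
  shows "Ck_on k S f \<longleftrightarrow> Ck_on k S g"
  using assms(2)
proof (induction k arbitrary: f g)
  case 0
  then show ?case using continuous_on_cong[of S S f g] by simp
next
  case (Suc k)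
  have "Ck_on k S (\<lambda>x. frechet_derivative f (at x) v) \<longleftrightarrow>
      Ck_on k S (\<lambda>x. frechet_derivative g (at x) v)" for v
    by (rule Suc.IH) (use frechet_derivative_cong_open[OF assms(1) _ Suc.prems] in auto)
  moreover have "(\<forall>x\<in>S. f differentiable (at x)) \<longleftrightarrow> (\<forall>x\<in>S. g differentiable (at x))"
    using differentiable_cong_open[OF assms(1) _ Suc.prems] by auto
  ultimately show ?case by simp
qed

lemma smooth_on_cong:
  assumes "open S" "\<And>y. y \<in> S \<Longrightarrow> f y = g y"
  shows "smooth_on S f \<longleftrightarrow> smooth_on S g"
  unfolding smooth_on_def using Ck_on_cong[OF assms] by simp

lemma Ck_on_SucD: "Ck_on (Suc k) S f \<Longrightarrow> Ck_on k S f"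
proof (induction k arbitrary: f)
  case 0
  then show ?case
    by (auto intro!: continuous_at_imp_continuous_on differentiable_imp_continuous_within)
next
  case (Suc k)
  from Suc.prems have "\<forall>x\<in>S. f differentiable (at x)"
    and "\<And>v. Ck_on (Suc k) S (\<lambda>x. frechet_derivative f (at x) v)"
    unfolding Ck_on.simps(2)[of "Suc k"] by blast+
  with Suc.IH show ?case unfolding Ck_on.simps(2)[of k] by blast
qed

lemma Ck_on_continuous: "Ck_on k S f \<Longrightarrow> continuous_on S f"
proof (induction k)
  case (Suc k)
  show ?case by (rule Suc.IH[OF Ck_on_SucD[OF Suc.prems]])
qed simp

lemma smooth_on_continuous: "smooth_on S f \<Longrightarrow> continuous_on S f"
  unfolding smooth_on_def by (rule Ck_on_continuous[of 0]) blast

lemma smooth_on_differentiable: "smooth_on S f \<Longrightarrow> x \<in> S \<Longrightarrow> f differentiable (at x)"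
  unfolding smooth_on_def by (drule spec[of _ "Suc 0"]) simp

lemma smooth_on_has_derivative:
  "smooth_on S f \<Longrightarrow> x \<in> S \<Longrightarrow> (f has_derivative frechet_derivative f (at x)) (at x)"
  using smooth_on_differentiable frechet_derivative_works by blast

lemma smooth_on_frechet_derivative:
  "smooth_on S f \<Longrightarrow> smooth_on S (\<lambda>x. frechet_derivative f (at x) v)"
  unfolding smooth_on_def by (intro allI) (drule_tac x = "Suc k" in spec, simp)

lemma Ck_on_const [simp]: "Ck_on k S (\<lambda>x. a)"
  by (induction k arbitrary: a) auto

lemma smooth_on_const [simp, intro]: "smooth_on S (\<lambda>x. a)"
  by (simp add: smooth_on_def)

lemma Ck_on_bounded_linear:
  assumes "open S" "bounded_linear L" "Ck_on k S f"
  shows "Ck_on k S (\<lambda>x. L (f x))"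
  using assms(3)
proof (induction k arbitrary: f)
  case 0
  then show ?case using linear_continuous_on_compose bounded_linear.continuous_on[OF assms(2)] by simp
next
  case (Suc k)
  have d: "((\<lambda>x. L (f x)) has_derivative (\<lambda>v. L (frechet_derivative f (at x) v))) (at x)"
    if "x \<in> S" for x
    using Suc.prems that
    by (intro bounded_linear.has_derivative[OF assms(2)]) (simp add: frechet_derivative_works)
  have "Ck_on k S (\<lambda>x. frechet_derivative (\<lambda>x. L (f x)) (at x) v)" for v
  proof -
    have "Ck_on k S (\<lambda>x. L (frechet_derivative f (at x) v))"
      using Suc by simp
    then show ?thesis
      by (rule Ck_on_cong[THEN iffD1, OF assms(1), rotated])
        (simp add: frechet_derivative_at[OF d, symmetric])
  qed
  then show ?case using d by (auto simp: differentiable_def)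
qed

lemma Ck_on_add:
  assumes "open S" "Ck_on k S f" "Ck_on k S h"
  shows "Ck_on k S (\<lambda>x. f x + h x)"
  using assms(2,3)
proof (induction k arbitrary: f h)
  case 0
  then show ?case by (simp add: continuous_on_add)
next
  case (Suc k)
  have d: "((\<lambda>x. f x + h x) has_derivative
      (\<lambda>v. frechet_derivative f (at x) v + frechet_derivative h (at x) v)) (at x)"
    if "x \<in> S" for x
    using Suc.prems that by (auto intro!: derivative_intros simp: frechet_derivative_works[symmetric])
  have "Ck_on k S (\<lambda>x. frechet_derivative (\<lambda>x. f x + h x) (at x) v)" for v
  proof -
    have "Ck_on k S (\<lambda>x. frechet_derivative f (at x) v + frechet_derivative h (at x) v)"
      using Suc by simp
    then show ?thesis
      by (rule Ck_on_cong[THEN iffD1, OF assms(1), rotated])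
        (simp add: frechet_derivative_at[OF d, symmetric])
  qed
  then show ?case using d by (auto simp: differentiable_def)
qed

lemma Ck_on_bilinear:
  assumes "open S" "bounded_bilinear P" "Ck_on k S f" "Ck_on k S h"
  shows "Ck_on k S (\<lambda>x. P (f x) (h x))"
  using assms(3,4)
proof (induction k arbitrary: f h)
  case 0
  then show ?case using bounded_bilinear.continuous_on[OF assms(2)] by simp
next
  case (Suc k)
  have d: "((\<lambda>x. P (f x) (h x)) has_derivative
      (\<lambda>v. P (f x) (frechet_derivative h (at x) v) + P (frechet_derivative f (at x) v) (h x))) (at x)"
    if "x \<in> S" for x
    using Suc.prems that
    by (auto intro!: bounded_bilinear.FDERIV[OF assms(2)] simp: frechet_derivative_works[symmetric])
  have "Ck_on k S (\<lambda>x. frechet_derivative (\<lambda>x. P (f x) (h x)) (at x) v)" for v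
  proof -
    have "Ck_on k S (\<lambda>x. P (f x) (frechet_derivative h (at x) v) +
        P (frechet_derivative f (at x) v) (h x))"
      \<comment> \<open>Each product contains one factor that is not differentiated; its order is
        lowered to \<open>k\<close> to fit the induction hypothesis.\<close>
      using Suc.prems Ck_on_SucD[OF Suc.prems(1)] Ck_on_SucD[OF Suc.prems(2)]
      by (intro Ck_on_add[OF assms(1)] Suc.IH) simp_all
    then show ?thesis
      by (rule Ck_on_cong[THEN iffD1, OF assms(1), rotated])
        (simp add: frechet_derivative_at[OF d, symmetric])
  qed
  then show ?case using d by (auto simp: differentiable_def)
qed

lemma smooth_on_bounded_linear:
  "open S \<Longrightarrow> bounded_linear L \<Longrightarrow> smooth_on S f \<Longrightarrow> smooth_on S (\<lambda>x. L (f x))"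
  by (simp add: smooth_on_def Ck_on_bounded_linear)

lemma smooth_on_add:
  "open S \<Longrightarrow> smooth_on S f \<Longrightarrow> smooth_on S h \<Longrightarrow> smooth_on S (\<lambda>x. f x + h x)"
  by (simp add: smooth_on_def Ck_on_add)

lemma smooth_on_bilinear:
  "open S \<Longrightarrow> bounded_bilinear P \<Longrightarrow> smooth_on S f \<Longrightarrow> smooth_on S h \<Longrightarrow>
    smooth_on S (\<lambda>x. P (f x) (h x))"
  by (simp add: smooth_on_def Ck_on_bilinear)

lemmas smooth_on_scaleR = smooth_on_bilinear[OF _ bounded_bilinear_scaleR]
lemmas smooth_on_inner = smooth_on_bilinear[OF _ bounded_bilinear_inner]
lemmas smooth_on_mult = smooth_on_bilinear[OF _ bounded_bilinear_mult]
lemmas smooth_on_minus = smooth_on_bounded_linear[OF _ bounded_linear_minus[OF bounded_linear_ident]]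

lemma smooth_on_diff:
  "open S \<Longrightarrow> smooth_on S f \<Longrightarrow> smooth_on S h \<Longrightarrow> smooth_on S (\<lambda>x. f x - h x)"
  using smooth_on_add[of S f "\<lambda>x. - h x"] smooth_on_minus[of S h] by simp

lemma Ck_on_sum:
  "open S \<Longrightarrow> (\<And>i. i \<in> I \<Longrightarrow> Ck_on k S (f i)) \<Longrightarrow> Ck_on k S (\<lambda>x. \<Sum>i\<in>I. f i x)"
  by (induction I rule: infinite_finite_induct) (auto intro: Ck_on_add)

lemma smooth_on_sum:
  "open S \<Longrightarrow> (\<And>i. i \<in> I \<Longrightarrow> smooth_on S (f i)) \<Longrightarrow> smooth_on S (\<lambda>x. \<Sum>i\<in>I. f i x)"
  by (simp add: smooth_on_def Ck_on_sum)

lemma linear_euclidean_expansion: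
  fixes L :: "'b::euclidean_space \<Rightarrow> 'c::real_vector"
  assumes "linear L"
  shows "L u = (\<Sum>i\<in>Basis. (u \<bullet> i) *\<^sub>R L i)"
  using linear_sum[OF assms, of "\<lambda>i. (u \<bullet> i) *\<^sub>R i" Basis]
  by (simp add: linear_scale[OF assms] euclidean_representation)

text \<open>The coefficients of \<open>X x\<close> in the basis and the columns of
  \<open>L x\<close> are smooth, and the value is the sum of their products. This is how a tensor
  known through its components gets applied to a field.\<close>

lemma smooth_on_linear_family:
  fixes L :: "'b::euclidean_space \<Rightarrow> 'd::euclidean_space \<Rightarrow> 'c::real_normed_vector"
  assumes "open S" "\<And>x. x \<in> S \<Longrightarrow> linear (L x)" "smooth_on S X"
    and "\<And>i. i \<in> Basis \<Longrightarrow> smooth_on S (\<lambda>x. L x i)"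
  shows "smooth_on S (\<lambda>x. L x (X x))"
proof -
  have "smooth_on S (\<lambda>x. \<Sum>i\<in>Basis. (X x \<bullet> i) *\<^sub>R L x i)"
    using assms by (intro smooth_on_sum smooth_on_scaleR smooth_on_inner) auto
  then show ?thesis
    by (rule smooth_on_cong[THEN iffD1, OF assms(1), rotated])
      (rule linear_euclidean_expansion[OF assms(2), symmetric])
qed

lemma smooth_on_derivative_along:
  fixes f :: "'b::euclidean_space \<Rightarrow> 'c::real_normed_vector"
  assumes "open S" "smooth_on S f" "smooth_on S X"
  shows "smooth_on S (\<lambda>x. frechet_derivative f (at x) (X x))"
  by (rule smooth_on_linear_family[OF assms(1) _ assms(3)])
    (simp_all add: linear_frechet_derivative smooth_on_differentiable[OF assms(2)]
      smooth_on_frechet_derivative[OF assms(2)])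

text \<open>The second difference over the parallelogram spanned by \<open>h u\<close> and
  \<open>h v\<close> is symmetric in \<open>u\<close> and \<open>v\<close>. The mean value theorem
  along \<open>u\<close>, and then along \<open>v\<close>, turns it into a mixed derivative at a
  nearby point.\<close>

lemma mvt_second_difference:
  fixes f :: "'b::real_normed_vector \<Rightarrow> real"
  assumes h: "0 < h" "h * (norm u + norm v) < d"
    and f: "\<And>y. y \<in> ball x d \<Longrightarrow> (f has_derivative f' y) (at y)"
    and f': "\<And>y. y \<in> ball x d \<Longrightarrow> ((\<lambda>y. f' y u) has_derivative f'' y) (at y)"
  shows "\<exists>y\<in>ball x d. f (x + h *\<^sub>R u + h *\<^sub>R v) - f (x + h *\<^sub>R u) - f (x + h *\<^sub>R v) + f x
      = h\<^sup>2 * f'' y v"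
proof -
  have in_ball: "x + s *\<^sub>R u + t *\<^sub>R v \<in> ball x d" if "0 \<le> s" "s \<le> h" "0 \<le> t" "t \<le> h" for s t
  proof -
    have "norm (s *\<^sub>R u + t *\<^sub>R v) \<le> s * norm u + t * norm v"
      using norm_triangle_ineq[of "s *\<^sub>R u" "t *\<^sub>R v"] that(1,3) by (simp only: norm_scaleR abs_of_nonneg)
    also have "\<dots> \<le> h * norm u + h * norm v"
      using that by (intro add_mono mult_right_mono) auto
    also have "\<dots> < d" using h(2) by (simp only: distrib_left)
    finally have "norm (s *\<^sub>R u + t *\<^sub>R v) < d" .
    moreover have "x - (x + s *\<^sub>R u + t *\<^sub>R v) = - (s *\<^sub>R u + t *\<^sub>R v)" by simp
    ultimately show ?thesis unfolding mem_ball dist_norm by (simp only: norm_minus_cancel)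
  qed
  have d1: "DERIV (\<lambda>s. f (x + s *\<^sub>R u + t *\<^sub>R v)) s :> f' (x + s *\<^sub>R u + t *\<^sub>R v) u"
    if "0 \<le> s" "s \<le> h" "0 \<le> t" "t \<le> h" for s t
  proof -
    have D: "(f has_derivative f' (x + s *\<^sub>R u + t *\<^sub>R v)) (at (x + s *\<^sub>R u + t *\<^sub>R v))"
      by (rule f[OF in_ball[OF that]])
    have "((\<lambda>s. f (x + s *\<^sub>R u + t *\<^sub>R v)) has_derivative
        (\<lambda>r. f' (x + s *\<^sub>R u + t *\<^sub>R v) (r *\<^sub>R u))) (at s)"
      by (rule has_derivative_compose[of "\<lambda>s. x + s *\<^sub>R u + t *\<^sub>R v" "\<lambda>r. r *\<^sub>R u", OF _ D])
        (auto intro!: derivative_eq_intros)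
    moreover have "(\<lambda>r. f' (x + s *\<^sub>R u + t *\<^sub>R v) (r *\<^sub>R u)) = (*) (f' (x + s *\<^sub>R u + t *\<^sub>R v) u)"
      by (rule ext) (simp add: linear_scale[OF has_derivative_linear[OF D]])
    ultimately show ?thesis by (simp add: has_field_derivative_def)
  qed
  have d2: "DERIV (\<lambda>t. f' (x + s *\<^sub>R u + t *\<^sub>R v) u) t :> f'' (x + s *\<^sub>R u + t *\<^sub>R v) v"
    if "0 \<le> s" "s \<le> h" "0 \<le> t" "t \<le> h" for s t
  proof -
    have D: "((\<lambda>y. f' y u) has_derivative f'' (x + s *\<^sub>R u + t *\<^sub>R v)) (at (x + s *\<^sub>R u + t *\<^sub>R v))"
      by (rule f'[OF in_ball[OF that]])
    have "((\<lambda>t. f' (x + s *\<^sub>R u + t *\<^sub>R v) u) has_derivative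
        (\<lambda>r. f'' (x + s *\<^sub>R u + t *\<^sub>R v) (r *\<^sub>R v))) (at t)"
      by (rule has_derivative_compose[of "\<lambda>t. x + s *\<^sub>R u + t *\<^sub>R v" "\<lambda>r. r *\<^sub>R v", OF _ D])
        (auto intro!: derivative_eq_intros)
    moreover have "(\<lambda>r. f'' (x + s *\<^sub>R u + t *\<^sub>R v) (r *\<^sub>R v)) = (*) (f'' (x + s *\<^sub>R u + t *\<^sub>R v) v)"
      by (rule ext) (simp add: linear_scale[OF has_derivative_linear[OF D]])
    ultimately show ?thesis by (simp add: has_field_derivative_def)
  qed
  \<comment> \<open>The zero multiples keep all points in the form \<open>x + s u + t v\<close> to
    which \<open>d1\<close> and \<open>d2\<close> apply.\<close>
  have "\<exists>s>0. s < h \<and> f (x + h *\<^sub>R u + h *\<^sub>R v) - f (x + h *\<^sub>R u + 0 *\<^sub>R v)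
      - (f (x + 0 *\<^sub>R u + h *\<^sub>R v) - f (x + 0 *\<^sub>R u + 0 *\<^sub>R v))
    = (h - 0) * (f' (x + s *\<^sub>R u + h *\<^sub>R v) u - f' (x + s *\<^sub>R u + 0 *\<^sub>R v) u)"
  proof (rule MVT2[of 0 h "\<lambda>s. f (x + s *\<^sub>R u + h *\<^sub>R v) - f (x + s *\<^sub>R u + 0 *\<^sub>R v)"])
    show "DERIV (\<lambda>s. f (x + s *\<^sub>R u + h *\<^sub>R v) - f (x + s *\<^sub>R u + 0 *\<^sub>R v)) s
        :> f' (x + s *\<^sub>R u + h *\<^sub>R v) u - f' (x + s *\<^sub>R u + 0 *\<^sub>R v) u" if "0 \<le> s" "s \<le> h" for s
      using that h(1) by (intro DERIV_diff[OF d1[of s h] d1[of s 0]]) simp_all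
  qed (rule h)
  then obtain s where s: "0 < s" "s < h" and "f (x + h *\<^sub>R u + h *\<^sub>R v) - f (x + h *\<^sub>R u + 0 *\<^sub>R v)
      - (f (x + 0 *\<^sub>R u + h *\<^sub>R v) - f (x + 0 *\<^sub>R u + 0 *\<^sub>R v))
    = (h - 0) * (f' (x + s *\<^sub>R u + h *\<^sub>R v) u - f' (x + s *\<^sub>R u + 0 *\<^sub>R v) u)"
    by blast
  then have eq1: "f (x + h *\<^sub>R u + h *\<^sub>R v) - f (x + h *\<^sub>R u) - f (x + h *\<^sub>R v) + f x
    = h * (f' (x + s *\<^sub>R u + h *\<^sub>R v) u - f' (x + s *\<^sub>R u + 0 *\<^sub>R v) u)"
    by simp
  have "\<exists>t>0. t < h \<and> f' (x + s *\<^sub>R u + h *\<^sub>R v) u - f' (x + s *\<^sub>R u + 0 *\<^sub>R v) u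
    = (h - 0) * f'' (x + s *\<^sub>R u + t *\<^sub>R v) v"
  proof (rule MVT2[of 0 h "\<lambda>t. f' (x + s *\<^sub>R u + t *\<^sub>R v) u"])
    show "DERIV (\<lambda>t. f' (x + s *\<^sub>R u + t *\<^sub>R v) u) t :> f'' (x + s *\<^sub>R u + t *\<^sub>R v) v"
      if "0 \<le> t" "t \<le> h" for t
      using that s by (intro d2[of s t]) simp_all
  qed (rule h)
  then obtain t where t: "0 < t" "t < h" and
    eq2: "f' (x + s *\<^sub>R u + h *\<^sub>R v) u - f' (x + s *\<^sub>R u + 0 *\<^sub>R v) u = h * f'' (x + s *\<^sub>R u + t *\<^sub>R v) v"
    by auto
  show ?thesis
  proof (rule bexI)
    show "x + s *\<^sub>R u + t *\<^sub>R v \<in> ball x d" using in_ball[of s t] s t by simp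
    show "f (x + h *\<^sub>R u + h *\<^sub>R v) - f (x + h *\<^sub>R u) - f (x + h *\<^sub>R v) + f x
        = h\<^sup>2 * f'' (x + s *\<^sub>R u + t *\<^sub>R v) v"
      unfolding eq1 eq2 power2_eq_square by simp
  qed
qed

text \<open>Both orders of differentiation give the same second difference, so the two mixed
  derivatives agree at two points close to \<open>x\<close>. Continuity moves this to
  \<open>x\<close> with an error below any \<open>e\<close>.\<close>

lemma second_derivative_symmetric_real:
  fixes f :: "'b::euclidean_space \<Rightarrow> real"
  assumes "open S" "x \<in> S" "smooth_on S f"
  shows "frechet_derivative (\<lambda>y. frechet_derivative f (at y) u) (at x) v =
    frechet_derivative (\<lambda>y. frechet_derivative f (at y) v) (at x) u"
proof -
  define H where "H u v y = frechet_derivative (\<lambda>y. frechet_derivative f (at y) u) (at y) v" for u v y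
  have "\<bar>H u v x - H v u x\<bar> \<le> e" if e: "0 < e" for e :: real
  proof -
    have cont: "continuous_on S (H u v)" for u v
      unfolding H_def
      by (intro smooth_on_continuous smooth_on_frechet_derivative assms)
    obtain d1 where d1: "d1 > 0" "ball x d1 \<subseteq> S"
      using assms openE by blast
    obtain d2 where d2: "d2 > 0" "\<And>y. y \<in> S \<Longrightarrow> dist y x < d2 \<Longrightarrow> dist (H u v y) (H u v x) < e / 2"
      using cont[of u v] assms(2) e unfolding continuous_on_iff by (metis half_gt_zero)
    obtain d3 where d3: "d3 > 0" "\<And>y. y \<in> S \<Longrightarrow> dist y x < d3 \<Longrightarrow> dist (H v u y) (H v u x) < e / 2"
      using cont[of v u] assms(2) e unfolding continuous_on_iff by (metis half_gt_zero)
    define d where "d = min d1 (min d2 d3)"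
    have d: "d > 0" "ball x d \<subseteq> S" using d1 d2 d3 by (auto simp: d_def)
    \<comment> \<open>The summand 1 keeps the denominator positive when \<open>u\<close> and
      \<open>v\<close> vanish; the factor 2 makes the parallelogram fit strictly into the
      ball.\<close>
    define h where "h = d / (2 * (norm u + norm v + 1))"
    have pos: "norm u + norm v + 1 > 0" by (simp add: add_nonneg_pos)
    have h: "h > 0" using d pos by (simp add: h_def)
    have "h * (norm u + norm v) < h * (2 * (norm u + norm v + 1))"
      using h pos by (intro mult_strict_left_mono) auto
    also have "\<dots> = d" using pos by (simp add: h_def)
    finally have hd: "h * (norm u + norm v) < d" .
    have mean: "\<exists>y\<in>ball x d. f (x + h *\<^sub>R u + h *\<^sub>R v) - f (x + h *\<^sub>R u) - f (x + h *\<^sub>R v) + f x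
        = h\<^sup>2 * H u v y" if "h * (norm u + norm v) < d" for u v
      unfolding H_def using d(2)
      by (intro mvt_second_difference[OF h that, where f' = "\<lambda>y. frechet_derivative f (at y)"]
          smooth_on_has_derivative[OF assms(3)]
          smooth_on_has_derivative[OF smooth_on_frechet_derivative[OF assms(3)]]) auto
    obtain y where y: "y \<in> ball x d"
      "f (x + h *\<^sub>R u + h *\<^sub>R v) - f (x + h *\<^sub>R u) - f (x + h *\<^sub>R v) + f x = h\<^sup>2 * H u v y"
      using mean[OF hd] by blast
    obtain z where z: "z \<in> ball x d"
      "f (x + h *\<^sub>R v + h *\<^sub>R u) - f (x + h *\<^sub>R v) - f (x + h *\<^sub>R u) + f x = h\<^sup>2 * H v u z"
      using mean[of v u] hd by (auto simp: add.commute)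
    have "h\<^sup>2 * H u v y = h\<^sup>2 * H v u z"
      using y(2) z(2) by (simp add: algebra_simps)
    then have "H u v y = H v u z" using h by simp
    moreover have "dist (H u v y) (H u v x) < e / 2"
      using y d by (intro d2) (auto simp: d_def dist_commute)
    moreover have "dist (H v u z) (H v u x) < e / 2"
      using z d by (intro d3) (auto simp: d_def dist_commute)
    ultimately show ?thesis unfolding dist_real_def by arith
  qed
  then have "\<bar>H u v x - H v u x\<bar> \<le> 0"
    using field_le_epsilon[of "\<bar>H u v x - H v u x\<bar>" 0] by simp
  then show ?thesis by (simp add: H_def)
qed

lemma frechet_derivative_bounded_linear:
  assumes "bounded_linear L" "f differentiable (at x)"
  shows "frechet_derivative (\<lambda>x. L (f x)) (at x) v = L (frechet_derivative f (at x) v)"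
proof -
  have "((\<lambda>x. L (f x)) has_derivative (\<lambda>v. L (frechet_derivative f (at x) v))) (at x)"
    using assms by (intro bounded_linear.has_derivative[OF assms(1)]) (simp add: frechet_derivative_works[symmetric])
  from frechet_derivative_at[OF this] show ?thesis by metis
qed

text \<open>The mean value theorem used above concerns real values, hence the passage to
  components.\<close>

lemma second_derivative_symmetric:
  fixes f :: "'b::euclidean_space \<Rightarrow> 'c::euclidean_space"
  assumes "open S" "x \<in> S" "smooth_on S f"
  shows "frechet_derivative (\<lambda>y. frechet_derivative f (at y) u) (at x) v =
    frechet_derivative (\<lambda>y. frechet_derivative f (at y) v) (at x) u"
proof (rule euclidean_eqI)
  fix i :: 'c assume "i \<in> Basis"
  have L: "bounded_linear (\<lambda>z::'c. z \<bullet> i)" by (rule bounded_linear_inner_left)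
  have 1: "frechet_derivative (\<lambda>y. f y \<bullet> i) (at y) u = frechet_derivative f (at y) u \<bullet> i"
    if "y \<in> S" for y u
    using frechet_derivative_bounded_linear[OF L] smooth_on_differentiable[OF assms(3) that] by blast
  have 2: "frechet_derivative (\<lambda>y. frechet_derivative (\<lambda>y. f y \<bullet> i) (at y) u) (at x) v
      = frechet_derivative (\<lambda>y. frechet_derivative f (at y) u) (at x) v \<bullet> i" for u v
  proof -
    have "frechet_derivative (\<lambda>y. frechet_derivative (\<lambda>y. f y \<bullet> i) (at y) u) (at x)
        = frechet_derivative (\<lambda>y. frechet_derivative f (at y) u \<bullet> i) (at x)"
      by (rule frechet_derivative_cong_open[OF assms(1,2) 1])
    then show ?thesis
      using frechet_derivative_bounded_linear[OF L]
        smooth_on_differentiable[OF smooth_on_frechet_derivative[OF assms(3)] assms(2)] by metis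
  qed
  show "frechet_derivative (\<lambda>y. frechet_derivative f (at y) u) (at x) v \<bullet> i =
    frechet_derivative (\<lambda>y. frechet_derivative f (at y) v) (at x) u \<bullet> i"
    using second_derivative_symmetric_real[OF assms(1,2) smooth_on_bounded_linear[OF assms(1) L assms(3)]]
    unfolding 2 by blast
qed

section \<open>Smooth dependence of solutions of linear equations\<close>

text \<open>The sum over the columns bounds the operator norm. It turns continuity of each column
  into continuity of the family that is uniform on bounded sets of vectors.\<close>

lemma norm_linear_diff_le:
  fixes L M :: "'b::euclidean_space \<Rightarrow> 'c::real_normed_vector"
  assumes "linear L" "linear M"
  shows "norm (L u - M u) \<le> (\<Sum>i\<in>Basis. norm (L i - M i)) * norm u"
proof -
  have "L u - M u = (\<Sum>i\<in>Basis. (u \<bullet> i) *\<^sub>R (L i - M i))"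
    using linear_euclidean_expansion[OF assms(1), of u] linear_euclidean_expansion[OF assms(2), of u]
    by (simp add: scaleR_diff_right sum_subtractf)
  also have "norm \<dots> \<le> (\<Sum>i\<in>Basis. norm (L i - M i) * norm u)"
  proof (rule sum_norm_le)
    fix i :: 'b assume "i \<in> Basis"
    then have "\<bar>u \<bullet> i\<bar> * norm (L i - M i) \<le> norm u * norm (L i - M i)"
      by (intro mult_right_mono Basis_le_norm) auto
    then show "norm ((u \<bullet> i) *\<^sub>R (L i - M i)) \<le> norm (L i - M i) * norm u"
      by (simp add: mult.commute)
  qed
  finally show ?thesis by (simp add: sum_distrib_right)
qed

context
  fixes S :: "'b::euclidean_space set" and G :: "'b \<Rightarrow> 'b \<Rightarrow> 'b"
  assumes S: "open S"
    and lin: "\<And>x. x \<in> S \<Longrightarrow> linear (G x)"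
    and inj: "\<And>x. x \<in> S \<Longrightarrow> inj (G x)"
    and smooth: "\<And>i. i \<in> Basis \<Longrightarrow> smooth_on S (\<lambda>x. G x i)"
begin

lemma family_continuity:
  assumes "x \<in> S" "0 < e"
  shows "\<exists>r>0. \<forall>y. dist y x < r \<longrightarrow> y \<in> S \<and> (\<forall>u. norm (G y u - G x u) \<le> e * norm u)"
proof -
  define D where "D y = (\<Sum>i\<in>Basis. norm (G y i - G x i))" for y
  have "isCont (\<lambda>y. G y i) x" if "i \<in> Basis" for i
    using smooth_on_continuous[OF smooth[OF that]] assms(1) S continuous_on_eq_continuous_at by blast
  then have "isCont D x"
    unfolding D_def by (intro continuous_sum continuous_norm continuous_diff) auto
  then obtain r1 where r1: "r1 > 0" "\<And>y. dist y x < r1 \<Longrightarrow> dist (D y) (D x) < e"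
    using assms(2) unfolding continuous_at_eps_delta by (metis)
  obtain r2 where r2: "r2 > 0" "ball x r2 \<subseteq> S" using S assms openE by blast
  show ?thesis
  proof (intro exI[of _ "min r1 r2"] conjI allI impI)
    fix y u assume y: "dist y x < min r1 r2"
    then show "y \<in> S" using r2 by (auto simp: dist_commute)
    have "D y < e" using r1(2)[of y] y by (simp add: D_def dist_real_def)
    have "norm (G y u - G x u) \<le> D y * norm u"
      unfolding D_def by (intro norm_linear_diff_le lin \<open>y \<in> S\<close> assms)
    also have "\<dots> \<le> e * norm u"
      using \<open>D y < e\<close> by (intro mult_right_mono) auto
    finally show "norm (G y u - G x u) \<le> e * norm u" .
  qed (use r1 r2 in auto)
qed

lemma family_bounded_below:
  assumes "x \<in> S"
  shows "\<exists>m>0. \<exists>r>0. \<forall>y. dist y x < r \<longrightarrow> y \<in> S \<and> (\<forall>u. m * norm u \<le> norm (G y u))"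
proof -
  \<comment> \<open>An injective linear map in finite dimension has a positive lower bound
    \<open>B\<close>. A perturbation of size \<open>B / 2\<close> uses up at most half of
    it.\<close>
  obtain B where B: "B > 0" "\<And>u. B * norm u \<le> norm (G x u)"
    using linear_inj_bounded_below_pos[OF lin inj] assms by metis
  obtain r where r: "r > 0"
    "\<And>y. dist y x < r \<Longrightarrow> y \<in> S \<and> (\<forall>u. norm (G y u - G x u) \<le> (B / 2) * norm u)"
    using family_continuity[OF assms, of "B / 2"] B by auto
  have "B / 2 * norm u \<le> norm (G y u)" if "dist y x < r" for y u
  proof -
    have "norm (G x u) \<le> norm (G y u) + norm (G y u - G x u)"
      by (metis norm_minus_commute norm_triangle_sub)
    moreover have "norm (G y u - G x u) \<le> (B / 2) * norm u" using r(2)[OF that] by blast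
    ultimately show ?thesis using B(2)[of u] by (simp add: field_simps)
  qed
  then show ?thesis using B r by (intro exI[of _ "B / 2"] conjI exI[of _ r]) auto
qed

text \<open>\<open>G y (U y - U x) = a y - G y (U x)\<close> tends to 0 as \<open>y\<close> tends to
  \<open>x\<close>, and the uniform lower bound of the maps \<open>G y\<close> carries this over to
  \<open>U y - U x\<close>.\<close>

lemma solution_continuous:
  assumes "continuous_on S a" "\<And>x. x \<in> S \<Longrightarrow> G x (U x) = a x"
  shows "continuous_on S U"
proof -
  have "isCont U x" if x: "x \<in> S" for x
  proof -
    obtain m r where mr: "m > 0" "r > 0"
      "\<And>y. dist y x < r \<Longrightarrow> y \<in> S \<and> (\<forall>u. m * norm u \<le> norm (G y u))"
      using family_bounded_below[OF x] by blast
    have "continuous_on S (\<lambda>y. G y (U x))"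
      using smooth_on_linear_family[OF S lin smooth_on_const smooth] by (rule smooth_on_continuous)
    then have "isCont (\<lambda>y. norm (a y - G y (U x)) / m) x"
      using assms(1) x mr(1) unfolding continuous_on_eq_continuous_at[OF S]
      by (intro continuous_divide continuous_norm continuous_diff continuous_const) auto
    then have lim: "((\<lambda>y. norm (a y - G y (U x)) / m) \<longlongrightarrow> 0) (at x)"
      using assms(2)[OF x] by (simp add: isCont_def)
    have "norm (U y - U x) \<le> norm (a y - G y (U x)) / m" if "dist y x < r" for y
    proof -
      have y: "y \<in> S" using mr that by blast
      have "G y (U y - U x) = a y - G y (U x)"
        using linear_diff[OF lin[OF y]] assms(2)[OF y] by simp
      then have "m * norm (U y - U x) \<le> norm (a y - G y (U x))" using mr(3)[OF that] by metis
      then show ?thesis using mr(1) by (simp add: field_simps)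
    qed
    then have "\<forall>\<^sub>F y in at x. norm (U y - U x) \<le> norm (a y - G y (U x)) / m"
      using mr(2) by (auto simp: eventually_at)
    from Lim_null_comparison[OF this lim] have "((\<lambda>y. U y - U x) \<longlongrightarrow> 0) (at x)" .
    then show ?thesis by (simp add: isCont_def LIM_zero_iff)
  qed
  then show ?thesis by (simp add: continuous_at_imp_continuous_on)
qed

text \<open>Subtracting \<open>G y (U x)\<close> from the right-hand side makes it vanish at \<open>x\<close>, so that only the
  continuity of \<open>G\<close> enters the estimate.\<close>

lemma solution_has_derivative:
  assumes x: "x \<in> S" and a: "a differentiable (at x)"
    and eq: "\<And>y. y \<in> S \<Longrightarrow> G y (U y) = a y"
  shows "\<exists>V. (U has_derivative V) (at x) \<and>
    (\<forall>v. G x (V v) = frechet_derivative a (at x) v - 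
      (\<Sum>i\<in>Basis. (U x \<bullet> i) *\<^sub>R frechet_derivative (\<lambda>y. G y i) (at x) v))"
proof -
  define H where "H y = a y - (\<Sum>i\<in>Basis. (U x \<bullet> i) *\<^sub>R G y i)" for y
  define H' where "H' v = frechet_derivative a (at x) v -
      (\<Sum>i\<in>Basis. (U x \<bullet> i) *\<^sub>R frechet_derivative (\<lambda>y. G y i) (at x) v)" for v
  have H: "(H has_derivative H') (at x)"
    unfolding H_def[abs_def] H'_def[abs_def] using a smooth smooth_on_has_derivative x
    by (intro has_derivative_diff has_derivative_sum has_derivative_scaleR_right)
      (auto simp: frechet_derivative_works[symmetric])
  have H_eq: "H y = a y - G y (U x)" if "y \<in> S" for y
    unfolding H_def using linear_euclidean_expansion[OF lin[OF that], of "U x"] by simp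
  obtain I where I: "linear I" "\<And>u. G x (I u) = u"
    using linear_injective_isomorphism[OF lin[OF x] inj[OF x]] by metis
  \<comment> \<open>Formal differentiation of \<open>G y (U y) = a y\<close> at \<open>x\<close>
    leaves \<open>G x (V v) = H' v\<close>. Inverting \<open>G x\<close> therefore yields the only
    candidate for the derivative.\<close>
  define V where "V = I \<circ> H'"
  have V_lin: "linear V"
    unfolding V_def using I(1) has_derivative_linear[OF H] by (rule linear_compose[rotated])
  have GV: "G x (V v) = H' v" for v by (simp add: V_def I(2))
  obtain K where K: "K > 0" "\<And>v. norm (V v) \<le> norm v * K"
    using bounded_linear.pos_bounded[of V] V_lin linear_conv_bounded_linear by blast
  obtain m r where mr: "m > 0" "r > 0"
      "\<And>y. dist y x < r \<Longrightarrow> y \<in> S \<and> (\<forall>u. m * norm u \<le> norm (G y u))"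
    using family_bounded_below[OF x] by blast
  have "(U has_derivative V) (at x)"
    unfolding has_derivative_at_alt
  proof (intro conjI allI impI)
    show "bounded_linear V" using V_lin linear_conv_bounded_linear by blast
    fix e :: real assume e: "0 < e"
    \<comment> \<open>\<open>m\<close> is the lower bound of \<open>G y\<close> near
      \<open>x\<close>, and \<open>K\<close> bounds \<open>V\<close>. With the tolerances chosen
      here the errors from \<open>H\<close> and from \<open>G y - G x\<close> add up to
      \<open>m * e * norm (y - x)\<close>, from which \<open>m\<close> cancels.\<close>
    obtain d1 where d1: "d1 > 0"
      "\<And>y. norm (y - x) < d1 \<Longrightarrow> norm (H y - H x - H' (y - x)) \<le> (m * e / 2) * norm (y - x)"
      using H e mr(1) unfolding has_derivative_at_alt by (metis divide_pos_pos mult_pos_pos zero_less_numeral)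
    obtain d2 where d2: "d2 > 0"
      "\<And>y u. dist y x < d2 \<Longrightarrow> norm (G y u - G x u) \<le> (m * e / (2 * K)) * norm u"
      using family_continuity[OF x, of "m * e / (2 * K)"] e mr(1) K(1) by auto
    have "norm (U y - U x - V (y - x)) \<le> e * norm (y - x)"
      if "norm (y - x) < min r (min d1 d2)" for y
    proof -
      have near: "dist y x < r" "norm (y - x) < d1" "dist y x < d2"
        using that by (auto simp: dist_norm)
      then have y: "y \<in> S" using mr(3) by blast
      have "H x = 0" using H_eq[OF x] eq[OF x] by simp
      then have "G y (U y - U x - V (y - x)) =
          (H y - H x - H' (y - x)) - (G y (V (y - x)) - G x (V (y - x)))"
        using H_eq[OF y] eq[OF y] GV by (simp add: linear_diff[OF lin[OF y]])
      also have "norm \<dots> \<le> norm (H y - H x - H' (y - x)) + norm (G y (V (y - x)) - G x (V (y - x)))"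
        by (rule norm_triangle_ineq4)
      also have "\<dots> \<le> (m * e / 2) * norm (y - x) + (m * e / (2 * K)) * norm (V (y - x))"
        using d1(2) d2(2) near by (intro add_mono) auto
      also have "\<dots> \<le> (m * e / 2) * norm (y - x) + (m * e / (2 * K)) * (norm (y - x) * K)"
        using K e mr(1) by (intro add_left_mono mult_left_mono) auto
      also have "\<dots> = m * (e * norm (y - x))" using K(1) by (simp add: field_simps)
      finally have "norm (G y (U y - U x - V (y - x))) \<le> m * (e * norm (y - x))" .
      moreover have "m * norm (U y - U x - V (y - x)) \<le> norm (G y (U y - U x - V (y - x)))"
        using mr(3)[OF near(1)] by blast
      ultimately have "m * norm (U y - U x - V (y - x)) \<le> m * (e * norm (y - x))" by linarith
      then show ?thesis using mr(1) by simp
    qed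
    then show "\<exists>d>0. \<forall>y. norm (y - x) < d \<longrightarrow> norm (U y - U x - V (y - x)) \<le> e * norm (y - x)"
      using mr(2) d1(1) d2(1) by (intro exI[of _ "min r (min d1 d2)"]) auto
  qed
  with GV show ?thesis unfolding H'_def by blast
qed

text \<open>The induction generalises \<open>a\<close> and \<open>U\<close> because a directional
  derivative of \<open>U\<close> solves the system with a new right-hand side. That side contains
  \<open>U\<close> itself, so class \<open>k\<close> of \<open>U\<close> is derived first.\<close>

lemma solution_Ck:
  assumes "Ck_on k S a" "\<And>x. x \<in> S \<Longrightarrow> G x (U x) = a x"
  shows "Ck_on k S U"
  using assms
proof (induction k arbitrary: a U)
  case 0
  then show ?case using solution_continuous by simp
next
  case (Suc k)
  have U: "Ck_on k S U" by (rule Suc.IH[OF Ck_on_SucD[OF Suc.prems(1)] Suc.prems(2)])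
  have a: "a differentiable (at x)" if "x \<in> S" for x using Suc.prems(1) that by simp
  have deriv: "U differentiable (at x) \<and> G x (frechet_derivative U (at x) v) =
      frechet_derivative a (at x) v -
      (\<Sum>i\<in>Basis. (U x \<bullet> i) *\<^sub>R frechet_derivative (\<lambda>y. G y i) (at x) v)" if x: "x \<in> S" for x v
  proof -
    obtain V where V: "(U has_derivative V) (at x)" "\<And>v. G x (V v) = frechet_derivative a (at x) v -
      (\<Sum>i\<in>Basis. (U x \<bullet> i) *\<^sub>R frechet_derivative (\<lambda>y. G y i) (at x) v)"
      using solution_has_derivative[OF x a[OF x] Suc.prems(2)] by blast
    from frechet_derivative_at[OF V(1)] V show ?thesis by (auto simp: differentiable_def)
  qed
  have "Ck_on k S (\<lambda>x. frechet_derivative U (at x) v)" for v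
  proof (rule Suc.IH)
    have "Ck_on k S (\<lambda>x. frechet_derivative (\<lambda>y. G y i) (at x) v)" if "i \<in> Basis" for i
      using smooth_on_frechet_derivative[OF smooth[OF that]] unfolding smooth_on_def by blast
    moreover have "Ck_on k S (\<lambda>x. U x \<bullet> i)" for i
      by (rule Ck_on_bounded_linear[OF S bounded_linear_inner_left U])
    ultimately have "Ck_on k S (\<lambda>x. frechet_derivative a (at x) v + 
      - (\<Sum>i\<in>Basis. (U x \<bullet> i) *\<^sub>R frechet_derivative (\<lambda>y. G y i) (at x) v))"
      using Suc.prems(1)
      by (intro Ck_on_add[OF S] Ck_on_sum[OF S]
          Ck_on_bounded_linear[OF S bounded_linear_minus[OF bounded_linear_ident]]
          Ck_on_bilinear[OF S bounded_bilinear_scaleR]) auto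
    then show "Ck_on k S (\<lambda>x. frechet_derivative a (at x) v -
      (\<Sum>i\<in>Basis. (U x \<bullet> i) *\<^sub>R frechet_derivative (\<lambda>y. G y i) (at x) v))" by simp
  qed (use deriv in blast)
  then show ?case using deriv by simp
qed

lemma smooth_on_solution:
  assumes "smooth_on S a" "\<And>x. x \<in> S \<Longrightarrow> G x (U x) = a x"
  shows "smooth_on S U"
  using assms solution_Ck unfolding smooth_on_def by blast

end

section \<open>Charts and vector fields\<close>

text \<open>A product rule: one summand has the vector frozen at \<open>X x\<close>, the other has
  the map frozen at \<open>x\<close>. It serves both for transition derivatives and for the
  components of covector fields.\<close>

lemma has_derivative_linear_family:
  fixes L :: "'b::euclidean_space \<Rightarrow> 'd::euclidean_space \<Rightarrow> 'c::real_normed_vector"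
  assumes "open S" "x \<in> S" "\<And>y. y \<in> S \<Longrightarrow> linear (L y)"
    and L: "\<And>i. i \<in> Basis \<Longrightarrow> (\<lambda>y. L y i) differentiable (at x)"
    and X: "(X has_derivative X') (at x)"
  shows "((\<lambda>y. L y (X y)) has_derivative
    (\<lambda>w. frechet_derivative (\<lambda>y. L y (X x)) (at x) w + L x (X' w))) (at x)"
proof -
  define L' where "L' i = frechet_derivative (\<lambda>y. L y i) (at x)" for i
  have L': "((\<lambda>y. L y i) has_derivative L' i) (at x)" if "i \<in> Basis" for i
    using L[OF that] unfolding L'_def by (simp add: frechet_derivative_works)
  have "((\<lambda>y. \<Sum>i\<in>Basis. (X x \<bullet> i) *\<^sub>R L y i) has_derivative
      (\<lambda>w. \<Sum>i\<in>Basis. (X x \<bullet> i) *\<^sub>R L' i w)) (at x)"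
    by (intro has_derivative_sum has_derivative_scaleR_right L')
  moreover have "frechet_derivative (\<lambda>y. L y (X x)) (at x) =
      frechet_derivative (\<lambda>y. \<Sum>i\<in>Basis. (X x \<bullet> i) *\<^sub>R L y i) (at x)"
    by (rule frechet_derivative_cong_open[OF assms(1,2)]) (rule linear_euclidean_expansion[OF assms(3)])
  ultimately have fixed: "frechet_derivative (\<lambda>y. L y (X x)) (at x) w
      = (\<Sum>i\<in>Basis. (X x \<bullet> i) *\<^sub>R L' i w)" for w
    using frechet_derivative_at by metis
  have Xi: "((\<lambda>y. X y \<bullet> i) has_derivative (\<lambda>w. X' w \<bullet> i)) (at x)" for i
    by (rule has_derivative_inner_left[OF X])
  have "((\<lambda>y. \<Sum>i\<in>Basis. (X y \<bullet> i) *\<^sub>R L y i) has_derivative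
      (\<lambda>w. \<Sum>i\<in>Basis. (X x \<bullet> i) *\<^sub>R L' i w + (X' w \<bullet> i) *\<^sub>R L x i)) (at x)"
    by (intro has_derivative_sum has_derivative_scaleR[OF Xi L'])
  also have "(\<lambda>w. \<Sum>i\<in>Basis. (X x \<bullet> i) *\<^sub>R L' i w + (X' w \<bullet> i) *\<^sub>R L x i)
      = (\<lambda>w. frechet_derivative (\<lambda>y. L y (X x)) (at x) w + L x (X' w))"
    unfolding fixed sum.distrib linear_euclidean_expansion[OF assms(3)[OF assms(2)], of "X' _"] ..
  finally show ?thesis
    by (rule has_derivative_transform_within_open[OF _ assms(1,2)])
      (rule linear_euclidean_expansion[OF assms(3), symmetric])
qed

lemma tvec_apply [simp]:
  "tadd v w c = v c + w c" "tdiff v w c = v c - w c" "tscale r v c = r *\<^sub>R v c" "tzero c = 0"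
  by (simp_all add: tadd_def tdiff_def tscale_def tzero_def)

lemma chart_inv_in: "x \<in> chart_image c \<Longrightarrow> chart_inv c x \<in> fst c"
  unfolding chart_image_def chart_inv_def by (rule inv_into_into)

lemma chart_inv_right: "x \<in> chart_image c \<Longrightarrow> snd c (chart_inv c x) = x"
  unfolding chart_image_def chart_inv_def by (rule f_inv_into_f)

context smooth_manifold
begin

section \<open>Charts, overlaps and the derivatives of transition maps\<close>

lemma inj_on_chart: "c \<in> A \<Longrightarrow> inj_on (snd c) (fst c)"
  using homeomorphic_imp_injective_map[OF chart_homeomorphic[of c]]
    openin_subset[OF chart_open[of c]] by (simp add: inf_absorb2)

lemma chart_inv_left: "c \<in> A \<Longrightarrow> p \<in> fst c \<Longrightarrow> chart_inv c (snd c p) = p"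
  unfolding chart_inv_def using inj_on_chart by (simp add: inv_into_f_f)

lemma chart_point: "p \<in> fst c \<Longrightarrow> snd c p \<in> chart_image c"
  unfolding chart_image_def by simp

lemma charts_atD: "c \<in> charts_at A p \<Longrightarrow> c \<in> A" "c \<in> charts_at A p \<Longrightarrow> p \<in> fst c"
  by (simp_all add: charts_at_def)

lemma carrierI: "c \<in> charts_at A p \<Longrightarrow> p \<in> carrier A"
  by (auto simp: charts_at_def carrier_def)

lemma chart_inv_charts_at: "c \<in> A \<Longrightarrow> x \<in> chart_image c \<Longrightarrow> c \<in> charts_at A (chart_inv c x)"
  by (simp add: charts_at_def chart_inv_in)

lemma some_chart: "p \<in> carrier A \<Longrightarrow> (SOME c. c \<in> charts_at A p) \<in> charts_at A p"
  by (rule someI_ex) (auto simp: charts_at_def carrier_def)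

lemma carrier_chart: "p \<in> carrier A \<Longrightarrow> \<exists>c. c \<in> charts_at A p"
  using some_chart by blast

definition overlap :: "('a, 'b) chart \<Rightarrow> ('a, 'b) chart \<Rightarrow> 'b set" where
  "overlap c c' = snd c ` (fst c \<inter> fst c')"

text \<open>The chart carries the relatively open intersection to a relatively open subset of its
  image, and the image is itself open.\<close>

lemma open_overlap:
  assumes "c \<in> A" "c' \<in> A"
  shows "open (overlap c c')"
proof -
  have sub: "fst c \<subseteq> topspace \<tau>" using chart_open[OF assms(1)] openin_subset by blast
  have "openin (subtopology \<tau> (fst c)) (fst c \<inter> fst c')"
    using chart_open[OF assms(2)] by (metis inf_commute openin_subtopology_Int)
  then have "openin (top_of_set (chart_image c)) (overlap c c')"
    unfolding overlap_def
    using homeomorphic_map_openness[OF chart_homeomorphic[OF assms(1)], of "fst c \<inter> fst c'"] sub by auto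
  then show ?thesis using chart_image_open[OF assms(1)] openin_open_eq by blast
qed

lemma overlapI: "c \<in> charts_at A p \<Longrightarrow> c' \<in> charts_at A p \<Longrightarrow> snd c p \<in> overlap c c'"
  unfolding overlap_def by (simp add: charts_at_def)

lemma overlapD:
  assumes "c \<in> A" "c' \<in> A" "x \<in> overlap c c'"
  shows "c \<in> charts_at A (chart_inv c x)" "c' \<in> charts_at A (chart_inv c x)"
    "snd c (chart_inv c x) = x" "chart_inv c' (snd c' (chart_inv c x)) = chart_inv c x"
  using assms by (auto simp: overlap_def charts_at_def chart_inv_left)

lemma smooth_transition: "c \<in> A \<Longrightarrow> c' \<in> A \<Longrightarrow> smooth_on (overlap c c') (snd c' \<circ> chart_inv c)"
  unfolding overlap_def by (rule transition_smooth)

lemma has_derivative_transition: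
  assumes "c \<in> charts_at A p" "c' \<in> charts_at A p"
  shows "((snd c' \<circ> chart_inv c) has_derivative coord_change c c' p) (at (snd c p))"
  unfolding coord_change_def using assms overlapI charts_atD
  by (intro smooth_on_has_derivative[OF smooth_transition]) auto

lemma linear_coord_change:
  "c \<in> charts_at A p \<Longrightarrow> c' \<in> charts_at A p \<Longrightarrow> linear (coord_change c c' p)"
  using has_derivative_transition has_derivative_linear by blast

lemma coord_change_self:
  assumes "c \<in> charts_at A p"
  shows "coord_change c c p u = u"
proof -
  have "coord_change c c p = frechet_derivative (\<lambda>x. x) (at (snd c p))"
    unfolding coord_change_def using assms
    by (intro frechet_derivative_cong_open[OF chart_image_open[of c]])
      (auto simp: charts_at_def chart_inv_right chart_point)
  then show ?thesis by simp
qed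

text \<open>The cocycle rule, from the chain rule. The composite of two transitions equals the
  direct transition on \<open>overlap c c'\<close>, which is a neighbourhood of
  \<open>snd c p\<close>.\<close>

lemma coord_change_compose:
  assumes "c \<in> charts_at A p" "c' \<in> charts_at A p" "c'' \<in> charts_at A p"
  shows "coord_change c' c'' p (coord_change c c' p u) = coord_change c c'' p u"
proof -
  note A = charts_atD(1)[OF assms(1)] charts_atD(1)[OF assms(2)] charts_atD(1)[OF assms(3)]
  have left: "chart_inv c (snd c p) = p" using assms by (simp add: charts_at_def chart_inv_left)
  have "((\<lambda>x. (snd c'' \<circ> chart_inv c') ((snd c' \<circ> chart_inv c) x)) has_derivative
      (\<lambda>u. coord_change c' c'' p (coord_change c c' p u))) (at (snd c p))"
    using has_derivative_compose[OF has_derivative_transition[OF assms(1,2)],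
      of "snd c'' \<circ> chart_inv c'" "coord_change c' c'' p"] has_derivative_transition[OF assms(2,3)] left
    by simp
  then have "((snd c'' \<circ> chart_inv c) has_derivative
      (\<lambda>u. coord_change c' c'' p (coord_change c c' p u))) (at (snd c p))"
    by (rule has_derivative_transform_within_open[OF _ open_overlap[OF A(1,2)] overlapI[OF assms(1,2)]])
      (use overlapD(4)[OF A(1,2)] in simp)
  from fun_cong[OF has_derivative_unique[OF this has_derivative_transition[OF assms(1,3)]]]
  show ?thesis .
qed

section \<open>Tangent vectors and vector fields in coordinates\<close>

lemma tangent_spaceD:
  "v \<in> tangent_space A p \<Longrightarrow> c \<in> charts_at A p \<Longrightarrow> c' \<in> charts_at A p \<Longrightarrow> v c' = coord_change c c' p (v c)"
  "v \<in> tangent_space A p \<Longrightarrow> c \<notin> charts_at A p \<Longrightarrow> v c = 0"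
  unfolding tangent_space_def by blast+

lemma tangent_spaceI:
  "(\<And>c c'. c \<in> charts_at A p \<Longrightarrow> c' \<in> charts_at A p \<Longrightarrow> v c' = coord_change c c' p (v c)) \<Longrightarrow>
    (\<And>c. c \<notin> charts_at A p \<Longrightarrow> v c = 0) \<Longrightarrow> v \<in> tangent_space A p"
  unfolding tangent_space_def by blast

lemma tangent_space_eqI:
  assumes "v \<in> tangent_space A p" "w \<in> tangent_space A p" "c \<in> charts_at A p" "v c = w c"
  shows "v = w"
proof
  fix c' show "v c' = w c'"
    using tangent_spaceD(1)[OF assms(1), of c c'] tangent_spaceD(1)[OF assms(2), of c c'] assms(3,4)
      tangent_spaceD(2)[OF assms(1), of c'] tangent_spaceD(2)[OF assms(2), of c']
    by (cases "c' \<in> charts_at A p") simp_all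
qed

lemma tangent_outside: "v \<in> tangent_space A p \<Longrightarrow> p \<notin> carrier A \<Longrightarrow> v = tzero"
  using tangent_spaceD(2)[of v p] carrierI[of _ p] by (intro ext) (simp, blast)

lemma tangent_space_closed:
  assumes "v \<in> tangent_space A p" "w \<in> tangent_space A p"
  shows "tadd v w \<in> tangent_space A p" "tdiff v w \<in> tangent_space A p"
proof -
  note D = tangent_spaceD(1)[OF assms(1)] tangent_spaceD(1)[OF assms(2)]
  note Z = tangent_spaceD(2)[OF assms(1)] tangent_spaceD(2)[OF assms(2)]
  show "tadd v w \<in> tangent_space A p"
  proof (rule tangent_spaceI)
    fix c c' assume c: "c \<in> charts_at A p" "c' \<in> charts_at A p"
    show "tadd v w c' = coord_change c c' p (tadd v w c)"
      unfolding tvec_apply linear_add[OF linear_coord_change[OF c]] D(1)[OF c] D(2)[OF c] ..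
  qed (simp add: Z)
  show "tdiff v w \<in> tangent_space A p"
  proof (rule tangent_spaceI)
    fix c c' assume c: "c \<in> charts_at A p" "c' \<in> charts_at A p"
    show "tdiff v w c' = coord_change c c' p (tdiff v w c)"
      unfolding tvec_apply linear_diff[OF linear_coord_change[OF c]] D(1)[OF c] D(2)[OF c] ..
  qed (simp add: Z)
qed

lemma tscale_tangent:
  assumes "v \<in> tangent_space A p"
  shows "tscale r v \<in> tangent_space A p"
proof (rule tangent_spaceI)
  fix c c' assume c: "c \<in> charts_at A p" "c' \<in> charts_at A p"
  show "tscale r v c' = coord_change c c' p (tscale r v c)"
    unfolding tvec_apply linear_scale[OF linear_coord_change[OF c]] tangent_spaceD(1)[OF assms c] ..
qed (simp add: tangent_spaceD(2)[OF assms])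

lemma tzero_tangent [simp]: "tzero \<in> tangent_space A p"
  unfolding tangent_space_def by (auto simp: linear_0[OF linear_coord_change])

lemma coord_vec_tangent:
  assumes "c \<in> charts_at A p"
  shows "coord_vec A c p u \<in> tangent_space A p"
  by (rule tangent_spaceI) (simp_all add: coord_vec_def coord_change_compose[OF assms])

lemma coord_vec_chart: "c \<in> charts_at A p \<Longrightarrow> coord_vec A c p u c = u"
  unfolding coord_vec_def by (simp add: coord_change_self)

lemma coord_vec_of_tangent:
  "v \<in> tangent_space A p \<Longrightarrow> c \<in> charts_at A p \<Longrightarrow> coord_vec A c p (v c) = v"
  by (rule tangent_space_eqI[of _ p _ c]) (simp_all add: coord_vec_tangent coord_vec_chart)

lemma coord_vec_apply: "c' \<in> charts_at A p \<Longrightarrow> coord_vec A c p u c' = coord_change c c' p u"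
  unfolding coord_vec_def by simp

lemma coord_vec_change:
  "c \<in> charts_at A p \<Longrightarrow> c' \<in> charts_at A p \<Longrightarrow>
    coord_vec A c' p (coord_change c c' p u) = coord_vec A c p u"
  by (rule tangent_space_eqI[of _ p _ c'])
    (simp_all add: coord_vec_tangent coord_vec_chart coord_vec_apply)

lemma coord_vec_add: "c \<in> charts_at A p \<Longrightarrow>
    coord_vec A c p (u + v) = tadd (coord_vec A c p u) (coord_vec A c p v)"
  by (rule tangent_space_eqI[of _ p _ c])
    (simp_all add: coord_vec_tangent coord_vec_chart tangent_space_closed)

lemma coord_vec_scale: "c \<in> charts_at A p \<Longrightarrow>
    coord_vec A c p (r *\<^sub>R u) = tscale r (coord_vec A c p u)"
  by (rule tangent_space_eqI[of _ p _ c])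
    (simp_all add: coord_vec_tangent coord_vec_chart tscale_tangent)

lemma vector_fieldD: "X \<in> vector_fields A \<Longrightarrow> X p \<in> tangent_space A p"
  "X \<in> vector_fields A \<Longrightarrow> c \<in> A \<Longrightarrow> smooth_on (chart_image c) (\<lambda>x. X (chart_inv c x) c)"
  unfolding vector_fields_def by blast+

text \<open>Outside the manifold both values lie in a tangent space that contains only the zero
  vector.\<close>

lemma vector_field_eqI:
  assumes "X \<in> vector_fields A" "Y \<in> vector_fields A" "\<And>p. p \<in> carrier A \<Longrightarrow> X p = Y p"
  shows "X = Y"
proof
  fix p show "X p = Y p"
    using assms(3) tangent_outside[OF vector_fieldD(1)[OF assms(1)], of p]
      tangent_outside[OF vector_fieldD(1)[OF assms(2)], of p] by metis
qed

lemma vector_field_has_derivative: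
  assumes "X \<in> vector_fields A" "c \<in> charts_at A p"
  shows "((\<lambda>x. X (chart_inv c x) c) has_derivative
    frechet_derivative (\<lambda>x. X (chart_inv c x) c) (at (snd c p))) (at (snd c p))"
  using vector_fieldD(2)[OF assms(1) charts_atD(1)[OF assms(2)]] charts_atD(2)[OF assms(2)]
  by (rule smooth_on_has_derivative[OF _ chart_point])

text \<open>The Hessian of the transition map. It is the non-tensorial term by which the derivatives
  of components in two charts differ.\<close>

abbreviation second_transition :: "('a, 'b) chart \<Rightarrow> ('a, 'b) chart \<Rightarrow> 'a \<Rightarrow> 'b \<Rightarrow> 'b \<Rightarrow> 'b" where
  "second_transition c c' p u w \<equiv> frechet_derivative
     (\<lambda>x. frechet_derivative (snd c' \<circ> chart_inv c) (at x) u) (at (snd c p)) w"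

lemma second_transition_symmetric:
  assumes "c \<in> charts_at A p" "c' \<in> charts_at A p"
  shows "second_transition c c' p u w = second_transition c c' p w u"
  by (rule second_derivative_symmetric[OF open_overlap overlapI[OF assms] smooth_transition])
    (use assms charts_atD in auto)

text \<open>The components in \<open>c'\<close>, read in the coordinates of \<open>c\<close>, are
  differentiated in two ways: by the chain rule, and by the product rule after writing them as the
  transition derivative applied to the components in \<open>c\<close>.\<close>

lemma vector_field_derivative_change:
  assumes X: "X \<in> vector_fields A" and c: "c \<in> charts_at A p" and c': "c' \<in> charts_at A p"
  shows "frechet_derivative (\<lambda>x. X (chart_inv c' x) c') (at (snd c' p)) (coord_change c c' p w) =
    second_transition c c' p (X p c) w +
    coord_change c c' p (frechet_derivative (\<lambda>x. X (chart_inv c x) c) (at (snd c p)) w)"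
proof -
  note A = charts_atD(1)[OF c] charts_atD(1)[OF c']
  note left = chart_inv_left[OF A(1) charts_atD(2)[OF c]]
  let ?\<phi> = "snd c' \<circ> chart_inv c" and ?X = "\<lambda>c x. X (chart_inv c x) c"
  have "((\<lambda>x. ?X c' (?\<phi> x)) has_derivative
      (\<lambda>w. frechet_derivative (?X c') (at (snd c' p)) (coord_change c c' p w))) (at (snd c p))"
    using has_derivative_compose[OF has_derivative_transition[OF c c'], of "?X c'"]
      vector_field_has_derivative[OF X c'] left by simp
  moreover have "((\<lambda>x. ?X c' (?\<phi> x)) has_derivative
      (\<lambda>w. second_transition c c' p (X p c) w +
        coord_change c c' p (frechet_derivative (?X c) (at (snd c p)) w))) (at (snd c p))"
  proof (rule has_derivative_transform_within_open[OF _ open_overlap[OF A] overlapI[OF c c']])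
    show "((\<lambda>x. frechet_derivative ?\<phi> (at x) (?X c x)) has_derivative
      (\<lambda>w. second_transition c c' p (X p c) w +
        coord_change c c' p (frechet_derivative (?X c) (at (snd c p)) w))) (at (snd c p))"
      using has_derivative_linear_family[OF open_overlap[OF A] overlapI[OF c c'],
          of "\<lambda>x. frechet_derivative ?\<phi> (at x)", OF _ _ vector_field_has_derivative[OF X c]]
        smooth_on_differentiable[OF smooth_on_frechet_derivative[OF smooth_transition[OF A]] overlapI[OF c c']]
        linear_frechet_derivative[OF smooth_on_differentiable[OF smooth_transition[OF A]]] left
      unfolding coord_change_def by simp
    fix x assume x: "x \<in> overlap c c'"
    show "frechet_derivative ?\<phi> (at x) (?X c x) = ?X c' (?\<phi> x)"
      using tangent_spaceD(1)[OF vector_fieldD(1)[OF X] overlapD(1,2)[OF A x]] overlapD(3,4)[OF A x]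
      by (simp add: coord_change_def)
  qed
  ultimately show ?thesis by (rule has_derivative_unique[THEN fun_cong])
qed

text \<open>Under a change of chart both halves of the bracket acquire the same Hessian term, by
  symmetry, and the difference removes it.\<close>

lemma vector_field_lie_bracket:
  assumes X: "X \<in> vector_fields A" and Y: "Y \<in> vector_fields A"
  shows "lie_bracket A X Y \<in> vector_fields A"
proof -
  have "lie_bracket A X Y p \<in> tangent_space A p" for p
  proof (rule tangent_spaceI)
    fix c c' assume c: "c \<in> charts_at A p" and c': "c' \<in> charts_at A p"
    show "lie_bracket A X Y p c' = coord_change c c' p (lie_bracket A X Y p c)"
      using c c' vector_field_derivative_change[OF X c c', of "Y p c"]
        vector_field_derivative_change[OF Y c c', of "X p c"]
        tangent_spaceD(1)[OF vector_fieldD(1)[OF X] c c'] tangent_spaceD(1)[OF vector_fieldD(1)[OF Y] c c']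
        second_transition_symmetric[OF c c', of "X p c" "Y p c"]
      by (simp add: lie_bracket_def linear_diff[OF linear_coord_change])
  qed (simp add: lie_bracket_def)
  moreover have "smooth_on (chart_image c) (\<lambda>x. lie_bracket A X Y (chart_inv c x) c)" if c: "c \<in> A" for c
  proof -
    have "smooth_on (chart_image c) (\<lambda>x.
        frechet_derivative (\<lambda>x. Y (chart_inv c x) c) (at x) (X (chart_inv c x) c)
      - frechet_derivative (\<lambda>x. X (chart_inv c x) c) (at x) (Y (chart_inv c x) c))"
      using chart_image_open[OF c] vector_fieldD(2)[OF X c] vector_fieldD(2)[OF Y c]
      by (intro smooth_on_diff smooth_on_derivative_along)
    then show ?thesis
      by (rule smooth_on_cong[THEN iffD1, OF chart_image_open[OF c], rotated])
        (simp add: lie_bracket_def chart_inv_charts_at[OF c] chart_inv_right)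
  qed
  ultimately show ?thesis unfolding vector_fields_def by blast
qed

end

section \<open>Covector fields\<close>

text \<open>The expression of \<open>dir_deriv\<close> on a single tangent vector, which makes
  \<open>df\<close> available as a covector field.\<close>

definition differential ::
  "('a, 'b::euclidean_space) chart set \<Rightarrow> ('a \<Rightarrow> real) \<Rightarrow> 'a \<Rightarrow> ('a, 'b) tvec \<Rightarrow> real" where
  "differential A f p v =
     (let c = (SOME c. c \<in> charts_at A p)
      in frechet_derivative (f \<circ> chart_inv c) (at (snd c p)) (v c))"

text \<open>Smoothness is asked for every constant coordinate vector \<open>u\<close>, so that it
  applies to the coordinates \<open>v c\<close> of a given tangent vector.\<close>

definition covector_field ::
  "('a, 'b::euclidean_space) chart set \<Rightarrow> ('a \<Rightarrow> ('a, 'b) tvec \<Rightarrow> real) \<Rightarrow> bool" where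
  "covector_field A \<beta> \<longleftrightarrow>
     (\<forall>p\<in>carrier A. \<forall>v\<in>tangent_space A p.
        (\<forall>w\<in>tangent_space A p. \<beta> p (tadd v w) = \<beta> p v + \<beta> p w) \<and>
        (\<forall>r. \<beta> p (tscale r v) = r * \<beta> p v)) \<and>
     (\<forall>c\<in>A. \<forall>u. smooth_on (chart_image c) (\<lambda>x. \<beta> (chart_inv c x) (coord_vec A c (chart_inv c x) u)))"

text \<open>The Lie derivative of a covector field in the chart \<open>c\<close>:
  \<open>(L\<^sub>X \<beta>)\<^sub>j = X\<^sup>i \<partial>\<^sub>i \<beta>\<^sub>j + \<beta>\<^sub>i \<partial>\<^sub>j X\<^sup>i\<close>.\<close>

definition chart_lie_covector ::
  "('a, 'b::euclidean_space) chart set \<Rightarrow> ('a, 'b) chart \<Rightarrow> ('a, 'b) vfield \<Rightarrow>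
   ('a \<Rightarrow> ('a, 'b) tvec \<Rightarrow> real) \<Rightarrow> 'a \<Rightarrow> ('a, 'b) tvec \<Rightarrow> real" where
  "chart_lie_covector A c X \<beta> p v =
     frechet_derivative (\<lambda>x. \<beta> (chart_inv c x) (coord_vec A c (chart_inv c x) (v c)))
       (at (snd c p)) (X p c)
     + \<beta> p (coord_vec A c p (frechet_derivative (\<lambda>x. X (chart_inv c x) c) (at (snd c p)) (v c)))"

definition lie_covector ::
  "('a, 'b::euclidean_space) chart set \<Rightarrow> ('a, 'b) vfield \<Rightarrow>
   ('a \<Rightarrow> ('a, 'b) tvec \<Rightarrow> real) \<Rightarrow> 'a \<Rightarrow> ('a, 'b) tvec \<Rightarrow> real" where
  "lie_covector A X \<beta> p = chart_lie_covector A (SOME c. c \<in> charts_at A p) X \<beta> p"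

lemma field_apply [simp]:
  "vadd X Y p = tadd (X p) (Y p)" "vdiff X Y p = tdiff (X p) (Y p)" "vscale f X p = tscale (f p) (X p)"
  by (simp_all add: vadd_def vdiff_def vscale_def)

lemma dir_deriv_differential: "dir_deriv A X f p = differential A f p (X p)"
  unfolding dir_deriv_def differential_def ..

context smooth_manifold
begin

section \<open>Smooth functions and their derivatives along vector fields\<close>

lemma smooth_fun_chart:
  "smooth_fun A f \<Longrightarrow> c \<in> A \<Longrightarrow> smooth_on (chart_image c) (\<lambda>x. f (chart_inv c x))"
  unfolding smooth_fun_def comp_def by blast

lemma smooth_funI:
  "(\<And>c. c \<in> A \<Longrightarrow> smooth_on (chart_image c) (\<lambda>x. f (chart_inv c x))) \<Longrightarrow> smooth_fun A f"
  unfolding smooth_fun_def comp_def by blast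

lemma smooth_fun_cong:
  assumes "\<And>p. p \<in> carrier A \<Longrightarrow> f p = h p"
  shows "smooth_fun A f \<longleftrightarrow> smooth_fun A h"
proof -
  have "smooth_on (chart_image c) (\<lambda>x. f (chart_inv c x)) \<longleftrightarrow>
      smooth_on (chart_image c) (\<lambda>x. h (chart_inv c x))" if "c \<in> A" for c
    by (rule smooth_on_cong[OF chart_image_open[OF that]])
      (rule assms[OF carrierI[OF chart_inv_charts_at[OF that]]])
  then show ?thesis unfolding smooth_fun_def comp_def by blast
qed

lemma smooth_fun_const [simp]: "smooth_fun A (\<lambda>_. r)"
  by (rule smooth_funI) (rule smooth_on_const)

lemma smooth_fun_add: "smooth_fun A f \<Longrightarrow> smooth_fun A h \<Longrightarrow> smooth_fun A (\<lambda>p. f p + h p)"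
  by (rule smooth_funI, rule smooth_on_add) (simp_all add: chart_image_open smooth_fun_chart)

lemma smooth_fun_mult: "smooth_fun A f \<Longrightarrow> smooth_fun A h \<Longrightarrow> smooth_fun A (\<lambda>p. f p * h p)"
  by (rule smooth_funI, rule smooth_on_mult) (simp_all add: chart_image_open smooth_fun_chart)

lemma smooth_fun_minus: "smooth_fun A f \<Longrightarrow> smooth_fun A (\<lambda>p. - f p)"
  using smooth_fun_mult[of "\<lambda>_. -1" f] by simp

lemma vector_fieldI:
  "(\<And>p. X p \<in> tangent_space A p) \<Longrightarrow>
    (\<And>c. c \<in> A \<Longrightarrow> smooth_on (chart_image c) (\<lambda>x. X (chart_inv c x) c)) \<Longrightarrow> X \<in> vector_fields A"
  unfolding vector_fields_def by blast

lemma vector_field_vadd: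
  assumes "X \<in> vector_fields A" "Y \<in> vector_fields A"
  shows "vadd X Y \<in> vector_fields A"
  using vector_fieldD[OF assms(1)] vector_fieldD[OF assms(2)]
  by (intro vector_fieldI) (simp_all add: tangent_space_closed chart_image_open smooth_on_add)

lemma vector_field_vdiff:
  assumes "X \<in> vector_fields A" "Y \<in> vector_fields A"
  shows "vdiff X Y \<in> vector_fields A"
  using vector_fieldD[OF assms(1)] vector_fieldD[OF assms(2)]
  by (intro vector_fieldI) (simp_all add: tangent_space_closed chart_image_open smooth_on_diff)

lemma vector_field_vscale:
  assumes "smooth_fun A f" "X \<in> vector_fields A"
  shows "vscale f X \<in> vector_fields A"
  using vector_fieldD[OF assms(2)] smooth_fun_chart[OF assms(1)]
  by (intro vector_fieldI) (simp_all add: tscale_tangent chart_image_open smooth_on_scaleR)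

lemma smooth_fun_has_derivative:
  assumes "smooth_fun A f" "c \<in> charts_at A p"
  shows "((\<lambda>x. f (chart_inv c x)) has_derivative
    frechet_derivative (\<lambda>x. f (chart_inv c x)) (at (snd c p))) (at (snd c p))"
  using smooth_fun_chart[OF assms(1) charts_atD(1)[OF assms(2)]] charts_atD(2)[OF assms(2)]
  by (rule smooth_on_has_derivative[OF _ chart_point])

text \<open>Independence of the chosen chart: the chain rule produces the derivative of the
  transition map, and the same linear map takes the coordinates of \<open>v\<close> in the chosen
  chart to those in \<open>c\<close>.\<close>

lemma differential_chart:
  assumes f: "smooth_fun A f" and v: "v \<in> tangent_space A p" and c: "c \<in> charts_at A p"
  shows "differential A f p v = frechet_derivative (\<lambda>x. f (chart_inv c x)) (at (snd c p)) (v c)"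
proof -
  define c' where "c' = (SOME c. c \<in> charts_at A p)"
  have c': "c' \<in> charts_at A p" unfolding c'_def by (rule some_chart[OF carrierI[OF c]])
  note A = charts_atD(1)[OF c'] charts_atD(1)[OF c]
  have "((\<lambda>x. f (chart_inv c ((snd c \<circ> chart_inv c') x))) has_derivative
      (\<lambda>u. frechet_derivative (\<lambda>x. f (chart_inv c x)) (at (snd c p)) (coord_change c' c p u)))
      (at (snd c' p))"
    using has_derivative_compose[OF has_derivative_transition[OF c' c], of "\<lambda>x. f (chart_inv c x)"]
      smooth_fun_has_derivative[OF f c] chart_inv_left[OF A(1) charts_atD(2)[OF c']] by simp
  then have "((\<lambda>x. f (chart_inv c' x)) has_derivative
      (\<lambda>u. frechet_derivative (\<lambda>x. f (chart_inv c x)) (at (snd c p)) (coord_change c' c p u)))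
      (at (snd c' p))"
    by (rule has_derivative_transform_within_open[OF _ open_overlap[OF A] overlapI[OF c' c]])
      (simp add: overlapD(4)[OF A])
  from frechet_derivative_at[OF this, THEN fun_cong] show ?thesis
    unfolding differential_def Let_def c'_def[symmetric] tangent_spaceD(1)[OF v c' c] comp_def
    by (rule sym)
qed

lemma dir_deriv_chart:
  assumes "smooth_fun A f" "X \<in> vector_fields A" "c \<in> charts_at A p"
  shows "dir_deriv A X f p = frechet_derivative (\<lambda>x. f (chart_inv c x)) (at (snd c p)) (X p c)"
  unfolding dir_deriv_differential by (rule differential_chart[OF assms(1) vector_fieldD(1) assms(3)]) (rule assms)

text \<open>Identities between metric products hold on the carrier only; this is the means to use
  them under a derivative. Each chart image is an open set of points of the manifold, so the
  functions agree near the point in question.\<close>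

lemma dir_deriv_cong:
  assumes "p \<in> carrier A" "\<And>q. q \<in> carrier A \<Longrightarrow> f q = h q"
  shows "dir_deriv A X f p = dir_deriv A X h p"
proof -
  define c where "c = (SOME c. c \<in> charts_at A p)"
  have c: "c \<in> charts_at A p" unfolding c_def by (rule some_chart[OF assms(1)])
  have "frechet_derivative (f \<circ> chart_inv c) (at (snd c p))
      = frechet_derivative (h \<circ> chart_inv c) (at (snd c p))"
    by (rule frechet_derivative_cong_open[OF chart_image_open[OF charts_atD(1)[OF c]]])
      (simp_all add: chart_point charts_atD[OF c] assms(2) carrierI[OF chart_inv_charts_at])
  then show ?thesis unfolding dir_deriv_def Let_def c_def[symmetric] by simp
qed

lemma smooth_fun_dir_deriv:
  assumes "smooth_fun A f" "X \<in> vector_fields A"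
  shows "smooth_fun A (dir_deriv A X f)"
proof (rule smooth_funI)
  fix c assume c: "c \<in> A"
  have "smooth_on (chart_image c)
      (\<lambda>x. frechet_derivative (\<lambda>x. f (chart_inv c x)) (at x) (X (chart_inv c x) c))"
    by (rule smooth_on_derivative_along[OF chart_image_open smooth_fun_chart vector_fieldD(2)])
      (rule assms c)+
  then show "smooth_on (chart_image c) (\<lambda>x. dir_deriv A X f (chart_inv c x))"
    by (rule smooth_on_cong[THEN iffD1, OF chart_image_open[OF c], rotated])
      (simp add: dir_deriv_chart[OF assms chart_inv_charts_at[OF c]] chart_inv_right)
qed

lemma dir_deriv_add_fun:
  assumes f: "smooth_fun A f" and h: "smooth_fun A h" and X: "X \<in> vector_fields A" and "p \<in> carrier A"
  shows "dir_deriv A X (\<lambda>q. f q + h q) p = dir_deriv A X f p + dir_deriv A X h p"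
proof -
  obtain c where c: "c \<in> charts_at A p" using carrier_chart assms by blast
  show ?thesis
    unfolding dir_deriv_chart[OF f X c] dir_deriv_chart[OF h X c]
      dir_deriv_chart[OF smooth_fun_add[OF f h] X c]
    using frechet_derivative_at[OF has_derivative_add[OF smooth_fun_has_derivative[OF f c]
      smooth_fun_has_derivative[OF h c]], THEN fun_cong, of "X p c"] by simp
qed

lemma dir_deriv_mult_fun:
  assumes f: "smooth_fun A f" and h: "smooth_fun A h" and X: "X \<in> vector_fields A" and "p \<in> carrier A"
  shows "dir_deriv A X (\<lambda>q. f q * h q) p = f p * dir_deriv A X h p + dir_deriv A X f p * h p"
proof -
  obtain c where c: "c \<in> charts_at A p" using carrier_chart assms by blast
  show ?thesis
    unfolding dir_deriv_chart[OF f X c] dir_deriv_chart[OF h X c]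
      dir_deriv_chart[OF smooth_fun_mult[OF f h] X c]
    using frechet_derivative_at[OF has_derivative_mult[OF smooth_fun_has_derivative[OF f c]
      smooth_fun_has_derivative[OF h c]], THEN fun_cong, of "X p c"] 
      chart_inv_left[OF charts_atD[OF c]] by simp
qed

lemma dir_deriv_const:
  assumes "X \<in> vector_fields A" "p \<in> carrier A"
  shows "dir_deriv A X (\<lambda>_. r) p = 0"
proof -
  obtain c where c: "c \<in> charts_at A p" using carrier_chart assms by blast
  show ?thesis unfolding dir_deriv_chart[OF smooth_fun_const assms(1) c] by simp
qed

lemma dir_deriv_minus_fun:
  assumes "smooth_fun A f" "X \<in> vector_fields A" "p \<in> carrier A"
  shows "dir_deriv A X (\<lambda>q. - f q) p = - dir_deriv A X f p"
  using dir_deriv_mult_fun[OF smooth_fun_const assms, of "-1"] dir_deriv_const[OF assms(2,3)] by simp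

lemma dir_deriv_vadd:
  assumes f: "smooth_fun A f" and X: "X \<in> vector_fields A" and Y: "Y \<in> vector_fields A" and "p \<in> carrier A"
  shows "dir_deriv A (vadd X Y) f p = dir_deriv A X f p + dir_deriv A Y f p"
proof -
  obtain c where c: "c \<in> charts_at A p" using carrier_chart assms by blast
  show ?thesis
    unfolding dir_deriv_chart[OF f X c] dir_deriv_chart[OF f Y c]
      dir_deriv_chart[OF f vector_field_vadd[OF X Y] c]
    by (simp add: linear_add[OF has_derivative_linear[OF smooth_fun_has_derivative[OF f c]]])
qed

lemma dir_deriv_vscale:
  assumes f: "smooth_fun A f" and h: "smooth_fun A h" and X: "X \<in> vector_fields A" and "p \<in> carrier A"
  shows "dir_deriv A (vscale h X) f p = h p * dir_deriv A X f p"
proof -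
  obtain c where c: "c \<in> charts_at A p" using carrier_chart assms by blast
  show ?thesis
    unfolding dir_deriv_chart[OF f X c] dir_deriv_chart[OF f vector_field_vscale[OF h X] c]
    by (simp add: linear_scale[OF has_derivative_linear[OF smooth_fun_has_derivative[OF f c]]])
qed

section \<open>Algebraic rules for the Lie bracket\<close>

lemma lie_bracket_skew: "lie_bracket A Y X = vscale (\<lambda>_. -1) (lie_bracket A X Y)"
  by (intro ext) (simp add: lie_bracket_def)

lemma lie_bracket_vadd:
  assumes X: "X \<in> vector_fields A" and Y: "Y \<in> vector_fields A" and Z: "Z \<in> vector_fields A"
  shows "lie_bracket A X (vadd Y Z) = vadd (lie_bracket A X Y) (lie_bracket A X Z)"
proof (intro ext)
  fix p c
  show "lie_bracket A X (vadd Y Z) p c = vadd (lie_bracket A X Y) (lie_bracket A X Z) p c"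
  proof (cases "c \<in> charts_at A p")
    case c: True
    show ?thesis
      using c frechet_derivative_at[OF has_derivative_add[OF vector_field_has_derivative[OF Y c]
          vector_field_has_derivative[OF Z c]], THEN fun_cong, of "X p c"]
        linear_add[OF has_derivative_linear[OF vector_field_has_derivative[OF X c]], of "Y p c" "Z p c"]
      by (simp add: lie_bracket_def)
  qed (simp add: lie_bracket_def)
qed

lemma lie_bracket_vscale:
  assumes f: "smooth_fun A f" and X: "X \<in> vector_fields A" and Y: "Y \<in> vector_fields A"
  shows "lie_bracket A X (vscale f Y) = vadd (vscale (dir_deriv A X f) Y) (vscale f (lie_bracket A X Y))"
proof (intro ext)
  fix p c
  show "lie_bracket A X (vscale f Y) p c
      = vadd (vscale (dir_deriv A X f) Y) (vscale f (lie_bracket A X Y)) p c"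
  proof (cases "c \<in> charts_at A p")
    case c: True
    show ?thesis
      using c frechet_derivative_at[OF has_derivative_scaleR[OF smooth_fun_has_derivative[OF f c]
          vector_field_has_derivative[OF Y c]], THEN fun_cong, of "X p c"]
        linear_scale[OF has_derivative_linear[OF vector_field_has_derivative[OF X c]], of "f p" "Y p c"]
        chart_inv_left[OF charts_atD[OF c]]
      by (simp add: lie_bracket_def dir_deriv_chart[OF f X c] scaleR_diff_right add.commute)
  \<comment> \<open>At a chart not around \<open>p\<close> the coordinates of \<open>Y p\<close> are
    0 by convention, which kills the derivative term on the right.\<close>
  qed (simp add: lie_bracket_def tangent_spaceD(2)[OF vector_fieldD(1)[OF Y]])
qed

section \<open>Covector fields and their Lie derivative\<close>

lemma covector_fieldI:
  assumes "\<And>p c. c \<in> charts_at A p \<Longrightarrow> linear (\<lambda>u. \<beta> p (coord_vec A c p u))"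
    and "\<And>c u. c \<in> A \<Longrightarrow> smooth_on (chart_image c) (\<lambda>x. \<beta> (chart_inv c x) (coord_vec A c (chart_inv c x) u))"
  shows "covector_field A \<beta>"
  unfolding covector_field_def
proof (intro conjI ballI allI)
  fix p v assume p: "p \<in> carrier A" and v: "v \<in> tangent_space A p"
  obtain c where c: "c \<in> charts_at A p" using carrier_chart[OF p] by blast
  note lin = assms(1)[OF c]
  show "\<beta> p (tscale r v) = r * \<beta> p v" for r
    using linear_scale[OF lin, of r "v c"] coord_vec_of_tangent[OF v c]
    by (simp add: coord_vec_scale[OF c])
  show "\<beta> p (tadd v w) = \<beta> p v + \<beta> p w" if w: "w \<in> tangent_space A p" for w
    using linear_add[OF lin, of "v c" "w c"] coord_vec_of_tangent[OF v c] coord_vec_of_tangent[OF w c]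
    by (simp add: coord_vec_add[OF c])
qed (rule assms(2))

lemma covector_field_linear:
  assumes "covector_field A \<beta>" "c \<in> charts_at A p"
  shows "linear (\<lambda>u. \<beta> p (coord_vec A c p u))"
  using assms(1) carrierI[OF assms(2)] coord_vec_tangent[OF assms(2)] unfolding covector_field_def
  by (intro linearI) (simp_all add: coord_vec_add[OF assms(2)] coord_vec_scale[OF assms(2)])

lemma covector_field_smooth:
  "covector_field A \<beta> \<Longrightarrow> c \<in> A \<Longrightarrow>
    smooth_on (chart_image c) (\<lambda>x. \<beta> (chart_inv c x) (coord_vec A c (chart_inv c x) u))"
  unfolding covector_field_def by blast

lemma smooth_fun_covector_apply:
  assumes \<beta>: "covector_field A \<beta>" and X: "X \<in> vector_fields A"
  shows "smooth_fun A (\<lambda>p. \<beta> p (X p))"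
proof (rule smooth_funI)
  fix c assume c: "c \<in> A"
  have "smooth_on (chart_image c)
      (\<lambda>x. \<beta> (chart_inv c x) (coord_vec A c (chart_inv c x) (X (chart_inv c x) c)))"
    by (rule smooth_on_linear_family[OF chart_image_open[OF c] covector_field_linear[OF \<beta>]
          vector_fieldD(2)[OF X c] covector_field_smooth[OF \<beta> c]])
      (rule chart_inv_charts_at[OF c])
  then show "smooth_on (chart_image c) (\<lambda>x. \<beta> (chart_inv c x) (X (chart_inv c x)))"
    by (rule smooth_on_cong[THEN iffD1, OF chart_image_open[OF c], rotated])
      (simp add: coord_vec_of_tangent[OF vector_fieldD(1)[OF X] chart_inv_charts_at[OF c]])
qed

lemma covector_field_add:
  assumes "covector_field A \<beta>" "covector_field A \<gamma>"
  shows "covector_field A (\<lambda>p v. \<beta> p v + \<gamma> p v)"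
proof (rule covector_fieldI)
  show "linear (\<lambda>u. \<beta> p (coord_vec A c p u) + \<gamma> p (coord_vec A c p u))" if c: "c \<in> charts_at A p" for p c
    by (rule linear_compose_add[OF covector_field_linear[OF assms(1) c] covector_field_linear[OF assms(2) c]])
qed (rule smooth_on_add[OF chart_image_open covector_field_smooth[OF assms(1)]
      covector_field_smooth[OF assms(2)]])

lemma covector_field_scale:
  assumes "covector_field A \<beta>"
  shows "covector_field A (\<lambda>p v. r * \<beta> p v)"
proof (rule covector_fieldI)
  show "linear (\<lambda>u. r * \<beta> p (coord_vec A c p u))" if c: "c \<in> charts_at A p" for p c
    using linear_compose_scale_right[OF covector_field_linear[OF assms c], of r] by simp
qed (rule smooth_on_mult[OF chart_image_open smooth_on_const covector_field_smooth[OF assms]])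

lemma covector_field_differential:
  assumes f: "smooth_fun A f"
  shows "covector_field A (differential A f)"
proof (rule covector_fieldI)
  have eq: "differential A f p (coord_vec A c p u)
      = frechet_derivative (\<lambda>x. f (chart_inv c x)) (at (snd c p)) u" if c: "c \<in> charts_at A p" for p c u
    using differential_chart[OF f coord_vec_tangent[OF c] c] coord_vec_chart[OF c] by simp
  fix c p assume "c \<in> charts_at A p"
  then show "linear (\<lambda>u. differential A f p (coord_vec A c p u))"
    using has_derivative_linear[OF smooth_fun_has_derivative[OF f]] by (simp add: eq)
next
  have eq: "differential A f p (coord_vec A c p u)
      = frechet_derivative (\<lambda>x. f (chart_inv c x)) (at (snd c p)) u" if c: "c \<in> charts_at A p" for p c u
    using differential_chart[OF f coord_vec_tangent[OF c] c] coord_vec_chart[OF c] by simp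
  fix c u assume c: "c \<in> A"
  have "smooth_on (chart_image c) (\<lambda>x. frechet_derivative (\<lambda>x. f (chart_inv c x)) (at x) u)"
    by (rule smooth_on_frechet_derivative[OF smooth_fun_chart[OF f c]])
  then show "smooth_on (chart_image c)
      (\<lambda>x. differential A f (chart_inv c x) (coord_vec A c (chart_inv c x) u))"
    by (rule smooth_on_cong[THEN iffD1, OF chart_image_open[OF c], rotated])
      (simp add: eq[OF chart_inv_charts_at[OF c]] chart_inv_right)
qed

lemma covector_field_has_derivative:
  assumes \<beta>: "covector_field A \<beta>" and c: "c \<in> charts_at A p"
    and X: "(X has_derivative X') (at (snd c p))"
  shows "((\<lambda>x. \<beta> (chart_inv c x) (coord_vec A c (chart_inv c x) (X x))) has_derivative
    (\<lambda>w. frechet_derivative (\<lambda>x. \<beta> (chart_inv c x) (coord_vec A c (chart_inv c x) (X (snd c p)))) (at (snd c p)) w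
      + \<beta> p (coord_vec A c p (X' w)))) (at (snd c p))"
proof -
  note A = charts_atD(1)[OF c]
  have x: "snd c p \<in> chart_image c" by (rule chart_point[OF charts_atD(2)[OF c]])
  show ?thesis
    using has_derivative_linear_family[OF chart_image_open[OF A] x,
        of "\<lambda>x u. \<beta> (chart_inv c x) (coord_vec A c (chart_inv c x) u)", OF _ _ X]
      covector_field_linear[OF \<beta> chart_inv_charts_at[OF A]]
      smooth_on_differentiable[OF covector_field_smooth[OF \<beta> A] x]
      chart_inv_left[OF charts_atD[OF c]]
    by simp
qed

lemma chart_lie_covector_change:
  assumes \<beta>: "covector_field A \<beta>" and X: "X \<in> vector_fields A" and v: "v \<in> tangent_space A p"
    and c: "c \<in> charts_at A p" and c': "c' \<in> charts_at A p"
  shows "chart_lie_covector A c X \<beta> p v = chart_lie_covector A c' X \<beta> p v"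
proof -
  note A = charts_atD(1)[OF c] charts_atD(1)[OF c']
  let ?\<phi> = "snd c' \<circ> chart_inv c" and ?\<beta> = "\<lambda>c u x. \<beta> (chart_inv c x) (coord_vec A c (chart_inv c x) u)"
  \<comment> \<open>The coordinates in \<open>c'\<close> of the vector whose coordinates in
    \<open>c\<close> are constantly \<open>v c\<close>.\<close>
  let ?D = "\<lambda>x. frechet_derivative ?\<phi> (at x) (v c)"
  have left: "chart_inv c (snd c p) = p" by (rule chart_inv_left[OF charts_atD[OF c]])
  have v': "v c' = coord_change c c' p (v c)" and X': "X p c' = coord_change c c' p (X p c)"
    using tangent_spaceD(1)[OF _ c c'] v vector_fieldD(1)[OF X] by auto
  have D: "(?D has_derivative second_transition c c' p (v c)) (at (snd c p))"
    by (rule smooth_on_has_derivative[OF smooth_on_frechet_derivative[OF smooth_transition[OF A]]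
          overlapI[OF c c']])
  have D': "?D (snd c p) = v c'" using v' by (simp add: coord_change_def)
  have lin: "linear (\<lambda>u. \<beta> (chart_inv c x) (coord_vec A c' (chart_inv c x) u))" if "x \<in> overlap c c'" for x
    by (rule covector_field_linear[OF \<beta> overlapD(2)[OF A that]])
  have chain: "((\<lambda>x. \<beta> (chart_inv c x) (coord_vec A c' (chart_inv c x) u)) has_derivative
      (\<lambda>w. frechet_derivative (?\<beta> c' u) (at (snd c' p)) (coord_change c c' p w))) (at (snd c p))" for u
  proof -
    have "((\<lambda>x. ?\<beta> c' u (?\<phi> x)) has_derivative
        (\<lambda>w. frechet_derivative (?\<beta> c' u) (at (snd c' p)) (coord_change c c' p w))) (at (snd c p))"
      using has_derivative_compose[OF has_derivative_transition[OF c c'], of "?\<beta> c' u"]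
        smooth_on_has_derivative[OF covector_field_smooth[OF \<beta> A(2)] chart_point[OF charts_atD(2)[OF c']]] left
      by simp
    then show ?thesis
      by (rule has_derivative_transform_within_open[OF _ open_overlap[OF A] overlapI[OF c c']])
        (simp add: overlapD(4)[OF A])
  qed
  have "((\<lambda>x. \<beta> (chart_inv c x) (coord_vec A c' (chart_inv c x) (?D x))) has_derivative
     (\<lambda>w. frechet_derivative (?\<beta> c' (v c')) (at (snd c' p)) (coord_change c c' p w)
       + \<beta> p (coord_vec A c' p (second_transition c c' p (v c) w)))) (at (snd c p))"
    using has_derivative_linear_family[OF open_overlap[OF A] overlapI[OF c c'],
        of "\<lambda>x u. \<beta> (chart_inv c x) (coord_vec A c' (chart_inv c x) u)", OF lin _ D]
      chain[THEN differentiableI] frechet_derivative_at[OF chain, symmetric]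
    unfolding D' left by simp
  then have "((?\<beta> c (v c)) has_derivative
     (\<lambda>w. frechet_derivative (?\<beta> c' (v c')) (at (snd c' p)) (coord_change c c' p w)
       + \<beta> p (coord_vec A c' p (second_transition c c' p (v c) w)))) (at (snd c p))"
  proof (rule has_derivative_transform_within_open[OF _ open_overlap[OF A] overlapI[OF c c']])
    fix x assume x: "x \<in> overlap c c'"
    show "\<beta> (chart_inv c x) (coord_vec A c' (chart_inv c x) (?D x)) = ?\<beta> c (v c) x"
      using coord_vec_change[OF overlapD(1,2)[OF A x], of "v c"] overlapD(3)[OF A x]
      by (simp add: coord_change_def)
  qed
  from frechet_derivative_at[OF this, THEN fun_cong, of "X p c"]
  have 1: "frechet_derivative (?\<beta> c (v c)) (at (snd c p)) (X p c) =
      frechet_derivative (?\<beta> c' (v c')) (at (snd c' p)) (X p c')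
      + \<beta> p (coord_vec A c' p (second_transition c c' p (X p c) (v c)))"
    using X' second_transition_symmetric[OF c c'] by simp
  have 2: "\<beta> p (coord_vec A c' p (frechet_derivative (\<lambda>x. X (chart_inv c' x) c') (at (snd c' p)) (v c'))) =
     \<beta> p (coord_vec A c' p (second_transition c c' p (X p c) (v c))) +
     \<beta> p (coord_vec A c p (frechet_derivative (\<lambda>x. X (chart_inv c x) c) (at (snd c p)) (v c)))"
    unfolding v' vector_field_derivative_change[OF X c c']
      linear_add[OF covector_field_linear[OF \<beta> c']] coord_vec_change[OF c c'] ..
  show ?thesis unfolding chart_lie_covector_def 1 2 by simp
qed

lemma lie_covector_chart:
  assumes "covector_field A \<beta>" "X \<in> vector_fields A" "v \<in> tangent_space A p" "c \<in> charts_at A p"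
  shows "lie_covector A X \<beta> p v = chart_lie_covector A c X \<beta> p v"
  unfolding lie_covector_def
  using chart_lie_covector_change[OF assms(1,2,3) some_chart[OF carrierI] assms(4)] assms(4) by blast

lemma covector_field_lie:
  assumes \<beta>: "covector_field A \<beta>" and X: "X \<in> vector_fields A"
  shows "covector_field A (lie_covector A X \<beta>)"
proof (rule covector_fieldI)
  let ?\<beta> = "\<lambda>c u x. \<beta> (chart_inv c x) (coord_vec A c (chart_inv c x) u)"
  fix c p assume c: "c \<in> charts_at A p"
  note A = charts_atD(1)[OF c]
  have x: "snd c p \<in> chart_image c" by (rule chart_point[OF charts_atD(2)[OF c]])
  let ?X' = "frechet_derivative (\<lambda>x. X (chart_inv c x) c) (at (snd c p))"
  have X': "linear ?X'" by (rule has_derivative_linear[OF vector_field_has_derivative[OF X c]])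
  have d: "(?\<beta> c u has_derivative frechet_derivative (?\<beta> c u) (at (snd c p))) (at (snd c p))" for u
    by (rule smooth_on_has_derivative[OF covector_field_smooth[OF \<beta> A] x])
  have sum: "?\<beta> c (u + v) y = ?\<beta> c u y + ?\<beta> c v y" "?\<beta> c (r *\<^sub>R u) y = r *\<^sub>R ?\<beta> c u y"
    if "y \<in> chart_image c" for u v y r
    using linear_add[OF covector_field_linear[OF \<beta> chart_inv_charts_at[OF A that]]]
      linear_scale[OF covector_field_linear[OF \<beta> chart_inv_charts_at[OF A that]]] by blast+
  \<comment> \<open>Linearity in \<open>u\<close> holds at every point of the chart image, an open
    set, and is therefore inherited by the derivative.\<close>
  have d_add: "frechet_derivative (?\<beta> c (u + v)) (at (snd c p)) w =
      frechet_derivative (?\<beta> c u) (at (snd c p)) w + frechet_derivative (?\<beta> c v) (at (snd c p)) w" for u v w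
    by (rule frechet_derivative_at[THEN fun_cong, symmetric,
          OF has_derivative_transform_within_open[OF has_derivative_add[OF d d] chart_image_open[OF A] x]])
      (rule sum(1)[symmetric])
  have d_scale: "frechet_derivative (?\<beta> c (r *\<^sub>R u)) (at (snd c p)) w =
      r *\<^sub>R frechet_derivative (?\<beta> c u) (at (snd c p)) w" for u r w
    by (rule frechet_derivative_at[THEN fun_cong, symmetric,
          OF has_derivative_transform_within_open[OF has_derivative_scaleR_right[OF d] chart_image_open[OF A] x]])
      (rule sum(2)[symmetric])
  have "linear (\<lambda>u. chart_lie_covector A c X \<beta> p (coord_vec A c p u))"
    unfolding chart_lie_covector_def coord_vec_chart[OF c]
    by (rule linearI)
      (simp_all add: d_add d_scale[simplified] linear_add[OF X'] linear_scale[OF X'] algebra_simps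
        linear_add[OF covector_field_linear[OF \<beta> c]] linear_scale[OF covector_field_linear[OF \<beta> c]])
  then show "linear (\<lambda>u. lie_covector A X \<beta> p (coord_vec A c p u))"
    by (simp only: lie_covector_chart[OF \<beta> X coord_vec_tangent[OF c] c])
next
  fix c u assume c: "c \<in> A"
  let ?\<beta> = "\<lambda>u x. \<beta> (chart_inv c x) (coord_vec A c (chart_inv c x) u)"
  have "smooth_on (chart_image c) (\<lambda>x. frechet_derivative (?\<beta> u) (at x) (X (chart_inv c x) c)
    + ?\<beta> (frechet_derivative (\<lambda>x. X (chart_inv c x) c) (at x) u) x)"
  proof (rule smooth_on_add[OF chart_image_open[OF c]])
    show "smooth_on (chart_image c) (\<lambda>x. frechet_derivative (?\<beta> u) (at x) (X (chart_inv c x) c))"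
      by (rule smooth_on_derivative_along[OF chart_image_open[OF c] covector_field_smooth[OF \<beta> c]
            vector_fieldD(2)[OF X c]])
    show "smooth_on (chart_image c) (\<lambda>x. ?\<beta> (frechet_derivative (\<lambda>x. X (chart_inv c x) c) (at x) u) x)"
      by (rule smooth_on_linear_family[OF chart_image_open[OF c] covector_field_linear[OF \<beta>]
            smooth_on_frechet_derivative[OF vector_fieldD(2)[OF X c]] covector_field_smooth[OF \<beta> c]])
        (rule chart_inv_charts_at[OF c])
  qed
  then show "smooth_on (chart_image c)
      (\<lambda>x. lie_covector A X \<beta> (chart_inv c x) (coord_vec A c (chart_inv c x) u))"
  proof (rule smooth_on_cong[THEN iffD1, OF chart_image_open[OF c], rotated])
    fix x assume x: "x \<in> chart_image c"
    note c' = chart_inv_charts_at[OF c x]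
    show "frechet_derivative (?\<beta> u) (at x) (X (chart_inv c x) c)
      + ?\<beta> (frechet_derivative (\<lambda>x. X (chart_inv c x) c) (at x) u) x
      = lie_covector A X \<beta> (chart_inv c x) (coord_vec A c (chart_inv c x) u)"
      unfolding lie_covector_chart[OF \<beta> X coord_vec_tangent[OF c'] c'] chart_lie_covector_def
        coord_vec_chart[OF c'] chart_inv_right[OF x] ..
  qed
qed

text \<open>Both terms on the right contain the derivative of \<open>Z\<close> along
  \<open>X\<close>, and it cancels. This is why their difference depends on \<open>Z\<close> only
  through its value at \<open>p\<close>.\<close>

lemma lie_covector_apply:
  assumes \<beta>: "covector_field A \<beta>" and X: "X \<in> vector_fields A" and Z: "Z \<in> vector_fields A"
    and p: "p \<in> carrier A"
  shows "lie_covector A X \<beta> p (Z p) = dir_deriv A X (\<lambda>q. \<beta> q (Z q)) p - \<beta> p (lie_bracket A X Z p)"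
proof -
  obtain c where c: "c \<in> charts_at A p" using carrier_chart[OF p] by blast
  note A = charts_atD(1)[OF c]
  have x: "snd c p \<in> chart_image c" by (rule chart_point[OF charts_atD(2)[OF c]])
  have left: "chart_inv c (snd c p) = p" by (rule chart_inv_left[OF charts_atD[OF c]])
  let ?\<beta> = "\<lambda>u x. \<beta> (chart_inv c x) (coord_vec A c (chart_inv c x) u)"
  let ?X' = "frechet_derivative (\<lambda>x. X (chart_inv c x) c) (at (snd c p))"
  let ?Z' = "frechet_derivative (\<lambda>x. Z (chart_inv c x) c) (at (snd c p))"
  have "frechet_derivative (\<lambda>x. \<beta> (chart_inv c x) (Z (chart_inv c x))) (at (snd c p))
    = frechet_derivative (\<lambda>x. ?\<beta> (Z (chart_inv c x) c) x) (at (snd c p))"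
    by (rule frechet_derivative_cong_open[OF chart_image_open[OF A] x])
      (simp add: coord_vec_of_tangent[OF vector_fieldD(1)[OF Z] chart_inv_charts_at[OF A]])
  then have 1: "dir_deriv A X (\<lambda>q. \<beta> q (Z q)) p
      = frechet_derivative (?\<beta> (Z p c)) (at (snd c p)) (X p c) + \<beta> p (coord_vec A c p (?Z' (X p c)))"
    using dir_deriv_chart[OF smooth_fun_covector_apply[OF \<beta> Z] X c]
      frechet_derivative_at[OF covector_field_has_derivative[OF \<beta> c vector_field_has_derivative[OF Z c]],
        THEN fun_cong, of "X p c"] left by simp
  have "lie_bracket A X Z p = coord_vec A c p (?Z' (X p c) - ?X' (Z p c))"
    using coord_vec_of_tangent[OF vector_fieldD(1)[OF vector_field_lie_bracket[OF X Z]] c] c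
    by (simp add: lie_bracket_def)
  then have 2: "\<beta> p (lie_bracket A X Z p)
      = \<beta> p (coord_vec A c p (?Z' (X p c))) - \<beta> p (coord_vec A c p (?X' (Z p c)))"
    using linear_diff[OF covector_field_linear[OF \<beta> c]] by simp
  show ?thesis
    unfolding 1 2 lie_covector_chart[OF \<beta> X vector_fieldD(1)[OF Z] c] chart_lie_covector_def by simp
qed

end

section \<open>Metric duality and the Koszul formula\<close>

definition koszul ::
  "('a, 'b::euclidean_space) chart set \<Rightarrow> ('a \<Rightarrow> ('a, 'b) tvec \<Rightarrow> ('a, 'b) tvec \<Rightarrow> real) \<Rightarrow>
   ('a, 'b) vfield \<Rightarrow> ('a, 'b) vfield \<Rightarrow> ('a, 'b) vfield \<Rightarrow> 'a \<Rightarrow> real" where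
  "koszul A g X Y Z p =
     dir_deriv A X (g_field g Y Z) p + dir_deriv A Y (g_field g X Z) p - dir_deriv A Z (g_field g X Y) p
     + g_field g (lie_bracket A X Y) Z p - g_field g (lie_bracket A X Z) Y p
     - g_field g (lie_bracket A Y Z) X p"

context riemannian_manifold
begin

section \<open>The metric in coordinates and the dual field of a covector field\<close>

lemma g_add_right: "p \<in> carrier A \<Longrightarrow> u \<in> tangent_space A p \<Longrightarrow> v \<in> tangent_space A p \<Longrightarrow>
    w \<in> tangent_space A p \<Longrightarrow> g p u (tadd v w) = g p u v + g p u w"
  using g_add[of p v w u] g_sym[of p _ u] tangent_space_closed by metis

lemma g_scale_right: "p \<in> carrier A \<Longrightarrow> u \<in> tangent_space A p \<Longrightarrow> v \<in> tangent_space A p \<Longrightarrow>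
    g p u (tscale r v) = r * g p u v"
  using g_scale[of p v u r] g_sym[of p _ u] tscale_tangent by metis

lemma linear_g_coord:
  assumes "c \<in> charts_at A p" "w \<in> tangent_space A p"
  shows "linear (\<lambda>u. g p (coord_vec A c p u) w)" "linear (\<lambda>u. g p w (coord_vec A c p u))"
  using assms carrierI[OF assms(1)] coord_vec_tangent[OF assms(1)]
  by (auto intro!: linearI simp: coord_vec_add coord_vec_scale g_add g_scale g_add_right g_scale_right)

lemma smooth_on_g_coord:
  assumes "c \<in> A"
  shows "smooth_on (chart_image c) (\<lambda>x. g (chart_inv c x) (coord_vec A c (chart_inv c x) u)
    (coord_vec A c (chart_inv c x) v))"
proof -
  note c = chart_inv_charts_at[OF assms]
  have "smooth_on (chart_image c) (\<lambda>x. g (chart_inv c x) (coord_vec A c (chart_inv c x) i)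
    (coord_vec A c (chart_inv c x) v))" if "i \<in> Basis" for i
    by (rule smooth_on_linear_family[OF chart_image_open[OF assms] linear_g_coord(2)[OF c]
          smooth_on_const g_smooth[OF assms that]]) (simp_all add: coord_vec_tangent[OF c])
  then show ?thesis
    by (rule smooth_on_linear_family[OF chart_image_open[OF assms] linear_g_coord(1)[OF c]
          smooth_on_const, rotated 2]) (simp_all add: coord_vec_tangent[OF c])
qed

lemma covector_field_flat:
  assumes X: "X \<in> vector_fields A"
  shows "covector_field A (\<lambda>p v. g p (X p) v)"
proof (rule covector_fieldI)
  show "linear (\<lambda>u. g p (X p) (coord_vec A c p u))" if "c \<in> charts_at A p" for p c
    by (rule linear_g_coord(2)[OF that vector_fieldD(1)[OF X]])
  fix c u assume c: "c \<in> A"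
  note c' = chart_inv_charts_at[OF c]
  have "smooth_on (chart_image c) (\<lambda>x. g (chart_inv c x)
      (coord_vec A c (chart_inv c x) (X (chart_inv c x) c)) (coord_vec A c (chart_inv c x) u))"
    by (rule smooth_on_linear_family[OF chart_image_open[OF c] linear_g_coord(1)[OF c']
          vector_fieldD(2)[OF X c] smooth_on_g_coord[OF c]]) (simp_all add: coord_vec_tangent[OF c'])
  then show "smooth_on (chart_image c)
      (\<lambda>x. g (chart_inv c x) (X (chart_inv c x)) (coord_vec A c (chart_inv c x) u))"
    by (rule smooth_on_cong[THEN iffD1, OF chart_image_open[OF c], rotated])
      (simp add: coord_vec_of_tangent[OF vector_fieldD(1)[OF X] c'])
qed

lemma smooth_fun_g_field:
  "X \<in> vector_fields A \<Longrightarrow> Y \<in> vector_fields A \<Longrightarrow> smooth_fun A (g_field g X Y)"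
  unfolding g_field_def by (rule smooth_fun_covector_apply[OF covector_field_flat])

text \<open>The Gram matrix in the form of a linear map, so that the results on families of linear
  equations apply to it.\<close>

definition gram :: "('a, 'b) chart \<Rightarrow> 'a \<Rightarrow> 'b \<Rightarrow> 'b" where
  "gram c p u = (\<Sum>j\<in>Basis. g p (coord_vec A c p u) (coord_vec A c p j) *\<^sub>R j)"

lemma gram_inner:
  assumes c: "c \<in> charts_at A p"
  shows "gram c p u \<bullet> v = g p (coord_vec A c p u) (coord_vec A c p v)"
proof -
  have "gram c p u \<bullet> v = (\<Sum>j\<in>Basis. (v \<bullet> j) *\<^sub>R g p (coord_vec A c p u) (coord_vec A c p j))"
    unfolding gram_def inner_sum_left by (rule sum.cong) (simp_all add: inner_commute)
  also have "\<dots> = g p (coord_vec A c p u) (coord_vec A c p v)"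
    by (rule linear_euclidean_expansion[OF linear_g_coord(2)[OF c coord_vec_tangent[OF c]], symmetric])
  finally show ?thesis .
qed

lemma linear_gram:
  assumes c: "c \<in> charts_at A p"
  shows "linear (gram c p)"
  by (rule linearI; rule euclidean_eqI)
    (simp_all add: inner_add_left gram_inner[OF c]
      linear_add[OF linear_g_coord(1)[OF c coord_vec_tangent[OF c]]]
      linear_scale[OF linear_g_coord(1)[OF c coord_vec_tangent[OF c]]])

lemma inj_gram:
  assumes c: "c \<in> charts_at A p"
  shows "inj (gram c p)"
  unfolding linear_injective_0[OF linear_gram[OF c]]
proof (intro allI impI)
  fix u assume "gram c p u = 0"
  then have "g p (coord_vec A c p u) (coord_vec A c p u) = 0"
    using gram_inner[OF c, of u u] by simp
  then have "coord_vec A c p u = tzero"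
    using g_pos[OF carrierI[OF c] coord_vec_tangent[OF c], of u] by force
  then show "u = 0" using coord_vec_chart[OF c, of u] by simp
qed

text \<open>In a chart the coordinates of the dual vector solve \<open>gram c p u = a c p\<close>,
  where \<open>a\<close> collects the components of \<open>\<beta>\<close>. Positivity of
  \<open>g\<close> makes \<open>gram\<close> injective and hence, in finite dimension, surjective;
  \<open>smooth_on_solution\<close> supplies smoothness.\<close>

lemma ex_sharp:
  assumes \<beta>: "covector_field A \<beta>"
  shows "\<exists>X\<in>vector_fields A. \<forall>p\<in>carrier A. \<forall>v\<in>tangent_space A p. g p (X p) v = \<beta> p v"
proof -
  define a where "a c p = (\<Sum>j\<in>Basis. \<beta> p (coord_vec A c p j) *\<^sub>R j)" for c p
  have a_inner: "a c p \<bullet> v = \<beta> p (coord_vec A c p v)" if c: "c \<in> charts_at A p" for c p v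
  proof -
    have "a c p \<bullet> v = (\<Sum>j\<in>Basis. (v \<bullet> j) *\<^sub>R \<beta> p (coord_vec A c p j))"
      unfolding a_def inner_sum_left by (rule sum.cong) (simp_all add: inner_commute)
    also have "\<dots> = \<beta> p (coord_vec A c p v)"
      by (rule linear_euclidean_expansion[OF covector_field_linear[OF \<beta> c], symmetric])
    finally show ?thesis .
  qed
  \<comment> \<open>The condition mentions no chart, so one choice of \<open>v\<close> at each point
    can be examined in every chart around it.\<close>
  define R where "R p v \<longleftrightarrow> v \<in> tangent_space A p \<and> (\<forall>w\<in>tangent_space A p. g p v w = \<beta> p w)" for p v
  have ex: "\<exists>v. R p v" if p: "p \<in> carrier A" for p
  proof -
    obtain c where c: "c \<in> charts_at A p" using carrier_chart[OF p] by blast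
    obtain u where u: "gram c p u = a c p"
      using linear_injective_imp_surjective[OF linear_gram[OF c] inj_gram[OF c]] by (metis surjD)
    have "g p (coord_vec A c p u) w = \<beta> p w" if w: "w \<in> tangent_space A p" for w
      using gram_inner[OF c, of u "w c"] a_inner[OF c, of "w c"] u coord_vec_of_tangent[OF w c] by simp
    then show ?thesis unfolding R_def using coord_vec_tangent[OF c] by blast
  qed
  \<comment> \<open>Off the manifold the value has to be \<open>tzero\<close>, the only element of
    the tangent space there.\<close>
  define X where "X p = (if p \<in> carrier A then SOME v. R p v else tzero)" for p
  have X: "R p (X p)" if "p \<in> carrier A" for p
    unfolding X_def using that someI_ex[OF ex[OF that]] by simp
  have tangent: "X p \<in> tangent_space A p" for p
    using X unfolding R_def X_def by (cases "p \<in> carrier A") auto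
  have solves: "gram c p (X p c) = a c p" if c: "c \<in> charts_at A p" for c p
  proof (rule euclidean_eqI)
    fix j :: 'b
    show "gram c p (X p c) \<bullet> j = a c p \<bullet> j"
      using X[OF carrierI[OF c]] coord_vec_tangent[OF c, of j] unfolding R_def
      by (simp add: gram_inner[OF c] a_inner[OF c] coord_vec_of_tangent[OF tangent c])
  qed
  have smooth: "smooth_on (chart_image c) (\<lambda>x. X (chart_inv c x) c)" if c: "c \<in> A" for c
  proof (rule smooth_on_solution[OF chart_image_open[OF c], of "\<lambda>x. gram c (chart_inv c x)"])
    note c' = chart_inv_charts_at[OF c]
    show "linear (gram c (chart_inv c x))" "inj (gram c (chart_inv c x))"
      "gram c (chart_inv c x) (X (chart_inv c x) c) = a c (chart_inv c x)" if "x \<in> chart_image c" for x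
      using linear_gram inj_gram solves c'[OF that] by blast+
    show "smooth_on (chart_image c) (\<lambda>x. gram c (chart_inv c x) i)" for i
      unfolding gram_def
      by (intro smooth_on_sum smooth_on_scaleR smooth_on_const smooth_on_g_coord chart_image_open c)
    show "smooth_on (chart_image c) (\<lambda>x. a c (chart_inv c x))"
      unfolding a_def
      by (intro smooth_on_sum smooth_on_scaleR smooth_on_const covector_field_smooth[OF \<beta>]
          chart_image_open c)
  qed
  have "X \<in> vector_fields A" by (rule vector_fieldI[OF tangent smooth])
  with X show ?thesis unfolding R_def by blast
qed

section \<open>Rules for metric products of fields\<close>

lemma g_field_vadd:
  assumes "X \<in> vector_fields A" "Y \<in> vector_fields A" "Z \<in> vector_fields A" "p \<in> carrier A"
  shows "g_field g (vadd X Y) Z p = g_field g X Z p + g_field g Y Z p"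
    and "g_field g Z (vadd X Y) p = g_field g Z X p + g_field g Z Y p"
  using assms by (simp_all add: g_field_def g_add g_add_right vector_fieldD(1))

lemma g_field_vscale:
  assumes "X \<in> vector_fields A" "Z \<in> vector_fields A" "p \<in> carrier A"
  shows "g_field g (vscale f X) Z p = f p * g_field g X Z p"
    and "g_field g Z (vscale f X) p = f p * g_field g Z X p"
  using assms by (simp_all add: g_field_def g_scale g_scale_right vector_fieldD(1))

lemma vdiff_conv_vadd: "vdiff X Y = vadd X (vscale (\<lambda>_. -1) Y)"
  by (intro ext) simp

lemma g_field_vdiff:
  assumes "X \<in> vector_fields A" "Y \<in> vector_fields A" "Z \<in> vector_fields A" "p \<in> carrier A"
  shows "g_field g (vdiff X Y) Z p = g_field g X Z p - g_field g Y Z p"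
  unfolding vdiff_conv_vadd using assms by (simp add: g_field_vadd g_field_vscale vector_field_vscale)

lemma g_field_sym:
  assumes "X \<in> vector_fields A" "Y \<in> vector_fields A" "p \<in> carrier A"
  shows "g_field g X Y p = g_field g Y X p"
  unfolding g_field_def by (rule g_sym) (use assms vector_fieldD(1) in blast)+

lemma g_field_lie_bracket_skew:
  assumes "X \<in> vector_fields A" "Y \<in> vector_fields A" "Z \<in> vector_fields A" "p \<in> carrier A"
  shows "g_field g (lie_bracket A Y X) Z p = - g_field g (lie_bracket A X Y) Z p"
  using g_field_vscale(1)[OF vector_field_lie_bracket[OF assms(1,2)] assms(3,4), of "\<lambda>_. -1"]
  unfolding lie_bracket_skew[of Y X] by simp

lemma tdiff_eq_tzeroI: "v = w \<Longrightarrow> tdiff v w = tzero"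
  by (intro ext) simp

text \<open>The difference of \<open>X\<close> and \<open>Y\<close> is itself a smooth field and may
  be taken as \<open>Z\<close>; positivity at each point then makes it vanish.\<close>

lemma vector_field_g_eqI:
  assumes X: "X \<in> vector_fields A" and Y: "Y \<in> vector_fields A"
    and eq: "\<And>Z p. Z \<in> vector_fields A \<Longrightarrow> p \<in> carrier A \<Longrightarrow> g_field g X Z p = g_field g Y Z p"
  shows "X = Y"
proof (rule vector_field_eqI[OF X Y])
  fix p assume p: "p \<in> carrier A"
  note W = vector_field_vdiff[OF X Y]
  have "g p (vdiff X Y p) (vdiff X Y p) = 0"
    using g_field_vdiff[OF X Y W p] eq[OF W p] by (simp add: g_field_def)
  then have "vdiff X Y p = tzero" using g_pos[OF p vector_fieldD(1)[OF W]] by force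
  then have "X p c - Y p c = 0" for c by (metis field_apply(2) tvec_apply(2,4))
  then show "X p = Y p" by (intro ext) simp
qed

lemma dir_deriv_g_sym:
  assumes "Y \<in> vector_fields A" "Z \<in> vector_fields A" "p \<in> carrier A"
  shows "dir_deriv A X (g_field g Y Z) p = dir_deriv A X (g_field g Z Y) p"
  by (rule dir_deriv_cong[OF assms(3) g_field_sym[OF assms(1,2)]])

lemma dir_deriv_g_vadd:
  assumes "X \<in> vector_fields A" "Y \<in> vector_fields A" "Y' \<in> vector_fields A"
    "Z \<in> vector_fields A" "p \<in> carrier A"
  shows "dir_deriv A X (g_field g (vadd Y Y') Z) p
      = dir_deriv A X (g_field g Y Z) p + dir_deriv A X (g_field g Y' Z) p"
  using dir_deriv_add_fun[OF smooth_fun_g_field smooth_fun_g_field, of Y Z Y' Z] assms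
    dir_deriv_cong[OF assms(5) g_field_vadd(1)[OF assms(2-4)]] by simp

lemma dir_deriv_g_vscale:
  assumes "smooth_fun A f" "X \<in> vector_fields A" "Y \<in> vector_fields A"
    "Z \<in> vector_fields A" "p \<in> carrier A"
  shows "dir_deriv A X (g_field g (vscale f Y) Z) p
      = f p * dir_deriv A X (g_field g Y Z) p + dir_deriv A X f p * g_field g Y Z p"
  using dir_deriv_mult_fun[OF assms(1) smooth_fun_g_field[OF assms(3,4)] assms(2,5)]
    dir_deriv_cong[OF assms(5) g_field_vscale(1)[OF assms(3,4)]] by simp

lemma lie_bracket_vadd_left:
  assumes "X \<in> vector_fields A" "Y \<in> vector_fields A" "Z \<in> vector_fields A"
  shows "lie_bracket A (vadd X Y) Z = vadd (lie_bracket A X Z) (lie_bracket A Y Z)"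
  unfolding lie_bracket_skew[of _ Z] lie_bracket_vadd[OF assms(3,1,2)]
  by (intro ext) simp

lemma lie_bracket_vscale_left:
  assumes "smooth_fun A f" "X \<in> vector_fields A" "Y \<in> vector_fields A"
  shows "lie_bracket A (vscale f X) Y
    = vadd (vscale (\<lambda>p. - dir_deriv A Y f p) X) (vscale f (lie_bracket A X Y))"
  unfolding lie_bracket_skew[of _ Y] lie_bracket_vscale[OF assms(1,3,2)]
  by (intro ext) simp

lemmas vector_field_intros = vector_field_vadd vector_field_vdiff vector_field_vscale
  vector_field_lie_bracket smooth_fun_dir_deriv smooth_fun_minus smooth_fun_const

lemma koszul_vadd1:
  assumes "X \<in> vector_fields A" "X' \<in> vector_fields A" "Y \<in> vector_fields A" "Z \<in> vector_fields A" "p \<in> carrier A"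
  shows "koszul A g (vadd X X') Y Z p = koszul A g X Y Z p + koszul A g X' Y Z p"
  unfolding koszul_def using assms
  by (simp add: dir_deriv_vadd smooth_fun_g_field dir_deriv_g_vadd lie_bracket_vadd_left g_field_vadd
      vector_field_intros)

lemma koszul_vadd2:
  assumes "X \<in> vector_fields A" "Y \<in> vector_fields A" "Y' \<in> vector_fields A" "Z \<in> vector_fields A" "p \<in> carrier A"
  shows "koszul A g X (vadd Y Y') Z p = koszul A g X Y Z p + koszul A g X Y' Z p"
  unfolding koszul_def using assms
  by (simp add: dir_deriv_vadd smooth_fun_g_field dir_deriv_g_sym[of X _ p Z] dir_deriv_g_vadd 
      lie_bracket_vadd_left lie_bracket_vadd g_field_vadd vector_field_intros)

text \<open>The terms with derivatives of \<open>f\<close> along \<open>Y\<close> and along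
  \<open>Z\<close> each occur twice with opposite signs: once from a product of functions, once from
  a bracket.\<close>

lemma koszul_vscale1:
  assumes "smooth_fun A f" "X \<in> vector_fields A" "Y \<in> vector_fields A" "Z \<in> vector_fields A" "p \<in> carrier A"
  shows "koszul A g (vscale f X) Y Z p = f p * koszul A g X Y Z p"
  unfolding koszul_def using assms
  by (simp add: dir_deriv_vscale smooth_fun_g_field dir_deriv_g_vscale lie_bracket_vscale_left
      g_field_vadd g_field_vscale vector_field_intros algebra_simps)

text \<open>The derivative along \<open>X\<close> comes once from a product and once from a bracket,
  with equal signs. The resulting factor 2 becomes the Leibniz rule when the Koszul equation is
  divided by 2.\<close>

lemma koszul_vscale2:
  assumes "smooth_fun A f" "X \<in> vector_fields A" "Y \<in> vector_fields A" "Z \<in> vector_fields A" "p \<in> carrier A"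
  shows "koszul A g X (vscale f Y) Z p = f p * koszul A g X Y Z p + 2 * dir_deriv A X f p * g_field g Y Z p"
  unfolding koszul_def using assms g_field_sym[of X Y p]
  by (simp add: dir_deriv_vscale smooth_fun_g_field dir_deriv_g_sym[of X _ p Z] dir_deriv_g_vscale
      lie_bracket_vscale_left lie_bracket_vscale g_field_vadd g_field_vscale vector_field_intros algebra_simps)

text \<open>The terms are regrouped as the covector field
  \<open>L_X (g Y) + L_Y (g X) - d (g X Y) + g [X, Y]\<close>. Each Lie derivative joins a
  derivative of a product containing \<open>Z\<close> with the bracket that compensates the
  derivatives of \<open>Z\<close>.\<close>

lemma covector_koszul:
  assumes X: "X \<in> vector_fields A" and Y: "Y \<in> vector_fields A"
  shows "\<exists>\<beta>. covector_field A \<beta> \<and> (\<forall>Z\<in>vector_fields A. \<forall>p\<in>carrier A. \<beta> p (Z p) = koszul A g X Y Z p)"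
proof -
  define \<beta> where "\<beta> p v = lie_covector A X (\<lambda>p. g p (Y p)) p v + (lie_covector A Y (\<lambda>p. g p (X p)) p v
      + (-1 * differential A (g_field g X Y) p v + g p (lie_bracket A X Y p) v))" for p v
  have "covector_field A \<beta>"
    unfolding \<beta>_def[abs_def]
    by (intro covector_field_add covector_field_scale covector_field_lie covector_field_flat
        covector_field_differential smooth_fun_g_field vector_field_lie_bracket X Y)
  moreover have "\<beta> p (Z p) = koszul A g X Y Z p" if Z: "Z \<in> vector_fields A" and p: "p \<in> carrier A" for Z p
  proof -
    have "g p (Y p) (lie_bracket A X Z p) = g_field g (lie_bracket A X Z) Y p"
      "g p (X p) (lie_bracket A Y Z p) = g_field g (lie_bracket A Y Z) X p"
      using g_field_sym[OF vector_field_lie_bracket Y p] g_field_sym[OF vector_field_lie_bracket X p] X Y Z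
      by (simp_all add: g_field_def)
    then show ?thesis
      unfolding \<beta>_def koszul_def lie_covector_apply[OF covector_field_flat[OF Y] X Z p]
        lie_covector_apply[OF covector_field_flat[OF X] Y Z p]
      by (simp add: dir_deriv_differential[of A Z] g_field_def[abs_def])
  qed
  ultimately show ?thesis by blast
qed

text \<open>With the first two arguments fixed, a metric dual field packs smoothness and linearity
  in the third argument into one condition.\<close>

definition represents_form ::
  "(('a, 'b) vfield \<Rightarrow> ('a, 'b) vfield \<Rightarrow> ('a, 'b) vfield \<Rightarrow> 'a \<Rightarrow> real) \<Rightarrow>
   ('a, 'b) vfield \<Rightarrow> ('a, 'b) vfield \<Rightarrow> ('a, 'b) vfield \<Rightarrow> bool" where
  "represents_form \<omega> X Y W \<longleftrightarrow> W \<in> vector_fields A \<and>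
     (\<forall>Z\<in>vector_fields A. \<forall>p\<in>carrier A. \<omega> X Y Z p = g_field g W Z p)"

text \<open>Half of the right-hand side is a covector field in \<open>Z\<close>, and
  \<open>D X Y\<close> is its metric dual. The choice is made separately for every pair of fields;
  linearity of \<open>D\<close> follows later because the equation determines its values.\<close>

lemma ex_koszul_connection:
  assumes \<omega>: "\<And>X Y. X \<in> vector_fields A \<Longrightarrow> Y \<in> vector_fields A \<Longrightarrow> \<exists>W. represents_form \<omega> X Y W"
  shows "\<exists>D. \<forall>X\<in>vector_fields A. \<forall>Y\<in>vector_fields A. D X Y \<in> vector_fields A \<and>
    (\<forall>Z\<in>vector_fields A. \<forall>p\<in>carrier A.
       2 * g_field g (D X Y) Z p = koszul A g X Y Z p + \<omega> X Y Z p)"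
proof -
  define P where "P X Y W \<longleftrightarrow> W \<in> vector_fields A \<and> (\<forall>Z\<in>vector_fields A. \<forall>p\<in>carrier A.
       2 * g_field g W Z p = koszul A g X Y Z p + \<omega> X Y Z p)" for X Y W
  have "\<exists>W. P X Y W" if X: "X \<in> vector_fields A" and Y: "Y \<in> vector_fields A" for X Y
  proof -
    obtain \<beta> where \<beta>: "covector_field A \<beta>"
      "\<And>Z p. Z \<in> vector_fields A \<Longrightarrow> p \<in> carrier A \<Longrightarrow> \<beta> p (Z p) = koszul A g X Y Z p"
      using covector_koszul[OF X Y] by blast
    obtain B where B: "represents_form \<omega> X Y B" using \<omega>[OF X Y] by blast
    then have "covector_field A (\<lambda>p v. 1 / 2 * (\<beta> p v + g p (B p) v))"
      unfolding represents_form_def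
      by (intro covector_field_scale covector_field_add \<beta> covector_field_flat) blast
    then obtain W where W: "W \<in> vector_fields A"
      "\<And>p v. p \<in> carrier A \<Longrightarrow> v \<in> tangent_space A p \<Longrightarrow> g p (W p) v = 1 / 2 * (\<beta> p v + g p (B p) v)"
      using ex_sharp by blast
    have "2 * g_field g W Z p = koszul A g X Y Z p + \<omega> X Y Z p"
      if Z: "Z \<in> vector_fields A" and p: "p \<in> carrier A" for Z p
    proof -
      have "\<omega> X Y Z p = g p (B p) (Z p)"
        using B Z p unfolding represents_form_def g_field_def by blast
      then show ?thesis using W(2)[OF p vector_fieldD(1)[OF Z]] \<beta>(2)[OF Z p] by (simp add: g_field_def)
    qed
    with W(1) show ?thesis unfolding P_def by blast
  qed
  then have "\<forall>X\<in>vector_fields A. \<exists>d. \<forall>Y\<in>vector_fields A. P X Y (d Y)"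
    by (intro ballI bchoice) blast
  then have "\<exists>D. \<forall>X\<in>vector_fields A. \<forall>Y\<in>vector_fields A. P X Y (D X Y)" by (rule bchoice)
  then show ?thesis unfolding P_def .
qed

text \<open>The third argument is linear by representation, and skewness transports this to the
  others. A field in the first place is two transpositions away from the third, hence the factor 1;
  one in the second place is a single transposition away, hence -1.\<close>

lemma three_formI:
  assumes rep: "\<And>X Y. X \<in> vector_fields A \<Longrightarrow> Y \<in> vector_fields A \<Longrightarrow> \<exists>W. represents_form \<omega> X Y W"
    and skew: "\<And>X Y Z p. X \<in> vector_fields A \<Longrightarrow> Y \<in> vector_fields A \<Longrightarrow> Z \<in> vector_fields A \<Longrightarrow>
      p \<in> carrier A \<Longrightarrow> \<omega> Y X Z p = - \<omega> X Y Z p \<and> \<omega> X Z Y p = - \<omega> X Y Z p"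
  shows "three_form A \<omega>"
proof -
  have lin: "Cinf_linear A (\<omega> X Y)" if XY: "X \<in> vector_fields A" "Y \<in> vector_fields A" for X Y
  proof -
    obtain W where W: "W \<in> vector_fields A"
      and \<omega>: "\<And>Z p. Z \<in> vector_fields A \<Longrightarrow> p \<in> carrier A \<Longrightarrow> \<omega> X Y Z p = g_field g W Z p"
      using rep[OF XY] unfolding represents_form_def by blast
    show ?thesis
      unfolding Cinf_linear_def
      using W smooth_fun_cong[OF \<omega>]
      by (auto simp: \<omega> g_field_vadd g_field_vscale vector_field_intros smooth_fun_g_field)
  qed
  have cong: "Cinf_linear A F" if F: "Cinf_linear A F'"
    and eq: "\<And>Z p. Z \<in> vector_fields A \<Longrightarrow> p \<in> carrier A \<Longrightarrow> F Z p = r * F' Z p" for F F' r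
  proof -
    have "smooth_fun A (F Z)" if Z: "Z \<in> vector_fields A" for Z
      using smooth_fun_mult[OF smooth_fun_const, of "F' Z" r] F Z smooth_fun_cong[of "F Z" "\<lambda>p. r * F' Z p", OF eq[OF Z]]
      unfolding Cinf_linear_def by blast
    then show ?thesis
      using F unfolding Cinf_linear_def
      by (simp add: eq vector_field_intros algebra_simps)
  qed
  have "Cinf_linear A (\<lambda>Z. \<omega> Z X Y)" "Cinf_linear A (\<lambda>Z. \<omega> X Z Y)"
    if XY: "X \<in> vector_fields A" "Y \<in> vector_fields A" for X Y
  proof -
    show "Cinf_linear A (\<lambda>Z. \<omega> Z X Y)"
    proof (rule cong[OF lin[OF XY], of _ 1])
      show "\<omega> Z X Y p = 1 * \<omega> X Y Z p" if "Z \<in> vector_fields A" "p \<in> carrier A" for Z p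
        using skew[of X Z Y p] skew[of X Y Z p] XY that by simp
    qed
    show "Cinf_linear A (\<lambda>Z. \<omega> X Z Y)"
    proof (rule cong[OF lin[OF XY], of _ "-1"])
      show "\<omega> X Z Y p = -1 * \<omega> X Y Z p" if "Z \<in> vector_fields A" "p \<in> carrier A" for Z p
        using skew[of X Y Z p] XY that by simp
    qed
  qed
  with lin skew show ?thesis unfolding three_form_def by blast
qed

lemma three_formD:
  assumes "three_form A \<omega>" "X \<in> vector_fields A" "Y \<in> vector_fields A" "Z \<in> vector_fields A" "p \<in> carrier A"
  shows "\<omega> Y X Z p = - \<omega> X Y Z p" "\<omega> X Z Y p = - \<omega> X Y Z p"
    and "W \<in> vector_fields A \<Longrightarrow> \<omega> (vadd X W) Y Z p = \<omega> X Y Z p + \<omega> W Y Z p"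
    and "W \<in> vector_fields A \<Longrightarrow> \<omega> X (vadd Y W) Z p = \<omega> X Y Z p + \<omega> X W Z p"
    and "smooth_fun A f \<Longrightarrow> \<omega> (vscale f X) Y Z p = f p * \<omega> X Y Z p"
    and "smooth_fun A f \<Longrightarrow> \<omega> X (vscale f Y) Z p = f p * \<omega> X Y Z p"
    and "smooth_fun A f \<Longrightarrow> \<omega> X Y (vscale f Z) p = f p * \<omega> X Y Z p"
proof -
  show "\<omega> Y X Z p = - \<omega> X Y Z p" "\<omega> X Z Y p = - \<omega> X Y Z p"
    using assms unfolding three_form_def by blast+
  have "Cinf_linear A (\<lambda>U. \<omega> U Y Z)" "Cinf_linear A (\<lambda>U. \<omega> X U Z)" "Cinf_linear A (\<lambda>U. \<omega> X Y U)"
    using assms unfolding three_form_def by blast+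
  with assms(2-5) show
    "W \<in> vector_fields A \<Longrightarrow> \<omega> (vadd X W) Y Z p = \<omega> X Y Z p + \<omega> W Y Z p"
    "W \<in> vector_fields A \<Longrightarrow> \<omega> X (vadd Y W) Z p = \<omega> X Y Z p + \<omega> X W Z p"
    "smooth_fun A f \<Longrightarrow> \<omega> (vscale f X) Y Z p = f p * \<omega> X Y Z p"
    "smooth_fun A f \<Longrightarrow> \<omega> X (vscale f Y) Z p = f p * \<omega> X Y Z p"
    "smooth_fun A f \<Longrightarrow> \<omega> X Y (vscale f Z) p = f p * \<omega> X Y Z p"
    unfolding Cinf_linear_def by blast+
qed

text \<open>Every law for \<open>D\<close> is checked after pairing with an arbitrary
  \<open>Z\<close>. Symmetrising the Koszul equation in \<open>Y\<close> and \<open>Z\<close> leaves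
  twice the derivative of \<open>g Y Z\<close> along \<open>X\<close>, which is metricity;
  antisymmetrising in \<open>X\<close> and \<open>Y\<close> leaves twice the bracket and twice
  \<open>\<omega>\<close>, which gives the torsion.\<close>

lemma koszul_connection:
  assumes D: "\<And>X Y. X \<in> vector_fields A \<Longrightarrow> Y \<in> vector_fields A \<Longrightarrow> D X Y \<in> vector_fields A"
    and K: "\<And>X Y Z p. X \<in> vector_fields A \<Longrightarrow> Y \<in> vector_fields A \<Longrightarrow> Z \<in> vector_fields A \<Longrightarrow>
      p \<in> carrier A \<Longrightarrow> 2 * g_field g (D X Y) Z p = koszul A g X Y Z p + \<omega> X Y Z p"
    and \<omega>: "three_form A \<omega>"
  shows "linear_connection A D" "preserves_metric A g D"
    and "\<And>X Y Z p. X \<in> vector_fields A \<Longrightarrow> Y \<in> vector_fields A \<Longrightarrow> Z \<in> vector_fields A \<Longrightarrow>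
      p \<in> carrier A \<Longrightarrow> torsion3 A g D X Y Z p = \<omega> X Y Z p"
proof -
  have G: "g_field g (D X Y) Z p = (koszul A g X Y Z p + \<omega> X Y Z p) / 2"
    if "X \<in> vector_fields A" "Y \<in> vector_fields A" "Z \<in> vector_fields A" "p \<in> carrier A" for X Y Z p
    using K[OF that] by simp
  have "D (vadd X Y) Z = vadd (D X Z) (D Y Z)" "D X (vadd Y Z) = vadd (D X Y) (D X Z)"
    if "X \<in> vector_fields A" "Y \<in> vector_fields A" "Z \<in> vector_fields A" for X Y Z
    using that D
    by (auto intro!: vector_field_g_eqI vector_field_intros
        simp: g_field_vadd vector_field_intros G koszul_vadd1 koszul_vadd2 three_formD(3-6)[OF \<omega>] field_simps)
  moreover have "D (vscale f X) Y = vscale f (D X Y)"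
    "D X (vscale f Y) = vadd (vscale (dir_deriv A X f) Y) (vscale f (D X Y))"
    if "smooth_fun A f" "X \<in> vector_fields A" "Y \<in> vector_fields A" for f X Y
    using that D
    by (auto intro!: vector_field_g_eqI vector_field_intros
        simp: g_field_vadd g_field_vscale vector_field_intros G koszul_vscale1 koszul_vscale2
          three_formD(3-6)[OF \<omega>] field_simps)
  ultimately show "linear_connection A D" unfolding linear_connection_def using D by blast
  have "dir_deriv A X (g_field g Y Z) p - g_field g (D X Y) Z p - g_field g Y (D X Z) p = 0"
    if X: "X \<in> vector_fields A" and Y: "Y \<in> vector_fields A" and Z: "Z \<in> vector_fields A"
      and p: "p \<in> carrier A" for X Y Z p
    unfolding g_field_sym[OF Y D[OF X Z] p] G[OF X Y Z p] G[OF X Z Y p] koszul_def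
    using dir_deriv_g_sym[OF Y Z p, of X] g_field_lie_bracket_skew[OF Z Y X p]
      three_formD(2)[OF \<omega> X Y Z p]
    by (simp add: field_simps)
  then show "preserves_metric A g D" unfolding preserves_metric_def by blast
  show "torsion3 A g D X Y Z p = \<omega> X Y Z p"
    if X: "X \<in> vector_fields A" and Y: "Y \<in> vector_fields A" and Z: "Z \<in> vector_fields A"
      and p: "p \<in> carrier A" for X Y Z p
    unfolding torsion3_def torsion_def
    using g_field_vdiff[OF vector_field_vdiff[OF D[OF X Y] D[OF Y X]] vector_field_lie_bracket[OF X Y] Z p]
      g_field_vdiff[OF D[OF X Y] D[OF Y X] Z p] G[OF X Y Z p] G[OF Y X Z p]
      dir_deriv_g_sym[OF X Y p, of Z] g_field_lie_bracket_skew[OF X Y Z p] three_formD(1)[OF \<omega> X Y Z p]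
    by (simp add: koszul_def field_simps)
qed

text \<open>Metricity replaces the three derivatives and the torsion replaces the three brackets in
  the Koszul expression. Of the three torsion terms that arise, skewness makes two cancel.\<close>

lemma metric_connection_koszul:
  assumes D: "linear_connection A D" and metric: "preserves_metric A g D"
    and T: "three_form A (torsion3 A g D)"
    and X: "X \<in> vector_fields A" and Y: "Y \<in> vector_fields A" and Z: "Z \<in> vector_fields A"
    and p: "p \<in> carrier A"
  shows "2 * g_field g (D X Y) Z p = koszul A g X Y Z p + torsion3 A g D X Y Z p"
proof -
  have DV: "D U V \<in> vector_fields A" if "U \<in> vector_fields A" "V \<in> vector_fields A" for U V
    using D that unfolding linear_connection_def by blast
  have m: "dir_deriv A U (g_field g V W) p = g_field g (D U V) W p + g_field g (D U W) V p"
    if U: "U \<in> vector_fields A" and V: "V \<in> vector_fields A" and W: "W \<in> vector_fields A" for U V W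
  proof -
    have "dir_deriv A U (g_field g V W) p - g_field g (D U V) W p - g_field g V (D U W) p = 0"
      using metric U V W p unfolding preserves_metric_def by blast
    then show ?thesis using g_field_sym[OF V DV[OF U W] p] by simp
  qed
  have t: "torsion3 A g D U V W p = g_field g (D U V) W p - g_field g (D V U) W p - g_field g (lie_bracket A U V) W p"
    if U: "U \<in> vector_fields A" and V: "V \<in> vector_fields A" and W: "W \<in> vector_fields A" for U V W
    unfolding torsion3_def torsion_def
    using g_field_vdiff[OF vector_field_vdiff[OF DV[OF U V] DV[OF V U]] vector_field_lie_bracket[OF U V] W p]
      g_field_vdiff[OF DV[OF U V] DV[OF V U] W p] by simp
  show ?thesis
    unfolding koszul_def
    using m[OF X Y Z] m[OF Y X Z] m[OF Z X Y] t[OF X Y Z] t[OF X Z Y] t[OF Y Z X]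
      three_formD(2)[OF T X Y Z p] three_formD(1)[OF T X Y Z p] three_formD(2)[OF T Y X Z p]
    by linarith
qed

text \<open>The construction with \<open>\<omega> = 0\<close>. The Koszul equation is part of the
  conclusion so that other connections can be compared with this one.\<close>

lemma ex_levi_civita:
  "\<exists>D. levi_civita A g D \<and> (\<forall>X\<in>vector_fields A. \<forall>Y\<in>vector_fields A. \<forall>Z\<in>vector_fields A. \<forall>p\<in>carrier A.
    2 * g_field g (D X Y) Z p = koszul A g X Y Z p)"
proof -
  define V0 where "V0 = (\<lambda>_::'a. tzero :: ('a, 'b) tvec)"
  have V0: "V0 \<in> vector_fields A" unfolding V0_def by (auto intro!: vector_fieldI)
  have g0: "g_field g V0 Z p = 0" if "Z \<in> vector_fields A" "p \<in> carrier A" for Z p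
  proof -
    have "tscale 0 tzero = (tzero :: ('a, 'b) tvec)" by (intro ext) simp
    then show ?thesis
      using g_scale[OF that(2) tzero_tangent vector_fieldD(1)[OF that(1)], of 0]
      by (simp add: V0_def g_field_def)
  qed
  let ?\<omega> = "\<lambda>(X :: ('a, 'b) vfield) (Y :: ('a, 'b) vfield) (Z :: ('a, 'b) vfield) (p :: 'a). 0 :: real"
  have rep: "\<exists>W. represents_form ?\<omega> X Y W" for X Y
    unfolding represents_form_def using V0 g0 by (intro exI[of _ V0]) simp
  obtain D where D: "\<And>X Y. X \<in> vector_fields A \<Longrightarrow> Y \<in> vector_fields A \<Longrightarrow> D X Y \<in> vector_fields A"
    and K: "\<And>X Y Z p. X \<in> vector_fields A \<Longrightarrow> Y \<in> vector_fields A \<Longrightarrow> Z \<in> vector_fields A \<Longrightarrow>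
      p \<in> carrier A \<Longrightarrow> 2 * g_field g (D X Y) Z p = koszul A g X Y Z p + ?\<omega> X Y Z p"
    using ex_koszul_connection[OF rep] by blast
  have form: "three_form A ?\<omega>" by (rule three_formI[OF rep]) simp
  have conn: "linear_connection A D" "preserves_metric A g D"
    by (rule koszul_connection[OF D K form]; assumption)+
  have tors: "torsion3 A g D X Y Z p = 0"
    if "X \<in> vector_fields A" "Y \<in> vector_fields A" "Z \<in> vector_fields A" "p \<in> carrier A" for X Y Z p
    using that by (rule koszul_connection(3)[OF D K form, rotated -4])
  have "torsion A D X Y p = tzero"
    if X: "X \<in> vector_fields A" and Y: "Y \<in> vector_fields A" and p: "p \<in> carrier A" for X Y p
  proof -
    have T: "torsion A D X Y \<in> vector_fields A"
      unfolding torsion_def by (intro vector_field_intros D X Y)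
    \<comment> \<open>The torsion is a smooth field, so it may be inserted as the third
      argument.\<close>
    have "g p (torsion A D X Y p) (torsion A D X Y p) = 0"
      using tors[OF X Y T p] unfolding torsion3_def by (simp add: g_field_def)
    then show ?thesis using g_pos[OF p vector_fieldD(1)[OF T]] by force
  qed
  then have "levi_civita A g D" unfolding levi_civita_def using conn by blast
  with K show ?thesis by auto
qed

end

section \<open>Almost hermitian manifolds\<close>

context almost_hermitian_manifold
begin

section \<open>Interplay of \<open>J\<close> with fields and metric products\<close>

lemma vector_field_J_field:
  assumes X: "X \<in> vector_fields A"
  shows "J_field A J X \<in> vector_fields A"
proof (rule vector_fieldI)
  show "J_field A J X p \<in> tangent_space A p" for p
    using J_tangent[OF _ vector_fieldD(1)[OF X]] unfolding J_field_def by simp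
  fix c assume c: "c \<in> A"
  note c' = chart_inv_charts_at[OF c]
  have lin: "linear (\<lambda>u. J p (coord_vec A c p u) c)" if "c \<in> charts_at A p" for p
    using J_add[OF carrierI[OF that]] J_scale[OF carrierI[OF that]] coord_vec_tangent[OF that]
    by (intro linearI) (simp_all add: coord_vec_add[OF that] coord_vec_scale[OF that])
  have "smooth_on (chart_image c)
      (\<lambda>x. J (chart_inv c x) (coord_vec A c (chart_inv c x) (X (chart_inv c x) c)) c)"
    by (rule smooth_on_linear_family[OF chart_image_open[OF c] lin[OF c'] vector_fieldD(2)[OF X c]
          J_smooth[OF c]])
  then show "smooth_on (chart_image c) (\<lambda>x. J_field A J X (chart_inv c x) c)"
    by (rule smooth_on_cong[THEN iffD1, OF chart_image_open[OF c], rotated])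
      (simp add: J_field_def carrierI[OF c'] coord_vec_of_tangent[OF vector_fieldD(1)[OF X] c'])
qed

lemma J_field_J_field:
  assumes X: "X \<in> vector_fields A"
  shows "J_field A J (J_field A J X) = vscale (\<lambda>_. -1) X"
proof
  fix p show "J_field A J (J_field A J X) p = vscale (\<lambda>_. -1) X p"
    using J_square[OF _ vector_fieldD(1)[OF X]] tangent_outside[OF vector_fieldD(1)[OF X], of p]
    by (cases "p \<in> carrier A") (auto simp: J_field_def fun_eq_iff)
qed

lemma g_field_J_J:
  assumes "X \<in> vector_fields A" "Y \<in> vector_fields A" "p \<in> carrier A"
  shows "g_field g (J_field A J X) (J_field A J Y) p = g_field g X Y p"
  using J_orthogonal[OF assms(3) vector_fieldD(1)[OF assms(1)] vector_fieldD(1)[OF assms(2)]] assms(3)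
  by (simp add: g_field_def J_field_def)

lemma g_field_JJ:
  assumes "X \<in> vector_fields A" "Y \<in> vector_fields A" "p \<in> carrier A"
  shows "g_field g X (J_field A J (J_field A J Y)) p = - g_field g X Y p"
  unfolding J_field_J_field[OF assms(2)] using g_field_vscale(2)[OF assms(2,1,3)] by simp

lemma g_field_J_skew:
  assumes "X \<in> vector_fields A" "Y \<in> vector_fields A" "p \<in> carrier A"
  shows "g_field g (J_field A J X) Y p = - g_field g X (J_field A J Y) p"
  using g_field_J_J[OF assms(1) vector_field_J_field[OF assms(2)] assms(3)]
    g_field_JJ[OF vector_field_J_field[OF assms(1)] assms(2,3)] by simp

lemma dir_deriv_J_J:
  assumes "X \<in> vector_fields A" "Y \<in> vector_fields A" "p \<in> carrier A"
  shows "dir_deriv A U (g_field g (J_field A J X) (J_field A J Y)) p = dir_deriv A U (g_field g X Y) p"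
  by (rule dir_deriv_cong[OF assms(3) g_field_J_J[OF assms(1,2)]])

lemma dir_deriv_J_skew:
  assumes "U \<in> vector_fields A" "X \<in> vector_fields A" "Y \<in> vector_fields A" "p \<in> carrier A"
  shows "dir_deriv A U (g_field g (J_field A J X) Y) p = - dir_deriv A U (g_field g X (J_field A J Y)) p"
  using dir_deriv_cong[OF assms(4) g_field_J_skew[OF assms(2,3)], where X = U]
    dir_deriv_minus_fun[OF smooth_fun_g_field[OF assms(2) vector_field_J_field[OF assms(3)]] assms(1,4)]
  by simp

lemma dir_deriv_JJ:
  assumes "U \<in> vector_fields A" "X \<in> vector_fields A" "Y \<in> vector_fields A" "p \<in> carrier A"
  shows "dir_deriv A U (g_field g X (J_field A J (J_field A J Y))) p = - dir_deriv A U (g_field g X Y) p"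
  using dir_deriv_J_skew[OF assms(1,2) vector_field_J_field[OF assms(3)] assms(4)]
    dir_deriv_J_J[OF assms(2,3,4), of U] by simp

lemma dir_deriv_kaehler_skew:
  assumes "U \<in> vector_fields A" "X \<in> vector_fields A" "Y \<in> vector_fields A" "p \<in> carrier A"
  shows "dir_deriv A U (g_field g Y (J_field A J X)) p = - dir_deriv A U (g_field g X (J_field A J Y)) p"
  using dir_deriv_J_skew[OF assms] dir_deriv_g_sym[OF assms(3) vector_field_J_field[OF assms(2)] assms(4), of U]
  by simp

section \<open>The Kaehler form and the Nijenhuis tensor\<close>

lemma ext_deriv_kaehler:
  "ext_deriv A (kaehler_form A g J) X Y Z p =
     dir_deriv A X (g_field g Y (J_field A J Z)) p - dir_deriv A Y (g_field g X (J_field A J Z)) p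
   + dir_deriv A Z (g_field g X (J_field A J Y)) p
   - g_field g (lie_bracket A X Y) (J_field A J Z) p + g_field g (lie_bracket A X Z) (J_field A J Y) p
   - g_field g (lie_bracket A Y Z) (J_field A J X) p"
  unfolding ext_deriv_def kaehler_form_def ..

lemma nijenhuis_vector_field:
  assumes "X \<in> vector_fields A" "Y \<in> vector_fields A"
  shows "nijenhuis A J X Y \<in> vector_fields A"
  unfolding nijenhuis_def by (intro vector_field_intros vector_field_J_field assms)

lemma nijenhuis3_eq:
  assumes X: "X \<in> vector_fields A" and Y: "Y \<in> vector_fields A" and Z: "Z \<in> vector_fields A"
    and p: "p \<in> carrier A"
  shows "nijenhuis3 A g J X Y Z p =
      g_field g (lie_bracket A (J_field A J X) (J_field A J Y)) Z p - g_field g (lie_bracket A X Y) Z p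
    + g_field g (lie_bracket A (J_field A J X) Y) (J_field A J Z) p
    + g_field g (lie_bracket A X (J_field A J Y)) (J_field A J Z) p"
  unfolding nijenhuis3_def nijenhuis_def
  by (simp add: g_field_vdiff g_field_J_skew vector_field_intros vector_field_J_field X Y Z p)

text \<open>The linear third argument of \<open>N\<close>. Tensoriality in the other two arguments
  then comes from skewness through \<open>three_formI\<close>.\<close>

lemma represents_nijenhuis:
  "X \<in> vector_fields A \<Longrightarrow> Y \<in> vector_fields A \<Longrightarrow>
    represents_form (nijenhuis3 A g J) X Y (nijenhuis A J X Y)"
  unfolding represents_form_def nijenhuis3_def by (simp add: nijenhuis_vector_field)

text \<open>The terms \<open>X(\<Omega>(Y, Z)) - \<Omega>(Y, [X, Z])\<close> of \<open>d\<Omega>(X, Y, Z)\<close> add up to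
  \<open>- (L\<^sub>X \<beta>)(Z)\<close> with \<open>\<beta> = g(JY, \<cdot>)\<close>.\<close>

lemma represents_ext_deriv_kaehler:
  assumes X: "X \<in> vector_fields A" and Y: "Y \<in> vector_fields A"
  shows "\<exists>W. represents_form (ext_deriv A (kaehler_form A g J)) X Y W"
proof -
  note JX = vector_field_J_field[OF X] and JY = vector_field_J_field[OF Y]
  note XY = vector_field_lie_bracket[OF X Y]
  define \<beta> where "\<beta> p v = -1 * lie_covector A X (\<lambda>p. g p (J_field A J Y p)) p v
      + (lie_covector A Y (\<lambda>p. g p (J_field A J X p)) p v
      + (differential A (g_field g X (J_field A J Y)) p v + g p (J_field A J (lie_bracket A X Y) p) v))" for p v
  have "covector_field A \<beta>"
    unfolding \<beta>_def[abs_def]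
    by (intro covector_field_add covector_field_scale covector_field_lie covector_field_flat
        covector_field_differential smooth_fun_g_field vector_field_J_field XY X Y)
  then obtain W where W: "W \<in> vector_fields A"
    "\<And>p v. p \<in> carrier A \<Longrightarrow> v \<in> tangent_space A p \<Longrightarrow> g p (W p) v = \<beta> p v"
    using ex_sharp by blast
  have "ext_deriv A (kaehler_form A g J) X Y Z p = g_field g W Z p"
    if Z: "Z \<in> vector_fields A" and p: "p \<in> carrier A" for Z p
  proof -
    note XZ = vector_field_lie_bracket[OF X Z] and YZ = vector_field_lie_bracket[OF Y Z]
    have "g_field g W Z p = \<beta> p (Z p)"
      unfolding g_field_def by (rule W(2)[OF p vector_fieldD(1)[OF Z]])
    also have "\<dots> = ext_deriv A (kaehler_form A g J) X Y Z p"
      unfolding \<beta>_def ext_deriv_kaehler lie_covector_apply[OF covector_field_flat[OF JY] X Z p]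
        lie_covector_apply[OF covector_field_flat[OF JX] Y Z p]
      using dir_deriv_J_skew[OF X Y Z p] dir_deriv_J_skew[OF Y X Z p] g_field_J_skew[OF XY Z p]
        g_field_sym[OF JY XZ p] g_field_sym[OF JX YZ p]
      by (simp add: dir_deriv_differential[of A Z] g_field_def[abs_def])
    finally show ?thesis by (rule sym)
  qed
  with W(1) show ?thesis unfolding represents_form_def by blast
qed

lemma three_form_ext_deriv_kaehler: "three_form A (ext_deriv A (kaehler_form A g J))"
proof (rule three_formI[OF represents_ext_deriv_kaehler])
  fix X Y Z p
  assume X: "X \<in> vector_fields A" and Y: "Y \<in> vector_fields A" and Z: "Z \<in> vector_fields A"
    and p: "p \<in> carrier A"
  note J = vector_field_J_field
  show "ext_deriv A (kaehler_form A g J) Y X Z p = - ext_deriv A (kaehler_form A g J) X Y Z p \<and>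
      ext_deriv A (kaehler_form A g J) X Z Y p = - ext_deriv A (kaehler_form A g J) X Y Z p"
    unfolding ext_deriv_kaehler
    using dir_deriv_kaehler_skew[OF Z X Y p] dir_deriv_kaehler_skew[OF X Y Z p]
      g_field_lie_bracket_skew[OF X Y J[OF Z] p] g_field_lie_bracket_skew[OF Y Z J[OF X] p]
    by simp
qed

definition hermitian_torsion ::
  "('a, 'b) vfield \<Rightarrow> ('a, 'b) vfield \<Rightarrow> ('a, 'b) vfield \<Rightarrow> 'a \<Rightarrow> real" where
  "hermitian_torsion X Y Z p =
     - ext_deriv A (kaehler_form A g J) (J_field A J X) (J_field A J Y) (J_field A J Z) p
     + nijenhuis3 A g J X Y Z p"

text \<open>If \<open>S\<close> represents the exterior derivative at \<open>JX\<close> and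
  \<open>JY\<close>, then inserting \<open>JZ\<close> gives \<open>g(S, JZ) = - g(JS, Z)\<close>.
  The minus sign in the torsion formula therefore turns into the dual field
  \<open>JS\<close>.\<close>

lemma represents_hermitian_torsion:
  assumes X: "X \<in> vector_fields A" and Y: "Y \<in> vector_fields A"
  shows "\<exists>W. represents_form hermitian_torsion X Y W"
proof -
  note J = vector_field_J_field
  obtain S where S: "S \<in> vector_fields A" and dO: "\<And>Z p. Z \<in> vector_fields A \<Longrightarrow> p \<in> carrier A \<Longrightarrow>
      ext_deriv A (kaehler_form A g J) (J_field A J X) (J_field A J Y) Z p = g_field g S Z p"
    using represents_ext_deriv_kaehler[OF J[OF X] J[OF Y]] unfolding represents_form_def by blast
  have "hermitian_torsion X Y Z p = g_field g (vadd (J_field A J S) (nijenhuis A J X Y)) Z p"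
    if Z: "Z \<in> vector_fields A" and p: "p \<in> carrier A" for Z p
    using g_field_vadd(1)[OF J[OF S] nijenhuis_vector_field[OF X Y] Z p] g_field_J_skew[OF S Z p]
      dO[OF J[OF Z] p]
    by (simp add: hermitian_torsion_def nijenhuis3_def)
  then show ?thesis
    unfolding represents_form_def using J[OF S] nijenhuis_vector_field[OF X Y] vector_field_vadd by blast
qed

lemma three_form_hermitian_torsion:
  assumes N: "three_form A (nijenhuis3 A g J)"
  shows "three_form A hermitian_torsion"
proof (rule three_formI[OF represents_hermitian_torsion])
  fix X Y Z p
  assume X: "X \<in> vector_fields A" and Y: "Y \<in> vector_fields A" and Z: "Z \<in> vector_fields A"
    and p: "p \<in> carrier A"
  note J = vector_field_J_field
  show "hermitian_torsion Y X Z p = - hermitian_torsion X Y Z p \<and>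
      hermitian_torsion X Z Y p = - hermitian_torsion X Y Z p"
    unfolding hermitian_torsion_def
    using three_formD(1,2)[OF N X Y Z p]
      three_formD(1,2)[OF three_form_ext_deriv_kaehler J[OF X] J[OF Y] J[OF Z] p]
    by simp
qed

text \<open>\<open>J\<close> is skew for \<open>g\<close>, so for the connection defined by the
  Koszul equation this identity is \<open>\<nabla>J = 0\<close> paired with
  \<open>Z\<close>.\<close>

lemma koszul_hermitian_torsion_J:
  assumes N: "three_form A (nijenhuis3 A g J)"
    and X: "X \<in> vector_fields A" and Y: "Y \<in> vector_fields A" and Z: "Z \<in> vector_fields A"
    and p: "p \<in> carrier A"
  shows "koszul A g X (J_field A J Y) Z p + hermitian_torsion X (J_field A J Y) Z p =
    - (koszul A g X Y (J_field A J Z) p + hermitian_torsion X Y (J_field A J Z) p)"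
proof -
  note J = vector_field_J_field and L = vector_field_lie_bracket
  note JX = J[OF X] and JY = J[OF Y] and JZ = J[OF Z]
  \<comment> \<open>The torsion at \<open>JY\<close> or \<open>JZ\<close> applies \<open>J\<close>
    twice inside the exterior derivative. Tensoriality turns this into a sign before any bracket is
    expanded.\<close>
  have dO1: "ext_deriv A (kaehler_form A g J) (J_field A J X) (J_field A J (J_field A J Y)) (J_field A J Z) p
      = - ext_deriv A (kaehler_form A g J) (J_field A J X) Y (J_field A J Z) p"
    unfolding J_field_J_field[OF Y]
    using three_formD(6)[OF three_form_ext_deriv_kaehler JX Y JZ p, of "\<lambda>_. -1"] by simp
  have dO2: "ext_deriv A (kaehler_form A g J) (J_field A J X) (J_field A J Y) (J_field A J (J_field A J Z)) p
      = - ext_deriv A (kaehler_form A g J) (J_field A J X) (J_field A J Y) Z p"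
    unfolding J_field_J_field[OF Z]
    using three_formD(7)[OF three_form_ext_deriv_kaehler JX JY Z p, of "\<lambda>_. -1"] by simp
  note dirs = dir_deriv_J_skew[OF X Y Z p] dir_deriv_JJ[OF JX Y Z p]
    dir_deriv_J_J[OF X JZ p, of Y] dir_deriv_J_J[OF X Y p, of "J_field A J Z"]
    dir_deriv_J_J[OF Y Z p, of "J_field A J X"] dir_deriv_J_J[OF X Z p, of "J_field A J Y"]
    dir_deriv_J_J[OF X JY p, of Z]
  note brs = g_field_JJ[OF L[OF JX Y] Z p] g_field_JJ[OF L[OF Y JZ] X p]
    g_field_JJ[OF L[OF JX Z] Y p] g_field_JJ[OF L[OF JY Z] X p]
    g_field_JJ[OF L[OF X JY] Z p] g_field_JJ[OF L[OF X JZ] Y p]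
  show ?thesis
    \<comment> \<open>Skewness exchanges \<open>N(X, JY, Z)\<close> for
      \<open>- N(X, Z, JY)\<close>. In the expansion of the latter a repeated \<open>J\<close>
      appears only in a slot of \<open>g\<close>, where the facts in \<open>brs\<close> remove it;
      what remains is linear arithmetic.\<close>
    using three_formD(2)[OF N X JY Z p] nijenhuis3_eq[OF X Y JZ p] nijenhuis3_eq[OF X Z JY p] dirs brs
    unfolding hermitian_torsion_def dO1 dO2 unfolding ext_deriv_kaehler koszul_def by linarith
qed

lemma ex_skew_hermitian_connection:
  assumes N: "three_form A (nijenhuis3 A g J)"
  shows "\<exists>D. skew_hermitian_connection A g J D"
proof -
  note T = three_form_hermitian_torsion[OF N]
  obtain D where D: "\<And>X Y. X \<in> vector_fields A \<Longrightarrow> Y \<in> vector_fields A \<Longrightarrow> D X Y \<in> vector_fields A"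
    and K: "\<And>X Y Z p. X \<in> vector_fields A \<Longrightarrow> Y \<in> vector_fields A \<Longrightarrow> Z \<in> vector_fields A \<Longrightarrow>
      p \<in> carrier A \<Longrightarrow> 2 * g_field g (D X Y) Z p = koszul A g X Y Z p + hermitian_torsion X Y Z p"
    using ex_koszul_connection[of hermitian_torsion, OF represents_hermitian_torsion] by blast
  have conn: "linear_connection A D" "preserves_metric A g D"
    by (rule koszul_connection[OF D K T]; assumption)+
  have tors: "torsion3 A g D X Y Z p = hermitian_torsion X Y Z p"
    if "X \<in> vector_fields A" "Y \<in> vector_fields A" "Z \<in> vector_fields A" "p \<in> carrier A" for X Y Z p
    using that by (rule koszul_connection(3)[OF D K T, rotated -4])
  \<comment> \<open>The torsion is known to agree with \<open>hermitian_torsion\<close> on smooth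
    fields at points of the manifold only, so the form property is transferred through its
    criterion.\<close>
  have "three_form A (torsion3 A g D)"
  proof (rule three_formI)
    show "\<exists>W. represents_form (torsion3 A g D) X Y W"
      if "X \<in> vector_fields A" "Y \<in> vector_fields A" for X Y
      using represents_hermitian_torsion[OF that] tors[OF that] unfolding represents_form_def by simp
    fix X Y Z p
    assume X: "X \<in> vector_fields A" and Y: "Y \<in> vector_fields A" and Z: "Z \<in> vector_fields A"
      and p: "p \<in> carrier A"
    show "torsion3 A g D Y X Z p = - torsion3 A g D X Y Z p \<and>
        torsion3 A g D X Z Y p = - torsion3 A g D X Y Z p"
      unfolding tors[OF X Y Z p] tors[OF Y X Z p] tors[OF X Z Y p]
      using three_formD(1,2)[OF T X Y Z p] by blast
  qed
  moreover have "D X (J_field A J Y) = J_field A J (D X Y)"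
    if X: "X \<in> vector_fields A" and Y: "Y \<in> vector_fields A" for X Y
  proof (rule vector_field_g_eqI[OF D[OF X vector_field_J_field[OF Y]] vector_field_J_field[OF D[OF X Y]]])
    fix Z p assume Z: "Z \<in> vector_fields A" and p: "p \<in> carrier A"
    show "g_field g (D X (J_field A J Y)) Z p = g_field g (J_field A J (D X Y)) Z p"
      using K[OF X vector_field_J_field[OF Y] Z p] K[OF X Y vector_field_J_field[OF Z] p]
        koszul_hermitian_torsion_J[OF N X Y Z p] g_field_J_skew[OF D[OF X Y] Z p] by linarith
  qed
  then have "preserves_almost_complex A J D"
    unfolding preserves_almost_complex_def by (simp add: tdiff_eq_tzeroI)
  ultimately show ?thesis unfolding skew_hermitian_connection_def using conn by blast
qed

context
  fixes D assumes D: "skew_hermitian_connection A g J D"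
begin

section \<open>Consequences of a given hermitian connection with skew torsion\<close>

lemma skew_hermitian_three_form: "three_form A (torsion3 A g D)"
  using D unfolding skew_hermitian_connection_def by blast

lemma skew_hermitian_vector_field:
  "X \<in> vector_fields A \<Longrightarrow> Y \<in> vector_fields A \<Longrightarrow> D X Y \<in> vector_fields A"
  using D unfolding skew_hermitian_connection_def linear_connection_def by blast

text \<open>\<open>\<nabla>J = 0\<close> combined with the skewness of \<open>J\<close> for
  \<open>g\<close>: \<open>J\<close> moves from the differentiated field to the other
  factor.\<close>

lemma skew_hermitian_J:
  assumes X: "X \<in> vector_fields A" and Y: "Y \<in> vector_fields A" and Z: "Z \<in> vector_fields A"
    and p: "p \<in> carrier A"
  shows "g_field g (D X (J_field A J Y)) Z p = - g_field g (D X Y) (J_field A J Z) p"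
proof -
  have "tdiff (D X (J_field A J Y) p) (J_field A J (D X Y) p) = tzero"
    using D X Y p unfolding skew_hermitian_connection_def preserves_almost_complex_def by blast
  then have "D X (J_field A J Y) p c - J_field A J (D X Y) p c = 0" for c
    by (metis tvec_apply(2,4))
  then have "D X (J_field A J Y) p = J_field A J (D X Y) p" by (intro ext) simp
  then show ?thesis
    using g_field_J_skew[OF skew_hermitian_vector_field[OF X Y] Z p] by (simp add: g_field_def)
qed

lemma skew_hermitian_metric:
  assumes X: "X \<in> vector_fields A" and Y: "Y \<in> vector_fields A" and Z: "Z \<in> vector_fields A"
    and p: "p \<in> carrier A"
  shows "dir_deriv A X (g_field g Y Z) p = g_field g (D X Y) Z p + g_field g (D X Z) Y p"
proof -
  have "dir_deriv A X (g_field g Y Z) p - g_field g (D X Y) Z p - g_field g Y (D X Z) p = 0"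
    using D X Y Z p unfolding skew_hermitian_connection_def preserves_metric_def by blast
  then show ?thesis using g_field_sym[OF Y skew_hermitian_vector_field[OF X Z] p] by simp
qed

lemma skew_hermitian_torsion:
  assumes X: "X \<in> vector_fields A" and Y: "Y \<in> vector_fields A" and Z: "Z \<in> vector_fields A"
    and p: "p \<in> carrier A"
  shows "torsion3 A g D X Y Z p =
    g_field g (D X Y) Z p - g_field g (D Y X) Z p - g_field g (lie_bracket A X Y) Z p"
  unfolding torsion3_def torsion_def
  using X Y Z p by (simp add: g_field_vdiff vector_field_intros skew_hermitian_vector_field)

lemma skew_hermitian_torsion_JJ:
  assumes X: "X \<in> vector_fields A" and Y: "Y \<in> vector_fields A" and Z: "Z \<in> vector_fields A"
    and p: "p \<in> carrier A"
  shows "torsion3 A g D X Y (J_field A J (J_field A J Z)) p = - torsion3 A g D X Y Z p"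
  unfolding J_field_J_field[OF Z]
  using three_formD(7)[OF skew_hermitian_three_form X Y Z p, of "\<lambda>_. -1"] by simp

lemma skew_hermitian_ext_deriv_kaehler:
  assumes X: "X \<in> vector_fields A" and Y: "Y \<in> vector_fields A" and Z: "Z \<in> vector_fields A"
    and p: "p \<in> carrier A"
  shows "ext_deriv A (kaehler_form A g J) X Y Z p = torsion3 A g D X Y (J_field A J Z) p
    - torsion3 A g D X Z (J_field A J Y) p + torsion3 A g D Y Z (J_field A J X) p"
proof -
  note JX = vector_field_J_field[OF X] and JY = vector_field_J_field[OF Y] and JZ = vector_field_J_field[OF Z]
  show ?thesis
    \<comment> \<open>After these replacements every covariant derivative is paired with a field to
      which \<open>J\<close> is applied, and they cancel in pairs.\<close>
    unfolding ext_deriv_kaehler skew_hermitian_torsion[OF X Y JZ p] skew_hermitian_torsion[OF X Z JY p]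
      skew_hermitian_torsion[OF Y Z JX p] skew_hermitian_metric[OF X Y JZ p]
      skew_hermitian_metric[OF Y X JZ p] skew_hermitian_metric[OF Z X JY p]
      skew_hermitian_J[OF X Z Y p] skew_hermitian_J[OF Y Z X p] skew_hermitian_J[OF Z Y X p]
    by simp
qed

text \<open>On the right the covariant derivatives along each of \<open>X\<close>, \<open>Y\<close>,
  \<open>JX\<close> and \<open>JY\<close> occur in exactly two torsion terms and cancel by
  \<open>\<nabla>J = 0\<close>. The four brackets left over are those of \<open>N\<close>.\<close>

lemma skew_hermitian_nijenhuis:
  assumes X: "X \<in> vector_fields A" and Y: "Y \<in> vector_fields A" and Z: "Z \<in> vector_fields A"
    and p: "p \<in> carrier A"
  shows "nijenhuis3 A g J X Y Z p = torsion3 A g D X Y Z p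
    - torsion3 A g D (J_field A J X) (J_field A J Y) Z p
    - torsion3 A g D (J_field A J X) Y (J_field A J Z) p
    - torsion3 A g D X (J_field A J Y) (J_field A J Z) p"
proof -
  note JX = vector_field_J_field[OF X] and JY = vector_field_J_field[OF Y] and JZ = vector_field_J_field[OF Z]
  note V = skew_hermitian_vector_field
  show ?thesis
    unfolding nijenhuis3_eq[OF X Y Z p] skew_hermitian_torsion[OF X Y Z p]
      skew_hermitian_torsion[OF JX JY Z p] skew_hermitian_torsion[OF JX Y JZ p]
      skew_hermitian_torsion[OF X JY JZ p]
    using skew_hermitian_J[OF JX Y Z p] skew_hermitian_J[OF JY X Z p] skew_hermitian_J[OF Y X JZ p]
      skew_hermitian_J[OF X Y JZ p] g_field_JJ[OF V[OF Y X] Z p] g_field_JJ[OF V[OF X Y] Z p]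
    by linarith
qed

text \<open>At \<open>JX\<close>, \<open>JY\<close>, \<open>JZ\<close> each torsion term of the
  exterior derivative contains a double \<open>J\<close>. Up to sign and order these are the three
  terms subtracted from the torsion in \<open>N\<close>, so their sum cancels.\<close>

lemma skew_hermitian_torsion_eq:
  assumes X: "X \<in> vector_fields A" and Y: "Y \<in> vector_fields A" and Z: "Z \<in> vector_fields A"
    and p: "p \<in> carrier A"
  shows "torsion3 A g D X Y Z p = hermitian_torsion X Y Z p"
proof -
  note JX = vector_field_J_field[OF X] and JY = vector_field_J_field[OF Y] and JZ = vector_field_J_field[OF Z]
  note T = skew_hermitian_three_form
  show ?thesis
    unfolding hermitian_torsion_def skew_hermitian_ext_deriv_kaehler[OF JX JY JZ p]
      skew_hermitian_nijenhuis[OF X Y Z p] skew_hermitian_torsion_JJ[OF JX JY Z p]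
      skew_hermitian_torsion_JJ[OF JX JZ Y p] skew_hermitian_torsion_JJ[OF JY JZ X p]
    using three_formD(2)[OF T JX Y JZ p] three_formD(2)[OF T JY X JZ p] three_formD(1)[OF T X JY JZ p]
    by linarith
qed

text \<open>Exchanging two arguments permutes the three torsion terms with a double \<open>J\<close>
  among themselves and reverses all signs.\<close>

lemma skew_hermitian_three_form_nijenhuis: "three_form A (nijenhuis3 A g J)"
proof (rule three_formI)
  show "\<exists>W. represents_form (nijenhuis3 A g J) X Y W"
    if "X \<in> vector_fields A" "Y \<in> vector_fields A" for X Y
    using represents_nijenhuis[OF that] by blast
  fix X Y Z p
  assume X: "X \<in> vector_fields A" and Y: "Y \<in> vector_fields A" and Z: "Z \<in> vector_fields A"
    and p: "p \<in> carrier A"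
  note JX = vector_field_J_field[OF X] and JY = vector_field_J_field[OF Y] and JZ = vector_field_J_field[OF Z]
  note T = three_formD(1,2)[OF skew_hermitian_three_form]
  show "nijenhuis3 A g J Y X Z p = - nijenhuis3 A g J X Y Z p \<and>
      nijenhuis3 A g J X Z Y p = - nijenhuis3 A g J X Y Z p"
    unfolding skew_hermitian_nijenhuis[OF X Y Z p] skew_hermitian_nijenhuis[OF Y X Z p]
      skew_hermitian_nijenhuis[OF X Z Y p]
    using T[OF X Y Z p] T[OF JX JY Z p] T[OF X JY JZ p] T[OF JX Y JZ p] by linarith
qed

lemma skew_hermitian_koszul:
  assumes X: "X \<in> vector_fields A" and Y: "Y \<in> vector_fields A" and Z: "Z \<in> vector_fields A"
    and p: "p \<in> carrier A"
  shows "2 * g_field g (D X Y) Z p = koszul A g X Y Z p + torsion3 A g D X Y Z p"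
  using D metric_connection_koszul[OF _ _ _ X Y Z p] unfolding skew_hermitian_connection_def by blast

end

end

theorem theorem10p1:
  fixes n :: nat
    and \<tau> :: "'a topology"
    and A :: "('a, 'b::euclidean_space) chart set"
    and g :: "'a \<Rightarrow> ('a, 'b) tvec \<Rightarrow> ('a, 'b) tvec \<Rightarrow> real"
    and J :: "'a \<Rightarrow> ('a, 'b) tvec \<Rightarrow> ('a, 'b) tvec"
  assumes "almost_hermitian_manifold \<tau> A g J"
    and "DIM('b) = 2 * n"
  shows "((\<exists>D. skew_hermitian_connection A g J D) \<longleftrightarrow> three_form A (nijenhuis3 A g J)) \<and>
    (three_form A (nijenhuis3 A g J) \<longrightarrow>
       (\<forall>D D'. skew_hermitian_connection A g J D \<longrightarrow> skew_hermitian_connection A g J D' \<longrightarrow>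
          (\<forall>X\<in>vector_fields A. \<forall>Y\<in>vector_fields A. D X Y = D' X Y)) \<and>
       (\<forall>D. skew_hermitian_connection A g J D \<longrightarrow>
          (\<forall>X\<in>vector_fields A. \<forall>Y\<in>vector_fields A. \<forall>Z\<in>vector_fields A. \<forall>p\<in>carrier A.
             torsion3 A g D X Y Z p =
               - ext_deriv A (kaehler_form A g J) (J_field A J X) (J_field A J Y) (J_field A J Z) p
               + nijenhuis3 A g J X Y Z p)) \<and>
       (\<exists>LC. levi_civita A g LC \<and>
          (\<forall>D. skew_hermitian_connection A g J D \<longrightarrow>
             (\<forall>X\<in>vector_fields A. \<forall>Y\<in>vector_fields A. \<forall>Z\<in>vector_fields A. \<forall>p\<in>carrier A.
                g_field g (D X Y) Z p =
                  g_field g (LC X Y) Z p + 1/2 * torsion3 A g D X Y Z p))))"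
proof -
  interpret almost_hermitian_manifold \<tau> A g J by (rule assms(1))
  have "(\<exists>D. skew_hermitian_connection A g J D) \<longleftrightarrow> three_form A (nijenhuis3 A g J)"
    using ex_skew_hermitian_connection skew_hermitian_three_form_nijenhuis by blast
  moreover have "D X Y = D' X Y"
    if D: "skew_hermitian_connection A g J D" and D': "skew_hermitian_connection A g J D'"
      and X: "X \<in> vector_fields A" and Y: "Y \<in> vector_fields A" for D D' X Y
  proof (rule vector_field_g_eqI[OF skew_hermitian_vector_field[OF D X Y] skew_hermitian_vector_field[OF D' X Y]])
    fix Z p assume Z: "Z \<in> vector_fields A" and p: "p \<in> carrier A"
    show "g_field g (D X Y) Z p = g_field g (D' X Y) Z p"
      using skew_hermitian_koszul[OF D X Y Z p] skew_hermitian_koszul[OF D' X Y Z p]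
        skew_hermitian_torsion_eq[OF D X Y Z p] skew_hermitian_torsion_eq[OF D' X Y Z p] by linarith
  qed
  moreover have "torsion3 A g D X Y Z p =
      - ext_deriv A (kaehler_form A g J) (J_field A J X) (J_field A J Y) (J_field A J Z) p
      + nijenhuis3 A g J X Y Z p"
    if "skew_hermitian_connection A g J D" "X \<in> vector_fields A" "Y \<in> vector_fields A"
      "Z \<in> vector_fields A" "p \<in> carrier A" for D X Y Z p
    using skew_hermitian_torsion_eq[OF that] unfolding hermitian_torsion_def .
  moreover obtain LC where LC: "levi_civita A g LC"
    and K: "\<And>X Y Z p. X \<in> vector_fields A \<Longrightarrow> Y \<in> vector_fields A \<Longrightarrow> Z \<in> vector_fields A \<Longrightarrow>
      p \<in> carrier A \<Longrightarrow> 2 * g_field g (LC X Y) Z p = koszul A g X Y Z p"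
    using ex_levi_civita by blast
  \<comment> \<open>The Koszul equations of \<open>D\<close> and \<open>LC\<close> differ only by
    the torsion term; the factor 2 on their left sides produces \<open>1/2\<close>.\<close>
  have "g_field g (D X Y) Z p = g_field g (LC X Y) Z p + 1/2 * torsion3 A g D X Y Z p"
    if D: "skew_hermitian_connection A g J D" and X: "X \<in> vector_fields A" and Y: "Y \<in> vector_fields A"
      and Z: "Z \<in> vector_fields A" and p: "p \<in> carrier A" for D X Y Z p
    using skew_hermitian_koszul[OF D X Y Z p] K[OF X Y Z p] by simp
  with LC have "\<exists>LC. levi_civita A g LC \<and> (\<forall>D. skew_hermitian_connection A g J D \<longrightarrow>
      (\<forall>X\<in>vector_fields A. \<forall>Y\<in>vector_fields A. \<forall>Z\<in>vector_fields A. \<forall>p\<in>carrier A.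
        g_field g (D X Y) Z p = g_field g (LC X Y) Z p + 1/2 * torsion3 A g D X Y Z p))"
    by blast
  ultimately show ?thesis by blast
qed

end
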